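(* Let $X=[\mathbb{R}_+^2,(0,0)]$ be the blow-up of $\mathbb{R}_+^2$ (coordinates $(x,t)$) at the origin, with blow-down map $\beta$ and boundary faces $G_1,G_2,G_3$, and let $F=\pi_2\circ\beta:X\to\mathbb{R}_+$, where $\pi_2(x,t)=t$. Let $K_1,K_2$ be index sets and $K_3=\{(n,0): n=1,2,3,\ldots\}$. Let $u$ be a compactly supported $b$-density on $X$, smooth in the interior of $X$, and write $u=u_A(x,y)\,\frac{dx}{x}\frac{dy}{y}$ with $y=t/x$. Define $\sigma:(0,\infty)^2\to\mathbb{C}$ by $$\sigma(x,\zeta)=\frac1x\,u_A\left(x,\frac1\zeta\right).$$ Then $$F_*u=\left(\int_0^\infty\sigma\left(x,\frac xt\right)dx\right)\frac{dt}{t},$$ and the following equivalences hold: (A) $\sigma$ is smooth in $\{x\ge 0,\ \zeta>0\}$ if and only if $u$ is polyhomogeneous at the interior $\mathring{G}_3$ of $G_3$ with index set $K_3$ (i.e. $u=xv$ with $v$ smooth up to $\mathring{G}_3$). (B) $\sigma$ has complete asymptotics, i.e. there are $\sigma_{\alpha k}\in C_0^\infty(\mathbb{R}_+)$, $(\alpha,k)\in K_1$, and constants $C_{NK}$ such that $$\left|\partial_1^K\left(\sigma(x,\zeta)-\sum_{(\alpha,k)\in K_1,\ \Re\alpha<N}\zeta^{-\alpha}\ln^k\zeta\;\sigma_{\alpha k}(x)\right)\right|\le C_{NK}\,\zeta^{-N}$$ for all $N,K$ and all $x>0$, $\zeta>1$, if and only if $u$ is polyhomogeneous with index sets $K_1$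 (at $G_1$) and $K_3$ (at $G_3$) on $X\cap\{y<1\}$ (i.e. near $A=G_1\cap G_3$). (C) Suppose $u\in\mathcal{A}^{(K_1,K_2,K_3)}(X)$, where $K_2$ is the minimal index set for $u$ at $G_2$ (i.e. the coefficients in the corresponding expansion are non-trivial). Then for every $p\in\mathbb{N}_0$ there is a constant $C_p$ with $$\int_0^1\zeta^p\left|\partial_1^p\sigma(\zeta t,\zeta)\right|d\zeta\le C_p\quad\text{for all } t\in[0,1]$$ if and only if $\Re K_2>0$, i.e. $\Re\alpha>0$ for all $(\alpha,k)\in K_2$. (This is the condition that $\Re\mathcal{K}(G)>0$ for every boundary hypersurface $G$ of $X$ in $\mathrm{null}(e_F)=\{G_2\}$.)
   Context: Notation: $\mathbb{R}_+=[0,\infty)$, $\mathbb{N}_0=\{0,1,2,\ldots\}$, and $\partial_1,\partial_2$ denote partial derivatives in the first and second argument. $C_0^\infty(\mathbb{R}_+)$ denotes restrictions to $[0,\infty)$ of smooth compactly supported functions on $\mathbb{R}$ (smooth up to $0$, not necessarily vanishing there). Blow-up. $X=[\mathbb{R}_+^2,(0,0)]$ may be defined as $[0,\pi/2]\times\mathbb{R}_+$ with blow-down map $\beta(\theta,r)=(r\cos\theta,r\sin\theta)=(x,t)$. Its boundary faces are $G_1=\{\theta=0\}$ (lift of the $x$-axis $\{t=0\}$), $G_2=\{\theta=\pi/2\}$ (lift of the $t$-axis $\{x=0\}$) and $G_3=\{r=0\}$. The corners are $A=G_1\cap G_3$ and $B=G_2\cap G_3$. The functions $x,t$ are regarded as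 functions on $X$ via $\beta$. On the interior set $y=t/x$ and $\zeta=x/t=1/y$. Then $(x,y)$ are coordinates on $X\setminus G_2$, with $x,y\ge0$ boundary defining functions for $G_3,G_1$ respectively. Likewise $(\zeta,t)$ are coordinates on $X\setminus G_1$, with $\zeta,t\ge0$ boundary defining functions for $G_2,G_3$ respectively. $b$-densities. A $b$-density $u$ on $X$ is written $u=u_A(x,y)\frac{dx}{x}\frac{dy}{y}$ in the coordinates $(x,y)$ and $u=u_B(\zeta,t)\frac{d\zeta}{\zeta}\frac{dt}{t}$ in the coordinates $(\zeta,t)$ (absolute value signs omitted). On the interior, $\frac{dx}{x}\frac{dy}{y}=\frac{d\zeta}{\zeta}\frac{dt}{t}$, so $u_B(\zeta,t)=u_A(\zeta t,1/\zeta)$. Smoothness and polyhomogeneity of $u$ mean those of the coefficient functions $u_A$, $u_B$. Compact support means compact support in $X$ (the support may meet the boundary). Push-forward. $F_*u$ is the $b$-density on $\mathbb{R}_+$ (on $t>0$) determined by $\langle F_*u,\varphi\rangle=\int_X (\varphi\circ F)\,u$ for test functions $\varphi$, whenever the integrals involved converge. Index sets. An index set is a non-empty discrete set $K\subset\mathbb{C}\times\mathbb{N}_0$ such that: (i) $(\alpha_j,k_j)\in K$ and $|(\alpha_j,k_j)|\to\infty$ imply $\Re\alpha_j\to\infty$; (ii) $(\alpha,k)\in K$ and $p\in\mathbb{N}$ imply $(\alpha+p,k)\in K$; (iii) $(\alpha,k)\in K$ and $0\le p<k$ imply $(\alpha,p)\in K$. The set $K_3=\{(n,0):n\ge1\}$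 is the index set of smooth functions vanishing to first order at $G_3$. Polyhomogeneity. Informally, $u$ is polyhomogeneous with index set $K$ at a boundary hypersurface $H$ with defining function $\rho$ if $u\sim\sum_{(\alpha,k)\in K}\rho^\alpha\ln^k\rho\,v_{\alpha k}$ near $H$, with coefficients $v_{\alpha k}$ that are polyhomogeneous on $H$ for the restricted index family. Precisely: - At $\mathring{G}_3$ with index set $K_3$: $u=xv$ with $v$ smooth up to $\mathring{G}_3$. - Near $A$ with index sets $K_1,K_3$: $u$ has such asymptotic expansions at the interiors of $G_1$ and $G_3$, jointly uniformly up to $A$, meaning that for all $N$, $$u_A(x,y)-\sum_{(\alpha,k)\in K_1,\ \Re\alpha<N}y^\alpha\ln^k y\;u_{\alpha k}(x)$$ is an $N$ times differentiable function in $x\ge0,y\ge0$ vanishing to order $N$ at $G_1=\{y=0\}$, where the coefficients $u_{\alpha k}(x)$ are polyhomogeneous at $x=0$ with index set $K_3$ (i.e. $x$ times a function smooth up to $x=0$). - Near $B$ with index sets $K_2,K_3$: the analogous condition on $u_B(\zeta,t)$, with $\zeta$ in the role of $y$, $t$ in the role of $x$, $G_2=\{\zeta=0\}$ in the role of $G_1$, and $K_2$ in the role of $K_1$. $\mathcal{A}^{(K_1,K_2,K_3)}(X)$ is the space of those $u$ that are smooth in the interior and polyhomogeneous everywhere on $X$ with index set $K_i$ at $G_i$, $i=1,2,3$. Exponents of $F$. The map $F$ is a $b$-fibration, with exponents $e_F(G_1,\{0\})=1$, $e_F(G_2,\{0\})=0$, $e_F(G_3,\{0\})=1$ (the order of vanishing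 of $F^*t$ at $G_i$). $\mathrm{null}(e_F)$ is the set of boundary hypersurfaces of $X$ whose exponents with respect to all boundary hypersurfaces of the target vanish; here it is $\{G_2\}$.
   Formalization: (B) assumes every derivative of σ is O(ζ^M) for some M on x>0, ζ>1 (for "phg ⇒ estimates", phg on {y≤1} suffices instead); expansions sum over Re α ≤ N, not < N; in (C) K_2 is minimal for u at G_2 over 0≤t≤1 (not needed for Re K_2>0 ⇒ bound). *)

theory Defs
  imports "HOL-Analysis.Analysis"
begin

subsection \<open>Differentiability up to the boundary\<close>

definition smooth_real :: "(real \<Rightarrow> complex) \<Rightarrow> bool" where
  "smooth_real f \<longleftrightarrow>
     (\<exists>D. D 0 = f \<and> (\<forall>n x. (D n has_vector_derivative D (Suc n) x) (at x)))"

definition C0_infinity_Rplus :: "(real \<Rightarrow> complex) set" where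
  "C0_infinity_Rplus =
     {f. \<exists>g. smooth_real g \<and> compact (closure {x. g x \<noteq> 0}) \<and> (\<forall>x\<ge>0. f x = g x)}"

text \<open>\<open>partials_upto n A B f D\<close>: \<open>f\<close> is \<open>n\<close> times continuously differentiable on
  \<open>A \<times> B\<close> and \<open>D i j\<close> is its derivative of order \<open>i\<close> in the first and \<open>j\<close> in the second
  argument, for \<open>i + j \<le> n\<close>. Here \<open>A\<close>, \<open>B\<close> are nondegenerate intervals; at end points that
  belong to them the derivatives are one-sided.\<close>

definition partials_upto ::
  "nat \<Rightarrow> real set \<Rightarrow> real set \<Rightarrow> (real \<Rightarrow> real \<Rightarrow> complex)
     \<Rightarrow> (nat \<Rightarrow> nat \<Rightarrow> real \<Rightarrow> real \<Rightarrow> complex) \<Rightarrow> bool" where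
  "partials_upto n A B f D \<longleftrightarrow>
     (\<forall>x\<in>A. \<forall>y\<in>B. D 0 0 x y = f x y) \<and>
     (\<forall>i j. i + j \<le> n \<longrightarrow> continuous_on (A \<times> B) (\<lambda>(x, y). D i j x y)) \<and>
     (\<forall>i j. i + j < n \<longrightarrow> (\<forall>x\<in>A. \<forall>y\<in>B.
        ((\<lambda>s. D i j s y) has_vector_derivative D (Suc i) j x y) (at x within A) \<and>
        ((\<lambda>s. D i j x s) has_vector_derivative D i (Suc j) x y) (at y within B)))"

definition smooth_on_prod ::
  "real set \<Rightarrow> real set \<Rightarrow> (real \<Rightarrow> real \<Rightarrow> complex) \<Rightarrow> bool" where
  "smooth_on_prod A B f \<longleftrightarrow> (\<exists>D. \<forall>n. partials_upto n A B f D)"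

definition nth_deriv :: "real set \<Rightarrow> nat \<Rightarrow> (real \<Rightarrow> complex) \<Rightarrow> real \<Rightarrow> complex" where
  "nth_deriv S n f = ((\<lambda>g x. vector_derivative g (at x within S)) ^^ n) f"


subsection \<open>The blow-up of the quarter plane\<close>

definition blowup_X :: "(real \<times> real) set" where
  "blowup_X = {0..pi/2} \<times> {0..}"

definition blowdown :: "real \<times> real \<Rightarrow> real \<times> real" where
  "blowdown = (\<lambda>(\<theta>, r). (r * cos \<theta>, r * sin \<theta>))"

definition F_map :: "real \<times> real \<Rightarrow> real" where
  "F_map = snd \<circ> blowdown"

text \<open>\<open>ptA x y\<close> is the point of \<open>X - G\<^sub>2\<close> with coordinates \<open>(x, y)\<close>, \<open>y = t/x\<close>, and
  \<open>ptB \<zeta> t\<close> is the point of \<open>X - G\<^sub>1\<close> with coordinates \<open>(\<zeta>, t)\<close>, \<open>\<zeta> = x/t\<close>.\<close>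

definition ptA :: "real \<Rightarrow> real \<Rightarrow> real \<times> real" where
  "ptA x y = (arctan y, x * sqrt (1 + y\<^sup>2))"

definition ptB :: "real \<Rightarrow> real \<Rightarrow> real \<times> real" where
  "ptB \<zeta> t = (pi/2 - arctan \<zeta>, t * sqrt (1 + \<zeta>\<^sup>2))"

lemma blowdown_ptA: "blowdown (ptA x y) = (x, x * y)"
proof -
  have "sqrt (1 + y\<^sup>2) > 0" by (simp add: add_pos_nonneg)
  then show ?thesis
    by (simp add: blowdown_def ptA_def cos_arctan sin_arctan)
qed

lemma blowdown_ptB: "blowdown (ptB \<zeta> t) = (\<zeta> * t, t)"
proof -
  have "sqrt (1 + \<zeta>\<^sup>2) > 0" by (simp add: add_pos_nonneg)
  then show ?thesis
    by (simp add: blowdown_def ptB_def cos_diff sin_diff cos_arctan sin_arctan)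
qed

lemma ptB_eq_ptA:
  assumes "\<zeta> > 0"
  shows "ptB \<zeta> t = ptA (\<zeta> * t) (1 / \<zeta>)"
proof -
  have "\<zeta> * sqrt (1 + (1/\<zeta>)\<^sup>2) = sqrt (\<zeta>\<^sup>2 * (1 + (1/\<zeta>)\<^sup>2))"
    using assms by (simp add: real_sqrt_mult)
  also have "\<zeta>\<^sup>2 * (1 + (1/\<zeta>)\<^sup>2) = 1 + \<zeta>\<^sup>2"
    using assms by (simp add: field_simps)
  finally have "\<zeta> * sqrt (1 + (1/\<zeta>)\<^sup>2) = sqrt (1 + \<zeta>\<^sup>2)" .
  moreover have "arctan (1 / \<zeta>) = pi/2 - arctan \<zeta>"
    using assms arctan_inverse[of \<zeta>] by (simp add: inverse_eq_divide)
  ultimately show ?thesis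
    by (simp add: ptA_def ptB_def algebra_simps)
qed


subsection \<open>b-densities and their push-forward\<close>

text \<open>A b-density on \<open>X\<close> is represented by its coefficient, a function on the points
  \<open>(\<theta>, r)\<close> of \<open>X\<close>, with respect to \<open>dx/x dy/y = d\<zeta>/\<zeta> dt/t\<close>. Only its values in the
  interior are ever used.\<close>

definition coefA :: "(real \<times> real \<Rightarrow> complex) \<Rightarrow> real \<Rightarrow> real \<Rightarrow> complex" where
  "coefA u x y = u (ptA x y)"

definition coefB :: "(real \<times> real \<Rightarrow> complex) \<Rightarrow> real \<Rightarrow> real \<Rightarrow> complex" where
  "coefB u \<zeta> t = u (ptB \<zeta> t)"

lemma coefB_eq_coefA: "\<zeta> > 0 \<Longrightarrow> coefB u \<zeta> t = coefA u (\<zeta> * t) (1 / \<zeta>)"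
  by (simp add: coefA_def coefB_def ptB_eq_ptA)

definition smooth_in_interior :: "(real \<times> real \<Rightarrow> complex) \<Rightarrow> bool" where
  "smooth_in_interior u \<longleftrightarrow> smooth_on_prod {0<..} {0<..} (coefA u)"

definition compactly_supported :: "(real \<times> real \<Rightarrow> complex) \<Rightarrow> bool" where
  "compactly_supported u \<longleftrightarrow> compact (closure {p \<in> interior blowup_X. u p \<noteq> 0})"

text \<open>\<open>\<integral>\<^sub>X f u\<close> is computed in the chart \<open>(x, y)\<close>, which covers the interior of \<open>X\<close>.\<close>

definition integrand ::
  "(real \<times> real \<Rightarrow> complex) \<Rightarrow> (real \<times> real \<Rightarrow> complex) \<Rightarrow> real \<times> real \<Rightarrow> complex" where
  "integrand f u = (\<lambda>(x, y). f (ptA x y) * coefA u x y / of_real (x * y))"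

definition X_integrable :: "(real \<times> real \<Rightarrow> complex) \<Rightarrow> (real \<times> real \<Rightarrow> complex) \<Rightarrow> bool" where
  "X_integrable f u \<longleftrightarrow> set_integrable lborel ({0<..} \<times> {0<..}) (integrand f u)"

definition X_integral :: "(real \<times> real \<Rightarrow> complex) \<Rightarrow> (real \<times> real \<Rightarrow> complex) \<Rightarrow> complex" where
  "X_integral f u = set_lebesgue_integral lborel ({0<..} \<times> {0<..}) (integrand f u)"

definition test_function :: "(real \<Rightarrow> complex) \<Rightarrow> bool" where
  "test_function \<phi> \<longleftrightarrow> smooth_real \<phi> \<and> compact (closure {t. \<phi> t \<noteq> 0}) \<and>
     closure {t. \<phi> t \<noteq> 0} \<subseteq> {0<..}"

text \<open>\<open>is_pushforward u h\<close> says \<open>F\<^sub>*u = h dt/t\<close> on \<open>t > 0\<close>.\<close>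

definition is_pushforward :: "(real \<times> real \<Rightarrow> complex) \<Rightarrow> (real \<Rightarrow> complex) \<Rightarrow> bool" where
  "is_pushforward u h \<longleftrightarrow> (\<forall>\<phi>. test_function \<phi> \<longrightarrow> X_integrable (\<phi> \<circ> F_map) u \<longrightarrow>
     set_integrable lborel {0<..} (\<lambda>t. \<phi> t * h t / of_real t) \<and>
     (LINT t:{0<..}|lborel. \<phi> t * h t / of_real t) = X_integral (\<phi> \<circ> F_map) u)"

definition sigma :: "(real \<times> real \<Rightarrow> complex) \<Rightarrow> real \<Rightarrow> real \<Rightarrow> complex" where
  "sigma u x \<zeta> = coefA u x (1 / \<zeta>) / of_real x"

text \<open>Continuous extension to \<open>x = 0\<close>; meaningful if \<open>\<sigma>\<close> is smooth in \<open>x \<ge> 0\<close>, \<open>\<zeta> > 0\<close>.\<close>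

definition sigma_ext :: "(real \<times> real \<Rightarrow> complex) \<Rightarrow> real \<Rightarrow> real \<Rightarrow> complex" where
  "sigma_ext u x \<zeta> = (if x = 0 then Lim (at_right 0) (\<lambda>s. sigma u s \<zeta>) else sigma u x \<zeta>)"


subsection \<open>Index sets and polyhomogeneity\<close>

text \<open>Discreteness is meant in the closed sense (no accumulation points), so that only
  finitely many elements lie in each half plane \<open>Re \<alpha> \<le> N\<close>.\<close>

definition index_set :: "(complex \<times> nat) set \<Rightarrow> bool" where
  "index_set K \<longleftrightarrow> K \<noteq> {} \<and> (\<forall>z. \<not> z islimpt K) \<and>
     (\<forall>s :: nat \<Rightarrow> complex \<times> nat. (\<forall>j. s j \<in> K) \<longrightarrow>
        filterlim (\<lambda>j. norm (fst (s j), real (snd (s j)))) at_top sequentially \<longrightarrow>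
        filterlim (\<lambda>j. Re (fst (s j))) at_top sequentially) \<and>
     (\<forall>\<alpha> k p. (\<alpha>, k) \<in> K \<longrightarrow> (\<alpha> + of_nat p, k) \<in> K) \<and>
     (\<forall>\<alpha> k p. (\<alpha>, k) \<in> K \<longrightarrow> p < k \<longrightarrow> (\<alpha>, p) \<in> K)"

text \<open>The truncation keeps the terms with \<open>Re \<alpha> = N\<close>: a term \<open>y\<^sup>N ln y\<close> is neither
  \<open>N\<close> times differentiable at \<open>y = 0\<close> nor \<open>O(y\<^sup>N)\<close>, so remainders of
  order \<open>N\<close> can only be asked for after these terms have been removed.\<close>

definition upto_order :: "(complex \<times> nat) set \<Rightarrow> nat \<Rightarrow> (complex \<times> nat) set" where
  "upto_order K N = {(\<alpha>, k) \<in> K. Re \<alpha> \<le> real N}"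

lemma finite_upto_order:
  assumes "index_set K"
  shows "finite (upto_order K N)"
proof (rule ccontr)
  let ?g = "\<lambda>z :: complex \<times> nat. (fst z, real (snd z))"
  assume inf: "infinite (upto_order K N)"
  have sub: "upto_order K N \<subseteq> K" by (auto simp: upto_order_def)
  have bdd: "finite {z \<in> upto_order K N. norm (?g z) \<le> R}" for R
  proof (rule ccontr)
    let ?B = "{z \<in> upto_order K N. norm (?g z) \<le> R}"
    assume "infinite ?B"
    have in_box: "?B \<subseteq> cball 0 R \<times> {..nat \<lfloor>R\<rfloor>}"
    proof
      fix z assume z: "z \<in> ?B"
      then have "norm (fst z) \<le> R" "real (snd z) \<le> R"
        using norm_fst_le[of "fst z" "real (snd z)"] norm_snd_le[of "real (snd z)" "fst z"] by auto
      then show "z \<in> cball 0 R \<times> {..nat \<lfloor>R\<rfloor>}"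
        by (cases z) (auto simp: le_nat_floor)
    qed
    have "compact (cball (0::complex) R \<times> {..nat \<lfloor>R\<rfloor>})"
      by (intro compact_Times compact_cball finite_imp_compact) auto
    from Heine_Borel_imp_Bolzano_Weierstrass[OF this \<open>infinite ?B\<close> in_box]
    obtain z where "z islimpt ?B" by blast
    then have "z islimpt K" by (rule islimpt_subset) (use sub in auto)
    then show False using assms unfolding index_set_def by blast
  qed
  have "\<exists>z \<in> upto_order K N. norm (?g z) > real j" for j
  proof (rule ccontr)
    assume "\<not> ?thesis"
    then have "upto_order K N = {z \<in> upto_order K N. norm (?g z) \<le> real j}" by force
    then show False using bdd[of "real j"] inf by simp
  qed
  then obtain s where s: "\<And>j. s j \<in> upto_order K N" "\<And>j. norm (?g (s j)) > real j"
    by metis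
  have "filterlim (\<lambda>j. norm (?g (s j))) at_top sequentially"
    by (rule filterlim_at_top_mono[OF filterlim_real_sequentially])
      (use s(2) in \<open>auto intro!: always_eventually less_imp_le\<close>)
  then have "filterlim (\<lambda>j. Re (fst (s j))) at_top sequentially"
    using assms s(1) sub unfolding index_set_def by blast
  then have "eventually (\<lambda>j. Re (fst (s j)) \<ge> real N + 1) sequentially"
    by (auto simp: filterlim_at_top)
  then obtain j where "Re (fst (s j)) \<ge> real N + 1"
    by (auto simp: eventually_sequentially)
  with s(1)[of j] show False by (auto simp: upto_order_def)
qed

text \<open>In the following, \<open>f\<close> is \<open>u\<^sub>A\<close> as a function of \<open>(x, y)\<close>, or \<open>u\<^sub>B\<close> as a function of
  \<open>(t, \<zeta>)\<close>: the first argument is the defining function of \<open>G\<^sub>3\<close>, the second the one of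
  the other face at the corner. The index set at \<open>G\<^sub>3\<close> is \<open>K\<^sub>3 = {(n,0). n \<ge> 1}\<close> throughout.
  The expansion is required over the part \<open>S \<times> Y\<close> of the coordinate quadrant, with
  \<open>0 \<in> S\<close>, \<open>0 \<in> Y\<close>.\<close>

definition phg_face3 :: "real set \<Rightarrow> real set \<Rightarrow> (real \<Rightarrow> real \<Rightarrow> complex) \<Rightarrow> bool" where
  "phg_face3 S Y f \<longleftrightarrow> (\<exists>v. smooth_on_prod S (Y \<inter> {0<..}) v \<and>
     (\<forall>x\<in>S. \<forall>y\<in>Y. x > 0 \<longrightarrow> y > 0 \<longrightarrow> f x y = of_real x * v x y))"

definition phg_corner ::
  "real set \<Rightarrow> real set \<Rightarrow> (complex \<times> nat) set \<Rightarrow> (real \<Rightarrow> real \<Rightarrow> complex) \<Rightarrow> bool" where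
  "phg_corner S Y K f \<longleftrightarrow> phg_face3 S Y f \<and>
     (\<exists>c :: complex \<Rightarrow> nat \<Rightarrow> real \<Rightarrow> complex.
        (\<forall>(\<alpha>, k)\<in>K. \<exists>g. smooth_real g \<and> (\<forall>x\<in>S. c \<alpha> k x = of_real x * g x)) \<and>
        (\<forall>N. \<exists>R D. partials_upto N S Y R D \<and>
           (\<forall>x\<in>S. \<forall>j<N. D 0 j x 0 = 0) \<and>
           (\<forall>x\<in>S. \<forall>y\<in>Y. x > 0 \<longrightarrow> y > 0 \<longrightarrow>
              f x y - (\<Sum>(\<alpha>, k)\<in>upto_order K N.
                 of_real y powr \<alpha> * of_real (ln y) ^ k * c \<alpha> k x) = R x y)))"

text \<open>\<open>u \<in> \<A>\<^sup>(\<^sup>K\<^sup>1\<^sup>,\<^sup>K\<^sup>2\<^sup>,\<^sup>K\<^sup>3\<^sup>)(X)\<close>; the two coordinate quadrants together cover \<open>X\<close>.\<close>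

definition phg_X ::
  "(complex \<times> nat) set \<Rightarrow> (complex \<times> nat) set \<Rightarrow> (real \<times> real \<Rightarrow> complex) \<Rightarrow> bool" where
  "phg_X K1 K2 u \<longleftrightarrow> smooth_in_interior u \<and>
     phg_corner {0..} {0..} K1 (coefA u) \<and>
     phg_corner {0..} {0..} K2 (\<lambda>t \<zeta>. coefB u \<zeta> t)"

text \<open>\<open>K2\<close> is contained in every index set that serves for \<open>u\<close> at \<open>G\<^sub>2\<close> over \<open>0 \<le> t \<le> 1\<close>.
  The restriction of \<open>t\<close> to the range of the integral condition is essential: an expansion
  coefficient supported in \<open>t > 1\<close> is not seen by that condition.\<close>

definition minimal_at_G2 :: "(complex \<times> nat) set \<Rightarrow> (real \<times> real \<Rightarrow> complex) \<Rightarrow> bool" where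
  "minimal_at_G2 K2 u \<longleftrightarrow> (\<forall>K'. index_set K' \<longrightarrow>
     phg_corner {0..1} {0..} K' (\<lambda>t \<zeta>. coefB u \<zeta> t) \<longrightarrow> K2 \<subseteq> K')"


subsection \<open>The conditions on \<open>\<sigma>\<close>\<close>

definition sigma_smooth :: "(real \<times> real \<Rightarrow> complex) \<Rightarrow> bool" where
  "sigma_smooth u \<longleftrightarrow> (\<exists>\<tau>. smooth_on_prod {0..} {0<..} \<tau> \<and>
     (\<forall>x>0. \<forall>\<zeta>>0. \<tau> x \<zeta> = sigma u x \<zeta>))"

definition complete_asymptotics ::
  "(complex \<times> nat) set \<Rightarrow> (real \<times> real \<Rightarrow> complex) \<Rightarrow> bool" where
  "complete_asymptotics K1 u \<longleftrightarrow>
     (\<exists>s :: complex \<Rightarrow> nat \<Rightarrow> real \<Rightarrow> complex. (\<forall>(\<alpha>, k)\<in>K1. s \<alpha> k \<in> C0_infinity_Rplus) \<and>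
        (\<forall>N K. \<exists>C. \<forall>x>0. \<forall>\<zeta>>1.
           norm (nth_deriv {0<..} K
             (\<lambda>x. sigma u x \<zeta> - (\<Sum>(\<alpha>, k)\<in>upto_order K1 N.
                of_real \<zeta> powr (- \<alpha>) * of_real (ln \<zeta>) ^ k * s \<alpha> k x)) x)
           \<le> C * \<zeta> powr (- real N)))"

text \<open>Every derivative of \<open>\<sigma>\<close> grows at most polynomially as \<open>\<zeta> \<rightarrow> \<infinity>\<close>. The estimates in
  \<^const>\<open>complete_asymptotics\<close> contain no derivatives in \<open>\<zeta>\<close> and do not imply this, whereas
  polyhomogeneity of \<open>u\<close> near \<open>A\<close> does: with a cut-off \<open>\<chi>\<close>, a function \<open>\<sigma>\<close> that equals
  \<open>\<chi>(x) exp(-\<zeta>) sin(exp(\<zeta>\<^sup>2))\<close> for \<open>\<zeta> > 1\<close> has complete asymptotics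
  with vanishing coefficients, but the corresponding \<open>u\<close> is not polyhomogeneous at \<open>A\<close>.\<close>

definition tempered_derivatives :: "(real \<times> real \<Rightarrow> complex) \<Rightarrow> bool" where
  "tempered_derivatives u \<longleftrightarrow> (\<forall>i j. \<exists>C M. \<forall>x>0. \<forall>\<zeta>>1.
     norm (nth_deriv {0<..} i (\<lambda>x. nth_deriv {0<..} j (sigma u x) \<zeta>) x) \<le> C * \<zeta> powr M)"

definition integral_condition :: "(real \<times> real \<Rightarrow> complex) \<Rightarrow> bool" where
  "integral_condition u \<longleftrightarrow> (\<forall>p. \<exists>C :: real. \<forall>t\<in>{0..1}.
     (\<integral>\<^sup>+\<zeta>\<in>{0<..<1}. ennreal (\<zeta> ^ p *
        norm (nth_deriv {0..} p (\<lambda>x. sigma_ext u x \<zeta>) (\<zeta> * t))) \<partial>lborel) \<le> ennreal C)"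

end

(* In the coordinates (x, y), sigma = u_A / x with zeta = 1/y, and in the coordinates (zeta, t) it is
   w(x / zeta, zeta) / zeta with w = u_B / t. Fubini on the fibres y = t/x gives the push-forward, and
   statement (A) is the chain rule for y = 1/zeta.

   From polyhomogeneity to asymptotics: a remainder that is M times differentiable and vanishes to
   order M at y = 0 has x-derivatives of order K bounded by y^(M - K); Hadamard's lemma divides by x,
   and the terms between orders N and M are harmless.

   From asymptotics to polyhomogeneity: the remainder after N terms has pure x-derivatives O(y^N) and
   mixed derivatives that grow at most like a power of 1/y independent of N. Landau interpolation
   between these, with N large, makes any given mixed derivative decay as fast as desired.

   In (C) the p-th integral is that of the p-th t-derivative of w against d zeta / zeta, which is
   finite if all exponents have positive real part. Conversely a sum of terms zeta^alpha ln^k zeta,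
   Re alpha <= 0, that is integrable against d zeta / zeta is zero: f(q zeta) - q^mu f(zeta) is again
   such a sum with one term less, so induction applies. Hence the coefficients with Re alpha <= 0
   vanish for t <= 1, and by minimality no such exponents occur. *)
theory Submission
  imports Defs
begin

subsection \<open>Families of derivatives\<close>

text \<open>On the half-open range y < 1 the corner condition gives no uniformity as y tends to 1,
  whereas complete asymptotics ask for constants valid for all \<zeta> > 1. On y \<le> 1/2
  compactness gives the estimates; on 1/2 \<le> y < 1 the uniformity comes either from tempered
  derivatives or from a corner condition on the closed range y \<le> 1. Hence the two versions of
  that implication.

  Conversely, asymptotics say nothing about derivatives in \<zeta> and nothing about x = 0.
  Temperedness bounds all mixed derivatives on compact ranges of y, and these bounds carry every
  derivative to x = 0. The growth exponent in the interpolation does not depend on N because the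
  real parts in an index set are bounded below.

  The terms between orders N and M are harmless because truncation keeps Re \<alpha> = N: the terms
  in between have Re \<alpha> > N strictly, and the excess absorbs logarithms.

  In (C), terms with equal real part can oscillate against each other, so there is no leading term
  to argue with; dilations separate the exponents instead.\<close>

definition derivs_on :: "real set \<Rightarrow> (nat \<Rightarrow> real \<Rightarrow> complex) \<Rightarrow> bool" where
  "derivs_on A a \<longleftrightarrow> (\<forall>n. \<forall>x\<in>A. (a n has_vector_derivative a (Suc n) x) (at x within A))"

lemma derivs_onD:
  "derivs_on A a \<Longrightarrow> x \<in> A \<Longrightarrow> (a n has_vector_derivative a (Suc n) x) (at x within A)"
  by (simp add: derivs_on_def)

lemma derivs_on_subset: "derivs_on A a \<Longrightarrow> B \<subseteq> A \<Longrightarrow> derivs_on B a"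
  unfolding derivs_on_def by (meson has_vector_derivative_within_subset subsetD)

lemma derivs_on_continuous: "derivs_on A a \<Longrightarrow> continuous_on A (a n)"
  unfolding derivs_on_def
  by (meson continuous_on_eq_continuous_within has_vector_derivative_continuous)

lemma smooth_real_iff: "smooth_real f \<longleftrightarrow> (\<exists>D. D 0 = f \<and> derivs_on UNIV D)"
  by (simp add: smooth_real_def derivs_on_def)

lemma has_vector_derivative_cong_within:
  assumes "(f has_vector_derivative d) (at x within A)" "\<And>y. y \<in> A \<Longrightarrow> f y = g y" "x \<in> A" "d = e"
  shows "(g has_vector_derivative e) (at x within A)"
  using has_vector_derivative_transform[of x A g f d] assms by auto

text \<open>\<open>nth_deriv\<close> is built from a choice operator; a known family of derivatives
  determines it because limits within S are unique at every point that is not isolated in S.\<close>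

lemma nth_deriv_eq:
  assumes "derivs_on S D" "\<And>x. x \<in> S \<Longrightarrow> D 0 x = f x" "\<And>x. x \<in> S \<Longrightarrow> at x within S \<noteq> bot" "x \<in> S"
  shows "nth_deriv S n f x = D n x"
  using assms(4)
proof (induction n arbitrary: x)
  case 0
  then show ?case using assms(2) by (simp add: nth_deriv_def)
next
  case (Suc n)
  have "(nth_deriv S n f has_vector_derivative D (Suc n) x) (at x within S)"
    by (rule has_vector_derivative_cong_within[OF derivs_onD[OF assms(1) Suc.prems, of n]])
      (use Suc in auto)
  then have "vector_derivative (nth_deriv S n f) (at x within S) = D (Suc n) x"
    using assms(3)[OF Suc.prems] by (intro vector_derivative_within)
  then show ?case by (simp add: nth_deriv_def)
qed

lemma at_within_gt0: "0 < x \<Longrightarrow> at (x::real) within {0<..} \<noteq> bot"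
  by (simp add: at_within_open[of x "{0<..}"])

lemma at_within_ge0: "0 \<le> x \<Longrightarrow> at (x::real) within {0..} \<noteq> bot"
  using trivial_limit_within[of x "{0..}"] islimpt_greaterThanLessThan1[of x "x+1"]
  by (metis atLeast_iff greaterThanLessThan_iff islimpt_subset less_add_one less_eq_real_def order_trans subsetI)

section \<open>The product rule of arbitrary order\<close>

definition leibniz :: "(nat \<Rightarrow> real \<Rightarrow> complex) \<Rightarrow> (nat \<Rightarrow> real \<Rightarrow> complex) \<Rightarrow> nat \<Rightarrow> real \<Rightarrow> complex" where
  "leibniz a b n x = (\<Sum>k\<le>n. of_nat (n choose k) * (a k x * b (n - k) x))"

text \<open>The right-hand side is what termwise differentiation of the formula of order n produces;
  Pascal's rule regroups the binomial sum of order n + 1 into it.\<close>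

lemma leibniz_Suc:
  "leibniz a b (Suc n) x
    = (\<Sum>k\<le>n. of_nat (n choose k) * (a (Suc k) x * b (n - k) x + a k x * b (Suc n - k) x))"
proof -
  have 1: "leibniz a b (Suc n) x = a 0 x * b (Suc n) x +
      (\<Sum>k\<le>n. of_nat (Suc n choose Suc k) * (a (Suc k) x * b (n - k) x))"
    unfolding leibniz_def by (subst sum.atMost_Suc_shift) simp
  have 2: "(\<Sum>k\<le>n. of_nat (Suc n choose Suc k) * (a (Suc k) x * b (n - k) x)) =
     (\<Sum>k\<le>n. of_nat (n choose k) * (a (Suc k) x * b (n - k) x)) +
     (\<Sum>k\<le>n. of_nat (n choose Suc k) * (a (Suc k) x * b (n - k) x))"
    by (simp add: sum.distrib algebra_simps)
  have 3: "(\<Sum>k\<le>Suc n. of_nat (n choose k) * (a k x * b (Suc n - k) x))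
     = a 0 x * b (Suc n) x + (\<Sum>k\<le>n. of_nat (n choose Suc k) * (a (Suc k) x * b (n - k) x))"
    by (subst sum.atMost_Suc_shift) simp
  have 4: "(\<Sum>k\<le>Suc n. of_nat (n choose k) * (a k x * b (Suc n - k) x)) =
     (\<Sum>k\<le>n. of_nat (n choose k) * (a k x * b (Suc n - k) x))"
    by simp
  have 5: "(\<Sum>k\<le>n. of_nat (n choose k) * (a (Suc k) x * b (n - k) x + a k x * b (Suc n - k) x)) =
     (\<Sum>k\<le>n. of_nat (n choose k) * (a (Suc k) x * b (n - k) x)) +
     (\<Sum>k\<le>n. of_nat (n choose k) * (a k x * b (Suc n - k) x))"
    unfolding distrib_left sum.distrib ..
  show ?thesis using 1 2 3 4 5 by (simp del: sum.atMost_Suc)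
qed

lemma leibniz_has_vector_derivative:
  assumes "\<And>k. k \<le> n \<Longrightarrow> (a k has_vector_derivative a (Suc k) x) (at x within A)"
    and "\<And>k. k \<le> n \<Longrightarrow> (b k has_vector_derivative b (Suc k) x) (at x within A)"
  shows "(leibniz a b n has_vector_derivative leibniz a b (Suc n) x) (at x within A)"
  unfolding leibniz_Suc unfolding leibniz_def
proof (intro has_vector_derivative_sum has_vector_derivative_mult_right)
  fix k assume "k \<in> {..n}"
  then have k: "k \<le> n" "n - k \<le> n" "Suc n - k = Suc (n - k)" by auto
  show "((\<lambda>x. a k x * b (n - k) x) has_vector_derivative
         a (Suc k) x * b (n - k) x + a k x * b (Suc n - k) x) (at x within A)"
    unfolding k(3) using has_vector_derivative_mult[OF assms(1)[OF k(1)] assms(2)[OF k(2)]]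
    by (simp add: add.commute)
qed

lemma derivs_on_leibniz: "derivs_on A a \<Longrightarrow> derivs_on A b \<Longrightarrow> derivs_on A (leibniz a b)"
  by (simp add: derivs_on_def leibniz_has_vector_derivative)

lemma derivs_on_diff:
  "derivs_on A a \<Longrightarrow> derivs_on A b \<Longrightarrow> derivs_on A (\<lambda>n x. a n x - b n x)"
  unfolding derivs_on_def by (auto intro!: has_vector_derivative_diff)

lemma leibniz_0 [simp]: "leibniz a b 0 x = a 0 x * b 0 x"
  by (simp add: leibniz_def)

section \<open>Families of partial derivatives on products of intervals\<close>

lemma partials_uptoI:
  assumes "\<And>x y. x \<in> A \<Longrightarrow> y \<in> B \<Longrightarrow> D 0 0 x y = f x y"
    and "\<And>i j. i + j \<le> n \<Longrightarrow> continuous_on (A \<times> B) (\<lambda>(x, y). D i j x y)"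
    and "\<And>i j x y. i + j < n \<Longrightarrow> x \<in> A \<Longrightarrow> y \<in> B \<Longrightarrow>
       ((\<lambda>s. D i j s y) has_vector_derivative D (Suc i) j x y) (at x within A)"
    and "\<And>i j x y. i + j < n \<Longrightarrow> x \<in> A \<Longrightarrow> y \<in> B \<Longrightarrow>
       ((\<lambda>s. D i j x s) has_vector_derivative D i (Suc j) x y) (at y within B)"
  shows "partials_upto n A B f D"
  using assms unfolding partials_upto_def by blast

lemma partials_uptoD:
  assumes "partials_upto n A B f D"
  shows "\<And>x y. x \<in> A \<Longrightarrow> y \<in> B \<Longrightarrow> D 0 0 x y = f x y"
    and "\<And>i j. i + j \<le> n \<Longrightarrow> continuous_on (A \<times> B) (\<lambda>(x, y). D i j x y)"
    and "\<And>i j x y. i + j < n \<Longrightarrow> x \<in> A \<Longrightarrow> y \<in> B \<Longrightarrow>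
       ((\<lambda>s. D i j s y) has_vector_derivative D (Suc i) j x y) (at x within A)"
    and "\<And>i j x y. i + j < n \<Longrightarrow> x \<in> A \<Longrightarrow> y \<in> B \<Longrightarrow>
       ((\<lambda>s. D i j x s) has_vector_derivative D i (Suc j) x y) (at y within B)"
  using assms unfolding partials_upto_def by blast+

lemma partials_upto_subset:
  assumes "partials_upto n A B f D" "A' \<subseteq> A" "B' \<subseteq> B"
    and "\<And>x y. x \<in> A' \<Longrightarrow> y \<in> B' \<Longrightarrow> f x y = g x y"
  shows "partials_upto n A' B' g D"
proof (rule partials_uptoI)
  show "D 0 0 x y = g x y" if "x \<in> A'" "y \<in> B'" for x y
    using that assms partials_uptoD(1)[OF assms(1)] by (metis subsetD)
  show "continuous_on (A' \<times> B') (\<lambda>(x, y). D i j x y)" if "i + j \<le> n" for i j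
    by (rule continuous_on_subset[OF partials_uptoD(2)[OF assms(1) that]]) (use assms in auto)
  show "((\<lambda>s. D i j s y) has_vector_derivative D (Suc i) j x y) (at x within A')"
    if "i + j < n" "x \<in> A'" "y \<in> B'" for i j x y
    using has_vector_derivative_within_subset[OF partials_uptoD(3)[OF assms(1) that(1)]] that assms
    by blast
  show "((\<lambda>s. D i j x s) has_vector_derivative D i (Suc j) x y) (at y within B')"
    if "i + j < n" "x \<in> A'" "y \<in> B'" for i j x y
    using has_vector_derivative_within_subset[OF partials_uptoD(4)[OF assms(1) that(1)]] that assms
    by blast
qed

lemma partials_upto_continuous_x:
  assumes "partials_upto n A B f D" "i + j \<le> n" "y \<in> B"
  shows "continuous_on A (\<lambda>x. D i j x y)"
proof -
  have "continuous_on A ((\<lambda>(x, y). D i j x y) \<circ> (\<lambda>x. (x, y)))"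
    by (rule continuous_on_compose)
      (auto intro!: continuous_intros continuous_on_subset[OF partials_uptoD(2)[OF assms(1,2)]] simp: assms(3))
  then show ?thesis by (simp add: o_def)
qed

lemma derivs_on_partials_x:
  assumes P: "\<And>n. partials_upto n A B f D" and "y \<in> B"
  shows "derivs_on A (\<lambda>i x. D i j x y)"
  unfolding derivs_on_def
proof (intro allI ballI)
  fix n x assume "x \<in> A"
  then show "((\<lambda>x. D n j x y) has_vector_derivative D (Suc n) j x y) (at x within A)"
    by (intro partials_uptoD(3)[OF P[of "Suc (n + j)"]] assms) auto
qed

lemma derivs_on_partials_y:
  assumes P: "\<And>n. partials_upto n A B f D" and "x \<in> A"
  shows "derivs_on B (\<lambda>j y. D i j x y)"
  unfolding derivs_on_def
proof (intro allI ballI)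
  fix n y assume "y \<in> B"
  then show "((\<lambda>y. D i n x y) has_vector_derivative D i (Suc n) x y) (at y within B)"
    by (intro partials_uptoD(4)[OF P[of "Suc (i + n)"]] assms) auto
qed

text \<open>The factors that occur depend on x alone: 1 / x in passing from u to
  \<open>sigma\<close>, and x in passing back to the remainder of u.\<close>

lemma partials_upto_mult:
  assumes "partials_upto n A B f D" "derivs_on A a"
  shows "partials_upto n A B (\<lambda>x y. a 0 x * f x y) (\<lambda>i j x y. leibniz a (\<lambda>i x. D i j x y) i x)"
proof (rule partials_uptoI)
  fix i j x y assume ij: "i + j < n" and xy: "x \<in> A" "y \<in> B"
  show "((\<lambda>s. leibniz a (\<lambda>i x. D i j x y) i s) has_vector_derivative
        leibniz a (\<lambda>i x. D i j x y) (Suc i) x) (at x within A)"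
    by (rule leibniz_has_vector_derivative)
      (use ij xy partials_uptoD(3)[OF assms(1)] derivs_onD[OF assms(2)] in auto)
  show "((\<lambda>s. leibniz a (\<lambda>i x. D i j x s) i x) has_vector_derivative
        leibniz a (\<lambda>i x. D i (Suc j) x y) i x) (at y within B)"
    unfolding leibniz_def
    by (intro has_vector_derivative_sum has_vector_derivative_mult_right)
      (use ij xy in \<open>auto intro!: partials_uptoD(4)[OF assms(1)]\<close>)
next
  fix i j assume ij: "i + j \<le> n"
  have a: "continuous_on (A \<times> B) (\<lambda>p. a k (fst p))" for k
    by (rule continuous_on_compose2[OF derivs_on_continuous[OF assms(2)] continuous_on_fst[OF continuous_on_id]]) auto
  have D: "continuous_on (A \<times> B) (\<lambda>p. D (i - k) j (fst p) (snd p))" for k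
    using partials_uptoD(2)[OF assms(1), of "i - k" j] ij by (simp add: case_prod_unfold)
  show "continuous_on (A \<times> B) (\<lambda>(x, y). leibniz a (\<lambda>i x. D i j x y) i x)"
    unfolding leibniz_def case_prod_unfold by (intro continuous_intros a D)
qed (use partials_uptoD(1)[OF assms(1)] in auto)

lemma partials_upto_tensor:
  assumes "derivs_on A a" "derivs_on B b"
  shows "partials_upto n A B (\<lambda>x y. a 0 x * b 0 y) (\<lambda>i j x y. a i x * b j y)"
proof (rule partials_uptoI)
  fix i j :: nat
  show "continuous_on (A \<times> B) (\<lambda>(x, y). a i x * b j y)"
    unfolding case_prod_unfold
    by (intro continuous_intros continuous_on_compose2[OF derivs_on_continuous[OF assms(1)] continuous_on_fst[OF continuous_on_id]]
       continuous_on_compose2[OF derivs_on_continuous[OF assms(2)] continuous_on_snd[OF continuous_on_id]]) auto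
next
  fix i j x y assume "x \<in> A" "y \<in> B"
  then show "((\<lambda>s. a i s * b j y) has_vector_derivative a (Suc i) x * b j y) (at x within A)"
    "((\<lambda>s. a i x * b j s) has_vector_derivative a i x * b (Suc j) y) (at y within B)"
    by (auto intro!: has_vector_derivative_mult_left has_vector_derivative_mult_right derivs_onD assms)
qed auto

lemma partials_upto_diff:
  assumes "partials_upto n A B f D" "partials_upto n A B g E"
  shows "partials_upto n A B (\<lambda>x y. f x y - g x y) (\<lambda>i j x y. D i j x y - E i j x y)"
  using assms unfolding partials_upto_def case_prod_unfold
  by (auto intro!: continuous_intros has_vector_derivative_diff)

lemma partials_upto_sum:
  assumes "\<And>z. z \<in> I \<Longrightarrow> partials_upto n A B (f z) (D z)"
  shows "partials_upto n A B (\<lambda>x y. \<Sum>z\<in>I. f z x y) (\<lambda>i j x y. \<Sum>z\<in>I. D z i j x y)"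
  using assms unfolding partials_upto_def case_prod_unfold
  by (auto intro!: continuous_intros has_vector_derivative_sum)

text \<open>Coefficients of the iterated chain rule for \<open>y \<mapsto> f (1 / y)\<close>.\<close>

fun invc :: "nat \<Rightarrow> nat \<Rightarrow> real" where
  "invc 0 l = (if l = 0 then 1 else 0)"
| "invc (Suc j) l = - real (j + l) * invc j l - (if l = 0 then 0 else invc j (l - 1))"

lemma invc_eq_0: "j < l \<Longrightarrow> invc j l = 0"
  by (induction j arbitrary: l) auto

text \<open>Differentiating y^-(j+l) keeps l and brings the factor -(j+l) / y, while differentiating
  D at 1 / y raises l and brings - 1 / y^2. Both results carry the power y^-(j+1+l) for the new l,
  which gives the two terms in the recursion of \<open>invc\<close>.\<close>

definition inv_partial ::
  "(nat \<Rightarrow> nat \<Rightarrow> real \<Rightarrow> real \<Rightarrow> complex) \<Rightarrow> nat \<Rightarrow> nat \<Rightarrow> real \<Rightarrow> real \<Rightarrow> complex" where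
  "inv_partial D i j x y = (\<Sum>l\<le>j. of_real (invc j l / y ^ (j + l)) * D i l x (1 / y))"

lemma DERIV_divide_power:
  fixes y c :: real
  assumes "y \<noteq> 0"
  shows "((\<lambda>s. c / s ^ n) has_real_derivative - real n * c / y ^ (n + 1)) (at y within A)"
proof (cases n)
  case (Suc m)
  have "((\<lambda>s. c / s ^ Suc m) has_real_derivative
      (0 * y ^ Suc m - c * (real (Suc m) * (1 * y ^ m))) / (y ^ Suc m * y ^ Suc m)) (at y within A)"
    by (intro DERIV_divide DERIV_const DERIV_cong[OF DERIV_power[OF DERIV_ident]]) (use assms in auto)
  moreover have "(0 * y ^ Suc m - c * (real (Suc m) * (1 * y ^ m))) / (y ^ Suc m * y ^ Suc m)
      = - real (Suc m) * c / y ^ (Suc m + 1)"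
    using assms by (simp add: divide_simps) algebra
  ultimately show ?thesis unfolding Suc by (simp only:)
qed auto

lemma partials_upto_inverse:
  assumes P: "partials_upto n A B f D" and B': "\<And>y. y \<in> B' \<Longrightarrow> 0 < y \<and> 1 / y \<in> B"
  shows "partials_upto n A B' (\<lambda>x y. f x (1 / y)) (inv_partial D)"
proof (rule partials_uptoI)
  fix x y assume "x \<in> A" "y \<in> B'"
  then show "inv_partial D 0 0 x y = f x (1 / y)"
    using partials_uptoD(1)[OF P] B' by (auto simp: inv_partial_def)
next
  fix i j assume ij: "i + j \<le> n"
  have "continuous_on (A \<times> B') (\<lambda>p. D i l (fst p) (1 / snd p))" if "l \<le> j" for l
  proof -
    have "continuous_on (A \<times> B') ((\<lambda>(x, y). D i l x y) \<circ> (\<lambda>p. (fst p, 1 / snd p)))"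
      by (rule continuous_on_compose)
        (use B' ij that in \<open>fastforce intro!: continuous_intros continuous_on_subset[OF partials_uptoD(2)[OF P]]\<close>)+
    then show ?thesis by (simp add: o_def)
  qed
  then show "continuous_on (A \<times> B') (\<lambda>(x, y). inv_partial D i j x y)"
    unfolding case_prod_unfold inv_partial_def
    by (intro continuous_intros) (use B' in fastforce)+
next
  fix i j x y assume ij: "i + j < n" and xy: "x \<in> A" "y \<in> B'"
  show "((\<lambda>s. inv_partial D i j s y) has_vector_derivative inv_partial D (Suc i) j x y) (at x within A)"
    unfolding inv_partial_def
    by (intro has_vector_derivative_sum has_vector_derivative_mult_right)
      (use ij xy B' in \<open>auto intro!: partials_uptoD(3)[OF P]\<close>)
  have y: "0 < y" "1 / y \<in> B" using B' xy by auto
  have summand: "((\<lambda>s. of_real (invc j l / s ^ (j + l)) * D i l x (1 / s)) has_vector_derivative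
      of_real (- real (j + l) * invc j l / y ^ (j + l + 1)) * D i l x (1 / y)
      - of_real (invc j l / y ^ (j + l + 2)) * D i (Suc l) x (1 / y)) (at y within B')" if l: "l \<le> j" for l
  proof -
    have 1: "((\<lambda>s. invc j l / s ^ (j + l)) has_real_derivative - real (j + l) * invc j l / y ^ (j + l + 1))
        (at y within B')"
      by (rule DERIV_divide_power) (use y in auto)
    have "((\<lambda>s. 1 / s) has_vector_derivative - 1 / y ^ 2) (at y within B')"
      unfolding has_real_derivative_iff_has_vector_derivative[symmetric]
      using y by (auto intro!: derivative_eq_intros simp: power2_eq_square)
    moreover have "((\<lambda>s. D i l x s) has_vector_derivative D i (Suc l) x (1 / y)) (at (1 / y) within (\<lambda>s. 1 / s) ` B')"
      by (rule has_vector_derivative_within_subset[OF partials_uptoD(4)[OF P]]) (use ij l xy y B' in auto)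
    ultimately have 2: "((\<lambda>s. D i l x (1 / s)) has_vector_derivative (- 1 / y ^ 2) *\<^sub>R D i (Suc l) x (1 / y)) (at y within B')"
      using vector_diff_chain_within by (fastforce simp: o_def)
    show ?thesis
      using has_vector_derivative_mult[OF has_vector_derivative_of_real[OF 1] 2]
      by (rule has_vector_derivative_cong_within)
        (use xy y in \<open>auto simp: scaleR_conv_of_real power_add power2_eq_square field_simps\<close>)
  qed
  have "(\<Sum>l\<le>j. of_real (- real (j + l) * invc j l / y ^ (j + l + 1)) * D i l x (1 / y)
      - of_real (invc j l / y ^ (j + l + 2)) * D i (Suc l) x (1 / y)) = inv_partial D i (Suc j) x y"
    (is "?L = _")
  proof -
    \<comment> \<open>The range can be enlarged to j + 1 because \<open>invc j (Suc j)\<close> is 0;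
      shifting the other sum then gives both the same range and the same powers of y.\<close>
    have "?L = (\<Sum>l\<le>Suc j. of_real (- real (j + l) * invc j l / y ^ (j + l + 1)) * D i l x (1 / y))
      - (\<Sum>l\<le>j. of_real (invc j l / y ^ (j + l + 2)) * D i (Suc l) x (1 / y))"
      by (simp add: sum_subtractf invc_eq_0)
    also have "(\<Sum>l\<le>j. of_real (invc j l / y ^ (j + l + 2)) * D i (Suc l) x (1 / y))
      = (\<Sum>l\<le>Suc j. of_real ((if l = 0 then 0 else invc j (l - 1)) / y ^ (j + l + 1)) * D i l x (1 / y))"
      by (subst sum.atMost_Suc_shift) simp
    finally show ?thesis
      unfolding inv_partial_def
      by (simp add: sum_subtractf[symmetric] diff_divide_distrib left_diff_distrib del: sum.atMost_Suc)
  qed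
  moreover have "((\<lambda>s. inv_partial D i j x s) has_vector_derivative ?L) (at y within B')"
    unfolding inv_partial_def[of D i j] by (rule has_vector_derivative_sum) (rule summand, simp)
  ultimately show "((\<lambda>s. inv_partial D i j x s) has_vector_derivative inv_partial D i (Suc j) x y) (at y within B')"
    by (simp only:)
qed

subsection \<open>Mean value estimates\<close>

lemma norm_diff_le_of_derivative_bound:
  fixes f :: "real \<Rightarrow> 'a::real_normed_vector"
  assumes "a \<le> b" "\<And>x. x \<in> {a..b} \<Longrightarrow> (f has_vector_derivative f' x) (at x within {a..b})"
    and "\<And>x. x \<in> {a..b} \<Longrightarrow> norm (f' x) \<le> B"
  shows "norm (f b - f a) \<le> B * (b - a)"
proof -
  have "norm (f b - f a) \<le> B * norm (b - a)"
    by (rule differentiable_bound[of "{a..b}" f "\<lambda>x h. h *\<^sub>R f' x"])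
      (use assms in \<open>auto simp: has_vector_derivative_def mult.commute[of B] intro!: onorm_le mult_left_mono\<close>)
  then show ?thesis using assms(1) by simp
qed

text \<open>Taylor's estimate without the factorial: the induction hypothesis is applied to the
  shifted family, that is to the derivative, and the mean value inequality contributes one more
  factor y.\<close>

lemma norm_le_power_of_vanishing_derivatives:
  fixes h :: "nat \<Rightarrow> real \<Rightarrow> complex"
  assumes "\<And>j y. j < m \<Longrightarrow> y \<in> {0..b} \<Longrightarrow> (h j has_vector_derivative h (Suc j) y) (at y within {0..b})"
    and "\<And>j. j < m \<Longrightarrow> h j 0 = 0" and "\<And>y. y \<in> {0..b} \<Longrightarrow> norm (h m y) \<le> C" and "y \<in> {0..b}"
  shows "norm (h 0 y) \<le> C * y ^ m"
  using assms
proof (induction m arbitrary: h y)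
  case 0
  then show ?case by simp
next
  case (Suc m)
  have C: "0 \<le> C" using Suc.prems(3)[OF Suc.prems(4)] norm_ge_zero order_trans by blast
  have 1: "norm (h 1 z) \<le> C * z ^ m" if "z \<in> {0..b}" for z
    using Suc.IH[of "\<lambda>j. h (Suc j)" z] Suc.prems that by simp
  have "norm (h 0 y - h 0 0) \<le> (C * y ^ m) * (y - 0)"
  proof (rule norm_diff_le_of_derivative_bound)
    fix x assume x: "x \<in> {0..y}"
    then have "x \<in> {0..b}" using Suc.prems(4) by auto
    then show "(h 0 has_vector_derivative h 1 x) (at x within {0..y})"
      using has_vector_derivative_within_subset[OF Suc.prems(1)[of 0 x]] Suc.prems(4) by auto
    show "norm (h 1 x) \<le> C * y ^ m"
      using 1[OF \<open>x \<in> {0..b}\<close>] x C mult_left_mono[OF power_mono[of x y m] C] by auto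
  qed (use Suc.prems in auto)
  then show ?case using Suc.prems(2)[of 0] by (simp add: mult_ac)
qed

text \<open>If \<open>q\<close> is \<open>f / x\<close>, then \<open>x q\<^sub>K\<^sub>+\<^sub>1 + (K+1) q\<^sub>K\<close> is the derivative of \<open>f\<close> of order \<open>K + 1\<close>,
  and multiplied by \<open>x\<^sup>K\<close> it is the derivative of \<open>x\<^sup>K\<^sup>+\<^sup>1 q\<^sub>K\<close>.\<close>

lemma norm_quotient_derivative_le:
  assumes q: "derivs_on {0..} q"
    and B: "\<And>x. x \<in> {0..X} \<Longrightarrow> norm (of_real x * q (Suc K) x + of_nat (Suc K) * q K x) \<le> B"
    and x: "x \<in> {0..X}"
  shows "norm (q K x) \<le> B"
proof (cases "x = 0")
  case True
  have "norm (q K 0) \<le> real (Suc K) * norm (q K 0)"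
    by (simp add: mult_le_cancel_right1)
  also have "\<dots> = norm (of_real 0 * q (Suc K) 0 + of_nat (Suc K) * q K 0)"
    by (simp add: norm_mult del: of_nat_Suc)
  also have "\<dots> \<le> B" using B[of 0] x by auto
  finally show ?thesis using True by simp
next
  case False
  then have x0: "0 < x" using x by simp
  have "norm (of_real (x ^ Suc K) * q K x - of_real (0 ^ Suc K) * q K 0) \<le> (x ^ K * B) * (x - 0)"
  proof (rule norm_diff_le_of_derivative_bound)
    fix s assume s: "s \<in> {0..x}"
    have "((\<lambda>s. s ^ Suc K) has_real_derivative real (Suc K) * s ^ K) (at s within {0..x})"
      by (rule DERIV_cong[OF DERIV_power[OF DERIV_ident]]) auto
    then have 1: "((\<lambda>s. of_real (s ^ Suc K)) has_vector_derivative (of_real (real (Suc K) * s ^ K) :: complex)) (at s within {0..x})"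
      by (rule has_vector_derivative_of_real)
    have "(q K has_vector_derivative q (Suc K) s) (at s within {0..x})"
      using has_vector_derivative_within_subset[OF derivs_onD[OF q, of s K]] s by auto
    from has_vector_derivative_mult[OF 1 this]
    show "((\<lambda>s. of_real (s ^ Suc K) * q K s) has_vector_derivative
        of_real (s ^ K) * (of_real s * q (Suc K) s + of_nat (Suc K) * q K s)) (at s within {0..x})"
      by (simp add: algebra_simps)
    have "norm (of_real s * q (Suc K) s + of_nat (Suc K) * q K s) \<le> B" using B[of s] s x by auto
    then show "norm (of_real (s ^ K) * (of_real s * q (Suc K) s + of_nat (Suc K) * q K s)) \<le> x ^ K * B"
      unfolding norm_mult using s by (intro mult_mono) (auto intro: power_mono simp: norm_power)
  qed (use x0 in auto)
  then have "x ^ Suc K * norm (q K x) \<le> x ^ Suc K * B"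
    using x0 by (simp add: norm_mult norm_power mult_ac)
  then show ?thesis using x0 by (simp only: mult_le_cancel_left_pos zero_less_power)
qed


subsection \<open>The functions \<open>y\<^sup>\<alpha> ln\<^sup>k y\<close>\<close>

text \<open>Since ln y has derivative 1 / y, differentiating y^(\<alpha> - j) p(ln y) gives
  y^(\<alpha> - j - 1) times ((\<alpha> - j) p + p')(ln y). Derivatives of every order thus stay a
  power times a polynomial in ln y.\<close>

fun powr_ln_poly :: "complex \<Rightarrow> nat \<Rightarrow> nat \<Rightarrow> complex poly" where
  "powr_ln_poly \<alpha> k 0 = monom 1 k"
| "powr_ln_poly \<alpha> k (Suc j) = smult (\<alpha> - of_nat j) (powr_ln_poly \<alpha> k j) + pderiv (powr_ln_poly \<alpha> k j)"

definition powr_ln :: "complex \<Rightarrow> nat \<Rightarrow> nat \<Rightarrow> real \<Rightarrow> complex" where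
  "powr_ln \<alpha> k j y = of_real y powr (\<alpha> - of_nat j) * poly (powr_ln_poly \<alpha> k j) (of_real (ln y))"

lemma powr_ln_0: "powr_ln \<alpha> k 0 y = of_real y powr \<alpha> * of_real (ln y) ^ k"
  by (simp add: powr_ln_def poly_monom)

lemma derivs_on_powr_ln: "derivs_on {0<..} (powr_ln \<alpha> k)"
  unfolding derivs_on_def
proof (intro allI ballI)
  fix j and y :: real assume "y \<in> {0<..}"
  then have y: "0 < y" by simp
  let ?p = "powr_ln_poly \<alpha> k j" and ?b = "\<alpha> - of_nat j"
  have "((\<lambda>z. z powr ?b) has_field_derivative ?b * of_real y powr (?b - 1)) (at (of_real y))"
    using y by (intro has_field_derivative_powr) (auto simp: complex_nonpos_Reals_iff)
  then have 1: "((\<lambda>s. of_real s powr ?b) has_vector_derivative ?b * of_real y powr (?b - 1)) (at y within {0<..})"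
    by (rule has_vector_derivative_real_field)
  have "((\<lambda>s. of_real (ln s)) has_vector_derivative (of_real (1 / y) :: complex)) (at y within {0<..})"
    by (rule has_vector_derivative_of_real) (use y in \<open>auto intro!: derivative_eq_intros\<close>)
  moreover have "(poly ?p has_field_derivative poly (pderiv ?p) (of_real (ln y))) (at (of_real (ln y)) within
      (\<lambda>s. of_real (ln s)) ` {0<..})"
    using poly_DERIV DERIV_subset by blast
  ultimately have 2: "((\<lambda>s. poly ?p (of_real (ln s))) has_vector_derivative
      of_real (1 / y) * poly (pderiv ?p) (of_real (ln y))) (at y within {0<..})"
    using field_vector_diff_chain_within by (fastforce simp: o_def)
  have 3: "of_real y powr ?b = of_real y powr (?b - 1) * (of_real y :: complex)"
    using y powr_add[of "of_real y" "?b - 1" 1] by simp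
  have eq: "\<alpha> - of_nat (Suc j) = ?b - 1" by simp
  have "of_real y powr ?b * (of_real (1 / y) * poly (pderiv ?p) (of_real (ln y))) +
        ?b * of_real y powr (?b - 1) * poly ?p (of_real (ln y)) = powr_ln \<alpha> k (Suc j) y"
    unfolding powr_ln_def eq powr_ln_poly.simps 3 using y by (simp add: algebra_simps)
  with has_vector_derivative_mult[OF 1 2]
  show "(powr_ln \<alpha> k j has_vector_derivative powr_ln \<alpha> k (Suc j) y) (at y within {0<..})"
    unfolding powr_ln_def[of \<alpha> k j] by (simp add: add.commute)
qed

lemma abs_ln_le_powr:
  fixes y e :: real
  assumes "0 < y" "y \<le> 1" "0 < e"
  shows "\<bar>ln y\<bar> \<le> y powr (- e) / e"
proof -
  have "ln (1 / y) \<le> (1 / y) powr e / e" using assms by (intro ln_powr_bound) auto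
  then show ?thesis using assms by (simp add: ln_div powr_divide powr_minus_divide)
qed

lemma poly_ln_bound:
  assumes "0 < e"
  shows "\<exists>C. \<forall>y\<in>{0<..1}. norm (poly p (of_real (ln y) :: complex)) \<le> C * y powr (- e)"
  using assms
proof (induction p arbitrary: e rule: pCons_induct)
  case 0
  then show ?case by (auto intro!: exI[of _ 0])
next
  case (pCons a p)
  \<comment> \<open>One half of the exponent absorbs the extra factor ln y, the other half goes to
    the induction hypothesis.\<close>
  have "0 < e / 2" using pCons.prems by simp
  from pCons.IH[OF this] obtain C where
    C: "\<And>y. y \<in> {0<..1} \<Longrightarrow> norm (poly p (of_real (ln y))) \<le> C * y powr (- (e/2))" by blast
  show ?case
  proof (intro exI ballI)
    fix y :: real assume y: "y \<in> {0<..1}"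
    have "norm (of_real (ln y) * poly p (of_real (ln y))) \<le> (y powr (- (e/2)) / (e/2)) * (C * y powr (- (e/2)))"
      unfolding norm_mult using abs_ln_le_powr[of y "e/2"] C[OF y] y pCons.prems by (intro mult_mono) auto
    also have "\<dots> = 2 * C / e * y powr (- e)"
      by (simp add: mult_ac flip: powr_add)
    finally have 1: "norm (of_real (ln y) * poly p (of_real (ln y))) \<le> 2 * C / e * y powr (- e)" .
    have "1 \<le> y powr (- e)" using y pCons.prems powr_mono2'[of "- e" y 1] by simp
    then have "norm a \<le> norm a * y powr (- e)" by (simp add: mult_le_cancel_left1)
    with 1 show "norm (poly (pCons a p) (of_real (ln y))) \<le> (norm a + 2 * C / e) * y powr (- e)"
      using norm_triangle_ineq[of a "of_real (ln y) * poly p (of_real (ln y))"] by (simp add: distrib_right)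
  qed
qed

text \<open>The gap between m and Re \<alpha> - j is spent on the polynomial in ln y; this is why
  the inequality is strict.\<close>

lemma powr_ln_bound:
  assumes "m < Re \<alpha> - real j"
  shows "\<exists>C. \<forall>y\<in>{0<..1}. norm (powr_ln \<alpha> k j y) \<le> C * y powr m"
proof -
  define e where "e = Re \<alpha> - real j - m"
  have e: "0 < e" using assms by (simp add: e_def)
  obtain C where C: "\<And>y. y \<in> {0<..1} \<Longrightarrow> norm (poly (powr_ln_poly \<alpha> k j) (of_real (ln y))) \<le> C * y powr (- e)"
    using poly_ln_bound[OF e] by blast
  have "norm (powr_ln \<alpha> k j y) \<le> C * y powr m" if y: "y \<in> {0<..1}" for y
  proof -
    have "norm (powr_ln \<alpha> k j y) \<le> y powr (Re \<alpha> - real j) * (C * y powr (- e))"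
      unfolding powr_ln_def norm_mult using y C[OF y]
      by (intro mult_mono) (auto simp: norm_powr_real_powr)
    also have "\<dots> = C * y powr m" by (simp add: e_def mult_ac flip: powr_add)
    finally show ?thesis .
  qed
  then show ?thesis by blast
qed


subsection \<open>Cut-off functions\<close>

lemma smooth_real_mult:
  assumes "smooth_real f" "smooth_real g"
  shows "smooth_real (\<lambda>x. f x * g x)"
proof -
  obtain A B where "A 0 = f" "B 0 = g" "derivs_on UNIV A" "derivs_on UNIV B"
    using assms unfolding smooth_real_iff by blast
  then show ?thesis unfolding smooth_real_iff
    by (intro exI[of _ "leibniz A B"]) (auto simp: derivs_on_leibniz)
qed

lemma smooth_real_affine:
  assumes "smooth_real f"
  shows "smooth_real (\<lambda>x. a * f (c * x + d) + b)"
proof -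
  obtain D where D: "D 0 = f" "\<And>n x. (D n has_vector_derivative D (Suc n) x) (at x)"
    using assms unfolding smooth_real_def by blast
  define E where "E n x = a * of_real (c ^ n) * D n (c * x + d) + (if n = 0 then b else 0)" for n x
  have "(E n has_vector_derivative E (Suc n) x) (at x)" for n x
  proof -
    have "((\<lambda>x. c * x + d) has_vector_derivative c) (at x)"
      by (auto intro!: derivative_eq_intros simp flip: has_real_derivative_iff_has_vector_derivative)
    from vector_diff_chain_at[OF this D(2)[of n]]
    have "((\<lambda>x. D n (c * x + d)) has_vector_derivative c *\<^sub>R D (Suc n) (c * x + d)) (at x)" by (simp add: o_def)
    from has_vector_derivative_add[OF has_vector_derivative_mult_right[OF this] has_vector_derivative_const]
    have "((\<lambda>x. a * of_real (c ^ n) * D n (c * x + d) + (if n = 0 then b else 0)) has_vector_derivative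
      a * of_real (c ^ n) * (c *\<^sub>R D (Suc n) (c * x + d)) + 0) (at x)" .
    moreover have "a * of_real (c ^ n) * (c *\<^sub>R D (Suc n) (c * x + d)) + 0 = E (Suc n) x"
      by (simp add: E_def scaleR_conv_of_real)
    ultimately show ?thesis unfolding E_def[of n] by simp
  qed
  then show ?thesis unfolding smooth_real_def
    by (intro exI[of _ E]) (auto simp: E_def D(1))
qed

lemma smooth_real_antiderivative:
  assumes "smooth_real f" "\<And>x. (F has_vector_derivative f x) (at x)"
  shows "smooth_real F"
proof -
  obtain D where D: "D 0 = f" "\<And>n x. (D n has_vector_derivative D (Suc n) x) (at x)"
    using assms unfolding smooth_real_def by blast
  have "(case_nat F D n has_vector_derivative case_nat F D (Suc n) x) (at x)" for n x
    using assms(2) D by (cases n) auto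
  then show ?thesis unfolding smooth_real_def by (intro exI[of _ "case_nat F D"]) auto
qed

text \<open>The functions p(1/x) exp(-1/x), extended by 0, form a class closed under
  differentiation, so one first-order computation makes them smooth.\<close>

definition flat :: "real poly \<Rightarrow> real \<Rightarrow> real" where
  "flat p x = (if x \<le> 0 then 0 else poly p (1 / x) * exp (- (1 / x)))"

lemma poly_div_exp_tendsto_0: "((\<lambda>x. poly p x * exp (- x)) \<longlongrightarrow> (0::real)) at_top"
proof -
  have "((\<lambda>x. \<Sum>i\<le>degree p. coeff p i * (x ^ i / exp x)) \<longlongrightarrow> (\<Sum>i\<le>degree p. coeff p i * 0)) at_top"
    by (intro tendsto_intros tendsto_power_div_exp_0)
  then show ?thesis
    by (simp add: poly_altdef sum_distrib_right exp_minus divide_inverse mult.assoc)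
qed

text \<open>For x > 0 both factors contribute x^-2: the polynomial gives - p'(1/x) and the
  exponential p(1/x), hence \<open>monom 1 2 * (p - pderiv p)\<close>.\<close>

lemma flat_has_derivative:
  "(flat p has_real_derivative flat (monom 1 2 * (p - pderiv p)) x) (at x)"
proof -
  consider "x < 0" | "x = 0" | "0 < x" by linarith
  then show ?thesis
  proof cases
    case 1
    have "((\<lambda>_. 0) has_real_derivative 0) (at x)" by simp
    then have "(flat p has_real_derivative 0) (at x)"
      by (rule has_field_derivative_transform_within_open[of _ _ _ "{..<0}"]) (use 1 in \<open>auto simp: flat_def\<close>)
    then show ?thesis using 1 by (simp add: flat_def)
  next
    case 3
    have "((\<lambda>x. poly p (1 / x) * exp (- (1 / x))) has_real_derivative
       poly (pderiv p) (1 / x) * (- 1 / x^2) * exp (- (1 / x)) + poly p (1 / x) * (exp (- (1 / x)) * (1 / x^2))) (at x)"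
      using 3 by (auto intro!: derivative_eq_intros DERIV_chain2[OF poly_DERIV] simp: power2_eq_square)
    then have "(flat p has_real_derivative
       poly (pderiv p) (1 / x) * (- 1 / x^2) * exp (- (1 / x)) + poly p (1 / x) * (exp (- (1 / x)) * (1 / x^2))) (at x)"
      by (rule has_field_derivative_transform_within_open[of _ _ _ "{0<..}"]) (use 3 in \<open>auto simp: flat_def\<close>)
    then show ?thesis
      using 3 by (simp add: flat_def poly_monom power_one_over algebra_simps diff_divide_distrib)
  next
    case 2
    have "((\<lambda>y. (flat p y - flat p 0) / (y - 0)) \<longlongrightarrow> 0) (at_left 0)"
      by (rule tendsto_eventually) (auto simp: eventually_at_left_field flat_def intro!: exI[of _ "-1"])
    moreover have "((\<lambda>y. (flat p y - flat p 0) / (y - 0)) \<longlongrightarrow> 0) (at_right 0)"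
    proof (rule Lim_transform_eventually)
      \<comment> \<open>The difference quotient at 0 is of the same type: division by y multiplies p
        by its variable, which is \<open>pCons 0 p\<close>.\<close>
      show "((\<lambda>y. poly (pCons 0 p) (inverse y) * exp (- inverse y)) \<longlongrightarrow> 0) (at_right (0::real))"
        using filterlim_compose[OF poly_div_exp_tendsto_0 filterlim_inverse_at_top_right] .
      show "\<forall>\<^sub>F y in at_right 0. poly (pCons 0 p) (inverse y) * exp (- inverse y) = (flat p y - flat p 0) / (y - 0)"
        by (auto simp: eventually_at_right_field flat_def inverse_eq_divide intro!: exI[of _ 1])
    qed
    ultimately have "(flat p has_real_derivative 0) (at 0)"
      unfolding has_field_derivative_iff filterlim_at_split by simp
    then show ?thesis using 2 by (simp add: flat_def)
  qed
qed

lemma smooth_real_flat: "smooth_real (\<lambda>x. of_real (flat 1 x))"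
  unfolding smooth_real_def
proof (intro exI conjI allI)
  let ?P = "\<lambda>n. ((\<lambda>p. monom 1 2 * (p - pderiv p)) ^^ n) 1"
  show "(\<lambda>x. complex_of_real (flat (?P 0) x)) = (\<lambda>x. of_real (flat 1 x))" by simp
  show "((\<lambda>x. complex_of_real (flat (?P n) x)) has_vector_derivative of_real (flat (?P (Suc n)) x)) (at x)" for n x
    using has_vector_derivative_of_real[OF flat_has_derivative] by simp
qed

text \<open>The step is an antiderivative of the bump \<open>b\<close>, which is positive on (0,1)
  and 0 elsewhere, normalised by its total increase F 1 - F 0.\<close>

lemma smooth_step:
  "\<exists>s. smooth_real s \<and> (\<forall>x\<le>0. s x = 0) \<and> (\<forall>x\<ge>1. s x = 1)"
proof -
  define b where "b x = flat 1 x * flat 1 (1 - x)" for x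
  have b: "b x = 0" if "x \<le> 0 \<or> 1 \<le> x" for x using that by (auto simp: b_def flat_def)
  have bpos: "0 < b x" if "0 < x" "x < 1" for x using that by (auto simp: b_def flat_def)
  have cont: "isCont b x" for x
    unfolding b_def
    by (intro continuous_intros isCont_o2[OF _ DERIV_isCont[OF flat_has_derivative]] DERIV_isCont[OF flat_has_derivative])
  obtain F where F: "\<And>x. (F has_real_derivative b x) (at x)"
    using einterval_antiderivative[of "-\<infinity>" "\<infinity>" b] cont
    by (auto simp: has_real_derivative_iff_has_vector_derivative)
  have const: "F v = F u" if "u \<le> v" "v \<le> 0 \<or> 1 \<le> u" for u v
  proof -
    have "norm (F v - F u) \<le> 0 * (v - u)"
    proof (rule norm_diff_le_of_derivative_bound)
      show "(F has_vector_derivative b x) (at x within {u..v})" for x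
        using F[of x] by (simp add: has_real_derivative_iff_has_vector_derivative has_vector_derivative_at_within)
    qed (use that b in auto)
    then show ?thesis by simp
  qed
  have F0: "F x = F 0" if "x \<le> 0" for x using const[of x 0] that by simp
  have F1: "F x = F 1" if "1 \<le> x" for x using const[of 1 x] that by simp
  have lt: "F 0 < F 1"
    by (rule DERIV_pos_imp_increasing_open) (use F bpos in \<open>auto intro!: continuous_at_imp_continuous_on intro: DERIV_isCont\<close>)
  have "smooth_real (\<lambda>x. of_real (flat 1 (1 - x)))"
    using smooth_real_affine[OF smooth_real_flat, of 1 "-1" 1 0] by simp
  from smooth_real_mult[OF smooth_real_flat this]
  have "smooth_real (\<lambda>x. of_real (b x))" by (simp add: b_def)
  moreover have "((\<lambda>x. of_real (F x)) has_vector_derivative complex_of_real (b x)) (at x)" for x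
    by (rule has_vector_derivative_of_real[OF F])
  ultimately have "smooth_real (\<lambda>x. of_real (F x))" by (rule smooth_real_antiderivative)
  from smooth_real_affine[OF this, of "of_real (1 / (F 1 - F 0))" 1 0 "of_real (- F 0 / (F 1 - F 0))"]
  have "smooth_real (\<lambda>x. of_real ((F x - F 0) / (F 1 - F 0)))"
    by (simp add: diff_divide_distrib)
  then show ?thesis
  proof (intro exI conjI allI impI)
    show "complex_of_real ((F x - F 0) / (F 1 - F 0)) = 0" if "x \<le> 0" for x
      unfolding F0[OF that] by simp
    show "complex_of_real ((F x - F 0) / (F 1 - F 0)) = 1" if "1 \<le> x" for x
      unfolding F1[OF that] using lt by simp
  qed
qed

lemma smooth_cutoff:
  "\<exists>k. smooth_real k \<and> (\<forall>x. 0 \<le> x \<longrightarrow> x \<le> X \<longrightarrow> k x = 1) \<and> (\<forall>x. x \<le> - 1 \<or> X + 1 \<le> x \<longrightarrow> k x = 0)"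
proof -
  obtain s where s: "smooth_real s" "\<And>x. x \<le> 0 \<Longrightarrow> s x = 0" "\<And>x. 1 \<le> x \<Longrightarrow> s x = 1"
    using smooth_step by blast
  have "smooth_real (\<lambda>x. s (x + 1))" using smooth_real_affine[OF s(1), of 1 1 1 0] by simp
  moreover have "smooth_real (\<lambda>x. s (X + 1 - x))"
    using smooth_real_affine[OF s(1), of 1 "-1" "X + 1" 0] by (simp add: algebra_simps)
  ultimately have "smooth_real (\<lambda>x. s (x + 1) * s (X + 1 - x))" by (rule smooth_real_mult)
  then show ?thesis
    by (intro exI[of _ "\<lambda>x. s (x + 1) * s (X + 1 - x)"]) (auto simp: s(2,3))
qed

subsection \<open>Push-forward and smoothness of \<open>\<sigma>\<close>\<close>

lemma smooth_on_prod_subset: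
  assumes "smooth_on_prod A B f" "A' \<subseteq> A" "B' \<subseteq> B"
  shows "smooth_on_prod A' B' f"
proof -
  obtain D where D: "\<And>n. partials_upto n A B f D" using assms(1) unfolding smooth_on_prod_def by blast
  then show ?thesis unfolding smooth_on_prod_def using partials_upto_subset[OF D assms(2,3)] by blast
qed

lemma smooth_on_prod_inverse:
  assumes "smooth_on_prod A B f" "\<And>y. y \<in> B' \<Longrightarrow> 0 < y \<and> 1 / y \<in> B"
  shows "smooth_on_prod A B' (\<lambda>x y. f x (1 / y))"
  using assms partials_upto_inverse unfolding smooth_on_prod_def by meson

lemma sigma_smooth_iff: "sigma_smooth u \<longleftrightarrow> phg_face3 {0..} {0..} (coefA u)"
proof
  assume "sigma_smooth u"
  then obtain \<tau> where \<tau>: "smooth_on_prod {0..} {0<..} \<tau>" "\<And>x \<zeta>. 0 < x \<Longrightarrow> 0 < \<zeta> \<Longrightarrow> \<tau> x \<zeta> = sigma u x \<zeta>"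
    unfolding sigma_smooth_def by blast
  have "smooth_on_prod {0..} ({0..} \<inter> {0<..}) (\<lambda>x y. \<tau> x (1 / y))"
    by (rule smooth_on_prod_inverse[OF \<tau>(1)]) auto
  then show "phg_face3 {0..} {0..} (coefA u)"
    unfolding phg_face3_def by (intro exI[of _ "\<lambda>x y. \<tau> x (1 / y)"]) (auto simp: \<tau>(2) sigma_def)
next
  assume "phg_face3 {0..} {0..} (coefA u)"
  then obtain v where v: "smooth_on_prod {0..} ({0..} \<inter> {0<..}) v"
      "\<And>x y. 0 < x \<Longrightarrow> 0 < y \<Longrightarrow> coefA u x y = of_real x * v x y"
    unfolding phg_face3_def by auto
  have "smooth_on_prod {0..} {0<..} (\<lambda>x \<zeta>. v x (1 / \<zeta>))"
    by (rule smooth_on_prod_inverse[OF v(1)]) auto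
  then show "sigma_smooth u"
    unfolding sigma_smooth_def by (intro exI[of _ "\<lambda>x \<zeta>. v x (1 / \<zeta>)"]) (auto simp: v(2) sigma_def)
qed

lemma is_pushforward_sigma: "is_pushforward u (\<lambda>t. LINT x:{0<..}|lborel. sigma u x (x / t))"
  unfolding is_pushforward_def
proof (intro allI impI)
  fix \<phi> assume "X_integrable (\<phi> \<circ> F_map) u"
  define g where "g = (\<lambda>z. indicator ({0<..} \<times> {0<..}) z *\<^sub>R integrand (\<phi> \<circ> F_map) u z)"
  have g: "integrable (lborel \<Otimes>\<^sub>M lborel) g"
    using \<open>X_integrable (\<phi> \<circ> F_map) u\<close>
    by (simp add: X_integrable_def set_integrable_def g_def lborel_prod)
  have gX: "X_integral (\<phi> \<circ> F_map) u = (LINT x|lborel. LINT y|lborel. g (x, y))"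
    using lborel_pair.integral_fst'[OF g]
    by (simp add: X_integral_def set_lebesgue_integral_def g_def lborel_prod)
  have g_zero: "g (x, y) = 0" if "x \<le> 0 \<or> y \<le> 0" for x y
    using that by (auto simp: g_def)
  \<comment> \<open>The fibre variable y is replaced by t = x y; the factor 1 / x is the
    Jacobian.\<close>
  define h where "h = (\<lambda>(x, t). of_real (1 / x) * g (x, t / x))"
  have h_zero: "h (x, t) = 0" if "x \<le> 0 \<or> t \<le> 0" for x t
    using that by (cases "0 < x") (auto simp: h_def g_zero divide_nonpos_pos)
  \<comment> \<open>Polymorphic in the range, because it is applied both to g and to its norm; the
    latter serves the integrability test for h.\<close>
  have scale: "(LINT t|lborel. of_real (1 / x) * f (t / x)) = (LINT y|lborel. f y)"
    if "0 < x" for x and f :: "real \<Rightarrow> 'b::{real_normed_field, banach, second_countable_topology}"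
    using lborel_integral_real_affine[of "1 / x" f 0] that
    by (simp add: scaleR_conv_of_real)
  have int_h: "(LINT t|lborel. h (x, t)) = (LINT y|lborel. g (x, y))" for x
    using scale[of x "\<lambda>y. g (x, y)"] by (cases "0 < x") (auto simp: h_def g_zero)
  have int_norm_h: "(LINT t|lborel. norm (h (x, t))) = (LINT y|lborel. norm (g (x, y)))" for x
  proof (cases "0 < x")
    case True
    then have "norm (h (x, t)) = of_real (1 / x) * norm (g (x, t / x))" for t
      by (simp add: h_def norm_mult norm_divide)
    then show ?thesis using scale[OF True, of "\<lambda>y. norm (g (x, y))"] by simp
  qed (simp add: h_zero g_zero)
  have h: "integrable (lborel \<Otimes>\<^sub>M lborel) h"
  proof (rule lborel_pair.Fubini_integrable)
    have [measurable]: "g \<in> borel_measurable (lborel \<Otimes>\<^sub>M lborel)" using g by auto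
    have [measurable]: "g \<in> borel_measurable (borel \<Otimes>\<^sub>M borel)"
      using g by (simp add: lborel_prod borel_prod borel_measurable_integrable)
    show "h \<in> borel_measurable (lborel \<Otimes>\<^sub>M lborel)" unfolding h_def by measurable
    show "integrable lborel (\<lambda>x. LINT y|lborel. norm (h (x, y)))"
      unfolding int_norm_h using lborel_pair.integrable_fst'[OF integrable_norm[OF g]] by simp
    show "AE x in lborel. integrable lborel (\<lambda>y. h (x, y))"
      using lborel_pair.AE_integrable_fst'[OF g]
    proof eventually_elim
      case (elim x)
      show ?case
      proof (cases "0 < x")
        case True
        then have "integrable lborel (\<lambda>t. g (x, t / x))"
          using lborel_integrable_real_affine_iff[of "1 / x" "\<lambda>y. g (x, y)" 0] elim by simp
        then show ?thesis by (simp add: h_def)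
      qed (simp add: h_zero)
    qed
  qed
  have inner: "(LINT x|lborel. h (x, t)) =
      indicator {0<..} t *\<^sub>R (\<phi> t * (LINT x:{0<..}|lborel. sigma u x (x / t)) / of_real t)" for t
  proof (cases "0 < t")
    case True
    \<comment> \<open>On the fibre x y = t the density 1 / (x y) becomes 1 / t, and the Jacobian 1 /
      x is the one inside \<open>sigma\<close>.\<close>
    have "h (x, t) = (\<phi> t / of_real t) * (indicator {0<..} x *\<^sub>R sigma u x (x / t))" for x
    proof (cases "0 < x")
      case True
      then show ?thesis using \<open>0 < t\<close>
        by (simp add: h_def g_def integrand_def sigma_def F_map_def blowdown_ptA)
    qed (simp add: h_zero)
    then have "(LINT x|lborel. h (x, t))
        = (LINT x|lborel. (\<phi> t / of_real t) * (indicator {0<..} x *\<^sub>R sigma u x (x / t)))"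
      by (simp only:)
    also have "\<dots> = (\<phi> t / of_real t) * (LINT x:{0<..}|lborel. sigma u x (x / t))"
      unfolding set_lebesgue_integral_def by (rule integral_mult_right_zero)
    finally show ?thesis using True by simp
  qed (simp add: h_zero)
  have h': "integrable (lborel \<Otimes>\<^sub>M lborel) (case_prod (\<lambda>x t. h (x, t)))" using h by simp
  show "set_integrable lborel {0<..} (\<lambda>t. \<phi> t * (LINT x:{0<..}|lborel. sigma u x (x / t)) / of_real t) \<and>
    (LINT t:{0<..}|lborel. \<phi> t * (LINT x:{0<..}|lborel. sigma u x (x / t)) / of_real t)
      = X_integral (\<phi> \<circ> F_map) u"
    unfolding set_integrable_def set_lebesgue_integral_def[of lborel "{0<..}" "\<lambda>t. \<phi> t * _ t / _ t"] inner[symmetric]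
    using lborel_pair.integrable_snd[OF h'] lborel_pair.integral_snd[OF h'] lborel_pair.integral_fst'[OF h]
    by (simp add: gX int_h)
qed

subsection \<open>Expansions and estimates at a corner\<close>

lemma greaterThan_subset_atLeast: "{a<..} \<subseteq> {a..}" for a :: real
  by auto

lemma sum_bound_exists:
  fixes f :: "'i \<Rightarrow> 'b \<Rightarrow> complex"
  assumes "finite I" "\<And>z. z \<in> I \<Longrightarrow> \<exists>C. \<forall>a\<in>A. norm (f z a) \<le> C * w a"
  shows "\<exists>C. \<forall>a\<in>A. norm (\<Sum>z\<in>I. f z a) \<le> C * w a"
proof -
  obtain C where C: "\<And>z a. z \<in> I \<Longrightarrow> a \<in> A \<Longrightarrow> norm (f z a) \<le> C z * w a"
    using assms(2) by metis
  show ?thesis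
    by (rule exI[of _ "\<Sum>z\<in>I. C z"]) (auto simp: sum_distrib_right intro!: sum_norm_le C)
qed

lemma continuous_bound_exists:
  fixes f :: "'a::topological_space \<Rightarrow> complex"
  assumes "compact T" "continuous_on T f"
  shows "\<exists>C\<ge>0. \<forall>x\<in>T. norm (f x) \<le> C"
proof -
  have "bounded (f ` T)" using assms compact_continuous_image compact_imp_bounded by blast
  then obtain C where "\<And>x. x \<in> T \<Longrightarrow> norm (f x) \<le> C" unfolding bounded_iff by blast
  then show ?thesis by (intro exI[of _ "max C 0"]) (auto simp: le_max_iff_disj)
qed

lemma continuous_eq_at_0:
  fixes f g :: "real \<Rightarrow> complex"
  assumes "continuous_on {0..} f" "continuous_on {0..} g" "\<And>x. 0 < x \<Longrightarrow> f x = g x"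
  shows "f 0 = g 0"
proof (rule tendsto_unique)
  show "at (0::real) within {0..} \<noteq> bot" by (rule at_within_ge0) simp
  show "(f \<longlongrightarrow> f 0) (at 0 within {0..})"
    using assms by (auto simp: continuous_on)
  have "(g \<longlongrightarrow> g 0) (at 0 within {0..})"
    using assms by (auto simp: continuous_on)
  then show "(f \<longlongrightarrow> g 0) (at 0 within {0..})"
    by (rule Lim_transform_eventually) (auto simp: eventually_at assms(3) intro!: exI[of _ 1])
qed

lemma derivs_on_zero:
  assumes "derivs_on A a" "open T" "T \<subseteq> A" "\<And>x. x \<in> T \<Longrightarrow> a 0 x = 0" "x \<in> T"
  shows "a n x = 0"
  using assms(5)
proof (induction n arbitrary: x)
  case (Suc n)
  have "(a n has_vector_derivative a (Suc n) x) (at x within T)"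
    using derivs_onD[OF derivs_on_subset[OF assms(1,3)] Suc.prems] .
  moreover have "(a n has_vector_derivative 0) (at x within T)"
    by (rule has_vector_derivative_cong_within[of "\<lambda>_. 0" 0]) (use Suc in auto)
  ultimately show ?case
    using vector_derivative_unique_at[of "a n" _ x] at_within_open[OF Suc.prems assms(2)] by metis
qed (use assms in simp)

text \<open>Here i and j count derivatives in x and in y. In its uses, \<open>g\<close> holds the
  coefficients after division by the defining function of the front face, so the sum expands u / x
  near A and u / t near B.\<close>

definition expansion ::
  "(complex \<times> nat) set \<Rightarrow> (complex \<Rightarrow> nat \<Rightarrow> nat \<Rightarrow> real \<Rightarrow> complex) \<Rightarrow> nat \<Rightarrow> nat \<Rightarrow> real \<Rightarrow> real \<Rightarrow> complex" where
  "expansion I g i j x y = (\<Sum>(\<alpha>, k)\<in>I. powr_ln \<alpha> k j y * g \<alpha> k i x)"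

lemma derivs_on_expansion:
  assumes "\<And>\<alpha> k. (\<alpha>, k) \<in> I \<Longrightarrow> derivs_on A (g \<alpha> k)"
  shows "derivs_on A (\<lambda>i x. expansion I g i j x y)"
  unfolding derivs_on_def expansion_def
  by (auto intro!: has_vector_derivative_sum has_vector_derivative_mult_right derivs_onD assms)

lemma upto_order_mono: "M \<le> N \<Longrightarrow> upto_order K M \<subseteq> upto_order K N"
  by (auto simp: upto_order_def)

lemma upto_order_subset: "upto_order K M \<subseteq> K"
  by (auto simp: upto_order_def)

lemma expansion_bound:
  assumes "finite I" "\<And>z. z \<in> I \<Longrightarrow> e < Re (fst z)"
    and g: "\<And>\<alpha> k. (\<alpha>, k) \<in> I \<Longrightarrow> derivs_on UNIV (g \<alpha> k)"
  shows "\<exists>C. \<forall>z\<in>{0..X} \<times> {0<..1}. norm (expansion I g i 0 (fst z) (snd z)) \<le> C * snd z powr e"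
  unfolding expansion_def
proof (rule sum_bound_exists[OF assms(1)])
  fix p assume "p \<in> I"
  obtain \<alpha> k where p: "p = (\<alpha>, k)" by (cases p)
  have "e < Re \<alpha>" using assms(2)[OF \<open>p \<in> I\<close>] by (simp add: p)
  then obtain C where C: "\<And>y. y \<in> {0<..1} \<Longrightarrow> norm (powr_ln \<alpha> k 0 y) \<le> C * y powr e"
    using powr_ln_bound[of e \<alpha> 0 k] by (simp only: of_nat_0 diff_zero) blast
  have "continuous_on {0..X} (g \<alpha> k i)"
    by (rule continuous_on_subset[OF derivs_on_continuous[OF g]]) (use \<open>p \<in> I\<close> p in auto)
  then obtain B where B: "\<And>x. x \<in> {0..X} \<Longrightarrow> norm (g \<alpha> k i x) \<le> B"
    using continuous_bound_exists[OF compact_Icc] by blast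
  show "\<exists>C. \<forall>z\<in>{0..X} \<times> {0<..1}. norm (case p of (\<alpha>, k) \<Rightarrow> powr_ln \<alpha> k 0 (snd z) * g \<alpha> k i (fst z)) \<le> C * snd z powr e"
  proof (intro exI[of _ "C * B"] ballI)
    fix z assume "z \<in> {0..X} \<times> {0<..1::real}"
    then have z: "fst z \<in> {0..X}" "snd z \<in> {0<..1}" by auto
    have "norm (powr_ln \<alpha> k 0 (snd z) * g \<alpha> k i (fst z)) \<le> (C * snd z powr e) * B"
      unfolding norm_mult using B[OF z(1)] C[OF z(2)]
      by (intro mult_mono) (auto intro: order_trans[OF norm_ge_zero])
    then show "norm (case p of (\<alpha>, k) \<Rightarrow> powr_ln \<alpha> k 0 (snd z) * g \<alpha> k i (fst z)) \<le> C * B * snd z powr e"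
      by (simp add: p mult_ac)
  qed
qed

lemma expansion_diff:
  assumes "index_set K" "N \<le> M"
  shows "expansion (upto_order K M - upto_order K N) g i j x y
    = expansion (upto_order K M) g i j x y - expansion (upto_order K N) g i j x y"
  unfolding expansion_def by (rule sum_diff[OF finite_upto_order[OF assms(1)] upto_order_mono[OF assms(2)]])

text \<open>The difference consists of finitely many terms with Re \<alpha> > N; the excess absorbs
  the logarithms, so the full power y^N remains.\<close>

lemma expansion_tail_bound:
  assumes K: "index_set K" and g: "\<And>\<alpha> k. (\<alpha>, k) \<in> K \<Longrightarrow> derivs_on UNIV (g \<alpha> k)" and "N \<le> M"
  shows "\<exists>C. \<forall>z\<in>{0..X} \<times> {0<..1}. norm (expansion (upto_order K M) g i 0 (fst z) (snd z)
     - expansion (upto_order K N) g i 0 (fst z) (snd z)) \<le> C * snd z ^ N"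
proof -
  have "\<exists>C. \<forall>z\<in>{0..X} \<times> {0<..1}.
      norm (expansion (upto_order K M - upto_order K N) g i 0 (fst z) (snd z)) \<le> C * snd z powr real N"
    by (rule expansion_bound) (use finite_upto_order[OF K] g in \<open>auto simp: upto_order_def\<close>)
  then show ?thesis unfolding expansion_diff[OF K \<open>N \<le> M\<close>] by (auto simp: powr_realpow)
qed

text \<open>A function that is 0 along the whole edge y = 0 has zero tangential derivatives
  there.\<close>

lemma partials_upto_vanish:
  assumes P: "partials_upto n {0..} Y R D" and "0 \<in> Y" and D0: "\<And>x. 0 \<le> x \<Longrightarrow> D 0 j x 0 = 0"
    and "i + j \<le> n" "0 \<le> x"
  shows "D i j x 0 = 0"
  using assms(4,5)
proof (induction i arbitrary: x)
  case (Suc i)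
  have "((\<lambda>s. D i j s 0) has_vector_derivative D (Suc i) j x 0) (at x within {0..})"
    by (rule partials_uptoD(3)[OF P]) (use Suc assms(2) in auto)
  moreover have "((\<lambda>s. D i j s 0) has_vector_derivative 0) (at x within {0..})"
    by (rule has_vector_derivative_cong_within[of "\<lambda>_. 0" 0]) (use Suc in auto)
  ultimately show ?case
    using vector_derivative_unique_within at_within_ge0[OF Suc.prems(2)] by blast
qed (use D0 in simp)

text \<open>The corner condition controls a remainder of f = x v, while the estimates are wanted for
  x-derivatives of v. The derivative D (p + 1) N of the remainder is bounded on compact sets and D
  (p + 1) j vanishes at y = 0 for j < N, so D (p + 1) 0 is O(y^N); one x-derivative is then given up
  for the division by x. V and g are fixed before N, p and X.\<close>

lemma phg_corner_estimate:
  assumes phg: "phg_corner {0..} Y K f" and K: "index_set K" and b: "0 < b" "b \<le> 1" "{0..b} \<subseteq> Y"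
  obtains V g where
    "\<And>n. partials_upto n {0..} (Y \<inter> {0<..}) (V 0 0) V"
    "\<And>x y. 0 < x \<Longrightarrow> y \<in> Y \<Longrightarrow> 0 < y \<Longrightarrow> f x y = of_real x * V 0 0 x y"
    "\<And>\<alpha> k. (\<alpha>, k) \<in> K \<Longrightarrow> derivs_on UNIV (g \<alpha> k)"
    "\<And>N p X. \<exists>C. \<forall>x\<in>{0..X}. \<forall>y\<in>{0<..b}.
       norm (V p 0 x y - expansion (upto_order K N) g p 0 x y) \<le> C * y ^ N"
proof -
  obtain v where v: "smooth_on_prod {0..} (Y \<inter> {0<..}) v"
      "\<And>x y. 0 < x \<Longrightarrow> y \<in> Y \<Longrightarrow> 0 < y \<Longrightarrow> f x y = of_real x * v x y"
    using phg unfolding phg_corner_def phg_face3_def by (auto simp: less_imp_le)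
  obtain V where V': "\<And>n. partials_upto n {0..} (Y \<inter> {0<..}) v V"
    using v(1) unfolding smooth_on_prod_def by blast
  have V0: "V 0 0 x y = v x y" if "0 \<le> x" "y \<in> Y" "0 < y" for x y
    using partials_uptoD(1)[OF V'[of 0]] that by auto
  have V: "partials_upto n {0..} (Y \<inter> {0<..}) (V 0 0) V" for n
    by (rule partials_upto_subset[OF V']) (auto simp: V0)
  obtain c where c: "\<forall>(\<alpha>, k)\<in>K. \<exists>g. smooth_real g \<and> (\<forall>x\<in>{0..}. c \<alpha> k x = of_real x * g x)"
      "\<And>N. \<exists>R D. partials_upto N {0..} Y R D \<and>
           (\<forall>x\<in>{0..}. \<forall>j<N. D 0 j x 0 = 0) \<and>
           (\<forall>x\<in>{0..}. \<forall>y\<in>Y. x > 0 \<longrightarrow> y > 0 \<longrightarrow>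
              f x y - (\<Sum>(\<alpha>, k)\<in>upto_order K N.
                 of_real y powr \<alpha> * of_real (ln y) ^ k * c \<alpha> k x) = R x y)"
    using phg unfolding phg_corner_def by blast
  have "\<forall>z\<in>K. \<exists>D. derivs_on UNIV D \<and> (\<forall>x\<ge>0. c (fst z) (snd z) x = of_real x * D 0 x)"
    using c(1) unfolding smooth_real_iff by fastforce
  then obtain g' where g': "\<And>z. z \<in> K \<Longrightarrow> derivs_on UNIV (g' z) \<and> (\<forall>x\<ge>0. c (fst z) (snd z) x = of_real x * g' z 0 x)"
    by metis
  define g where "g \<alpha> k = g' (\<alpha>, k)" for \<alpha> k
  have g: "derivs_on UNIV (g \<alpha> k)" "\<And>x. 0 \<le> x \<Longrightarrow> c \<alpha> k x = of_real x * g \<alpha> k 0 x" if "(\<alpha>, k) \<in> K" for \<alpha> k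
    using g'[OF that] by (auto simp: g_def)
  have est: "\<exists>C. \<forall>x\<in>{0..X}. \<forall>y\<in>{0<..b}.
       norm (V p 0 x y - expansion (upto_order K N) g p 0 x y) \<le> C * y ^ N" for N p X
  proof -
    \<comment> \<open>Orders are counted jointly: p + 1 derivatives in x, one of them for the
      division by x, and N in y.\<close>
    define M where "M = N + p + 1"
    obtain R D where P: "partials_upto M {0..} Y R D" and RD: "\<forall>x\<in>{0..}. \<forall>j<M. D 0 j x 0 = 0"
       "\<forall>x\<in>{0..}. \<forall>y\<in>Y. x > 0 \<longrightarrow> y > 0 \<longrightarrow>
              f x y - (\<Sum>(\<alpha>, k)\<in>upto_order K M.
                 of_real y powr \<alpha> * of_real (ln y) ^ k * c \<alpha> k x) = R x y"
      using c(2)[of M] by blast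
    have D0: "D 0 j x 0 = 0" if "0 \<le> x" "j < M" for x j using RD(1) that by simp
    have R: "f x y - (\<Sum>(\<alpha>, k)\<in>upto_order K M. of_real y powr \<alpha> * of_real (ln y) ^ k * c \<alpha> k x) = R x y"
      if "0 < x" "y \<in> Y" "0 < y" for x y using RD(2) that by simp
    have "0 \<in> Y" using b by auto
    have "continuous_on ({0..X} \<times> {0..b}) (\<lambda>(x, y). D (Suc p) N x y)"
      by (rule continuous_on_subset[OF partials_uptoD(2)[OF P]]) (use b in \<open>auto simp: M_def\<close>)
    from continuous_bound_exists[OF compact_Times[OF compact_Icc compact_Icc] this]
    obtain C where "\<forall>z\<in>{0..X} \<times> {0..b}. norm (case z of (x, y) \<Rightarrow> D (Suc p) N x y) \<le> C"
      by blast
    then have C: "norm (D (Suc p) N x y) \<le> C" if "x \<in> {0..X}" "y \<in> {0..b}" for x y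
      using that by force
    have taylor: "norm (D (Suc p) 0 x y) \<le> C * y ^ N" if x: "x \<in> {0..X}" and y: "y \<in> {0..b}" for x y
    proof (rule norm_le_power_of_vanishing_derivatives[of N b "\<lambda>j y. D (Suc p) j x y", OF _ _ C[OF x] y])
      fix j y assume "j < N" "y \<in> {0..b}"
      show "((\<lambda>y. D (Suc p) j x y) has_vector_derivative D (Suc p) (Suc j) x y) (at y within {0..b})"
      proof (rule has_vector_derivative_within_subset[OF partials_uptoD(4)[OF P]])
        show "Suc p + j < M" using \<open>j < N\<close> by (simp add: M_def)
        show "x \<in> {0..}" using x by simp
        show "y \<in> Y" using \<open>y \<in> {0..b}\<close> b(3) by blast
      qed (rule b(3))
    next
      fix j assume "j < N"
      show "D (Suc p) j x 0 = 0"
        by (rule partials_upto_vanish[OF P \<open>0 \<in> Y\<close>]) (use x D0 \<open>j < N\<close> in \<open>auto simp: M_def\<close>)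
    qed
    have bound_M: "norm (V p 0 x y - expansion (upto_order K M) g p 0 x y) \<le> C * y ^ N"
      if x: "x \<in> {0..X}" and y: "y \<in> {0<..b}" for x y
    proof -
      \<comment> \<open>For fixed y this is the remainder divided by x, with its x-derivatives. It
        is smooth up to x = 0 because V and g are; \<open>Di\<close> relates it to the derivatives
        of the remainder.\<close>
      define q where "q i x = V i 0 x y - expansion (upto_order K M) g i 0 x y" for i x
      have yY: "y \<in> Y" "0 < y" using y b by auto
      have q: "derivs_on {0..} q"
        unfolding q_def
        by (intro derivs_on_diff derivs_on_partials_x[OF V] derivs_on_expansion derivs_on_subset[OF g(1)])
          (use yY upto_order_subset in auto)
      have D00: "D 0 0 x y = of_real x * q 0 x" if "0 \<le> x" for x
      proof -
        have pos: "D 0 0 x y = of_real x * q 0 x" if "0 < x" for x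
        proof -
          have "D 0 0 x y = R x y" using partials_uptoD(1)[OF P] that yY by auto
          also have "\<dots> = f x y - (\<Sum>(\<alpha>, k)\<in>upto_order K M. of_real y powr \<alpha> * of_real (ln y) ^ k * c \<alpha> k x)"
            using R that yY by simp
          also have "(\<Sum>(\<alpha>, k)\<in>upto_order K M. of_real y powr \<alpha> * of_real (ln y) ^ k * c \<alpha> k x)
              = of_real x * expansion (upto_order K M) g 0 0 x y"
            unfolding expansion_def sum_distrib_left
          proof (rule sum.cong)
            fix z assume z: "z \<in> upto_order K M"
            obtain \<alpha> k where "z = (\<alpha>, k)" "(\<alpha>, k) \<in> K"
              using z upto_order_subset by (cases z) blast
            then show "(case z of (\<alpha>, k) \<Rightarrow> of_real y powr \<alpha> * of_real (ln y) ^ k * c \<alpha> k x)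
              = of_real x * (case z of (\<alpha>, k) \<Rightarrow> powr_ln \<alpha> k 0 y * g \<alpha> k 0 x)"
              using g(2)[of \<alpha> k x] that by (simp add: powr_ln_0)
          qed simp
          also have "f x y = of_real x * V 0 0 x y" using v(2) V0 that yY by simp
          finally show ?thesis by (simp add: q_def algebra_simps)
        qed
        \<comment> \<open>The identity in the corner condition is given for x > 0; both sides are
          continuous at 0.\<close>
        moreover have "D 0 0 0 y = of_real 0 * q 0 0"
          by (rule continuous_eq_at_0[of "\<lambda>x. D 0 0 x y" "\<lambda>x. of_real x * q 0 x"])
            (use pos in \<open>auto intro!: continuous_intros derivs_on_continuous[OF q] partials_upto_continuous_x[OF P _ yY(1)]\<close>)
        ultimately show ?thesis using \<open>0 \<le> x\<close> by (cases "x = 0") auto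
      qed
      \<comment> \<open>The product rule for x q. At i = 0 the truncated index i - 1 is harmless, as
        its term has coefficient 0.\<close>
      have Di: "D i 0 x y = of_real x * q i x + of_nat i * q (i - 1) x" if "i \<le> M" "0 \<le> x" for i x
        using that
      proof (induction i arbitrary: x)
        case 0
        then show ?case using D00 by simp
      next
        case (Suc i)
        have "((\<lambda>s. D i 0 s y) has_vector_derivative D (Suc i) 0 x y) (at x within {0..})"
          by (rule partials_uptoD(3)[OF P]) (use Suc yY in auto)
        moreover have "((\<lambda>s. D i 0 s y) has_vector_derivative of_real x * q (Suc i) x + of_nat (Suc i) * q i x) (at x within {0..})"
        proof (rule has_vector_derivative_cong_within[where f = "\<lambda>x. of_real x * q i x + of_nat i * q (i - 1) x"])
          have 1: "((\<lambda>x. complex_of_real x) has_vector_derivative of_real 1) (at x within {0..})"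
            by (rule has_vector_derivative_of_real) simp
          show "((\<lambda>x. of_real x * q i x + of_nat i * q (i - 1) x) has_vector_derivative
            (of_real x * q (Suc i) x + of_real 1 * q i x) + of_nat i * q (Suc (i - 1)) x) (at x within {0..})"
            by (intro has_vector_derivative_add has_vector_derivative_mult has_vector_derivative_mult_right
                derivs_onD[OF q] 1) (use Suc in auto)
          show "of_real x * q (Suc i) x + of_real 1 * q i x + of_nat i * q (Suc (i - 1)) x
            = of_real x * q (Suc i) x + of_nat (Suc i) * q i x"
            by (cases i) (auto simp: algebra_simps)
        qed (use Suc in auto)
        ultimately show ?case
          using vector_derivative_unique_within at_within_ge0[OF Suc.prems(2)] by fastforce
      qed
      have "norm (q p x) \<le> C * y ^ N"
      proof (rule norm_quotient_derivative_le[OF q _ x])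
        fix x assume x: "x \<in> {0..X}"
        have "of_real x * q (Suc p) x + of_nat (Suc p) * q p x = D (Suc p) 0 x y"
          using Di[of "Suc p" x] x by (simp add: M_def)
        then show "norm (of_real x * q (Suc p) x + of_nat (Suc p) * q p x) \<le> C * y ^ N"
          using taylor[OF x, of y] y by simp
      qed
      then show ?thesis by (simp add: q_def)
    qed
    have NM: "N \<le> M" by (simp add: M_def)
    obtain C' where "\<forall>z\<in>{0..X} \<times> {0<..1}. norm (expansion (upto_order K M) g p 0 (fst z) (snd z)
     - expansion (upto_order K N) g p 0 (fst z) (snd z)) \<le> C' * snd z ^ N"
      using expansion_tail_bound[where g=g, OF K g(1) NM, where X=X and i=p] by blast
    then have C': "norm (expansion (upto_order K M) g p 0 x y - expansion (upto_order K N) g p 0 x y) \<le> C' * y ^ N"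
      if "x \<in> {0..X}" "y \<in> {0<..1}" for x y
      using that by force
    show ?thesis
    proof (intro exI ballI)
      fix x y assume x: "x \<in> {0..X}" and y: "y \<in> {0<..b}"
      have "y \<in> {0<..1}" using y b by auto
      have "norm (V p 0 x y - expansion (upto_order K N) g p 0 x y)
        \<le> norm (V p 0 x y - expansion (upto_order K M) g p 0 x y) +
          norm (expansion (upto_order K M) g p 0 x y - expansion (upto_order K N) g p 0 x y)"
        using norm_triangle_ineq[of "V p 0 x y - expansion (upto_order K M) g p 0 x y"
            "expansion (upto_order K M) g p 0 x y - expansion (upto_order K N) g p 0 x y"] by simp
      also have "\<dots> \<le> (C + C') * y ^ N"
        using bound_M[OF x y] C'[OF x \<open>y \<in> {0<..1}\<close>] by (simp add: distrib_right)
      finally show "norm (V p 0 x y - expansion (upto_order K N) g p 0 x y) \<le> (C + C') * y ^ N" .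
    qed
  qed
  show thesis
    by (rule that[OF V _ g(1) est]) (use v(2) V0 in auto)
qed

subsection \<open>Polyhomogeneity implies complete asymptotics\<close>

text \<open>At the point with coordinates (x, y) the radius is x sqrt(1 + y^2), hence at least x: a
  bound on the support bounds x uniformly in y.\<close>

lemma compactly_supported_coefA:
  assumes "compactly_supported u"
  obtains X where "0 \<le> X" "\<And>x y. X < x \<Longrightarrow> 0 < y \<Longrightarrow> coefA u x y = 0"
proof -
  have "bounded {p \<in> interior blowup_X. u p \<noteq> 0}"
    using assms compact_imp_bounded bounded_closure_image bounded_subset closure_subset
    unfolding compactly_supported_def by metis
  then obtain X where X: "\<And>p. p \<in> interior blowup_X \<Longrightarrow> u p \<noteq> 0 \<Longrightarrow> norm p \<le> X"
    unfolding bounded_iff by blast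
  show thesis
  proof (rule that[of "max X 0"])
    fix x y :: real assume x: "max X 0 < x" and y: "0 < y"
    have "x \<le> x * sqrt (1 + y\<^sup>2)" using x mult_left_mono[of 1 "sqrt (1 + y\<^sup>2)" x] by simp
    moreover have "x * sqrt (1 + y\<^sup>2) \<le> norm (ptA x y)"
      using norm_snd_le[of "x * sqrt (1 + y\<^sup>2)" "arctan y"] by (simp add: ptA_def)
    ultimately have "X < norm (ptA x y)" using x by linarith
    moreover have "ptA x y \<in> interior blowup_X"
      using x y arctan_ubound[of y] by (simp add: blowup_X_def interior_Times ptA_def add_pos_nonneg)
    ultimately show "coefA u x y = 0" using X[of "ptA x y"] unfolding coefA_def by fastforce
  qed simp
qed

text \<open>The sign comes from ln (1 / y) = - ln y; it reappears in the coefficients whenever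
  \<zeta> is exchanged for y.\<close>

lemma powr_ln_inverse:
  assumes "0 < y"
  shows "of_real (1 / y) powr (- \<alpha>) * of_real (ln (1 / y)) ^ k = (- 1) ^ k * powr_ln \<alpha> k 0 y"
proof -
  have "of_real (1 / y) powr (- \<alpha>) = (of_real y powr \<alpha> :: complex)"
    using assms Ln_of_real[of y] Ln_of_real[of "1 / y"]
    by (simp add: powr_def ln_div del: of_real_divide)
  moreover have "of_real (ln (1 / y)) ^ k = ((- 1) ^ k * of_real (ln y) ^ k :: complex)"
    using assms by (simp add: ln_div flip: power_mult_distrib)
  ultimately show ?thesis by (simp add: powr_ln_0 del: of_real_divide)
qed

lemma C0_infinity_RplusI:
  assumes "smooth_real f" "\<And>x. x \<le> a \<or> b \<le> x \<Longrightarrow> f x = 0" "\<And>x. 0 \<le> x \<Longrightarrow> g x = f x"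
  shows "g \<in> C0_infinity_Rplus"
proof -
  have "{x. f x \<noteq> 0} \<subseteq> {a..b}" using assms(2) by (auto simp: subset_iff) (meson linear)+
  then have "compact (closure {x. f x \<noteq> 0})"
    by (meson bounded_closed_interval bounded_subset compact_closure)
  then show ?thesis using assms unfolding C0_infinity_Rplus_def by blast
qed

lemma expansion_bounded:
  assumes "finite I" and g: "\<And>\<alpha> k. (\<alpha>, k) \<in> I \<Longrightarrow> derivs_on UNIV (g \<alpha> k)" and "0 < a"
  shows "\<exists>C\<ge>0. \<forall>x\<in>{0..X}. \<forall>y\<in>{a..b}. norm (expansion I g i j x y) \<le> C"
proof -
  have "continuous_on ({0..X} \<times> {a..b}) (\<lambda>z. expansion I g i j (fst z) (snd z))"
    unfolding expansion_def
  proof (intro continuous_on_sum)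
    fix p assume "p \<in> I"
    obtain \<alpha> k where p: "p = (\<alpha>, k)" by (cases p)
    have "continuous_on ({0..X} \<times> {a..b}) (\<lambda>z. powr_ln \<alpha> k j (snd z))"
      by (rule continuous_on_compose2[OF derivs_on_continuous[OF derivs_on_powr_ln] continuous_on_snd[OF continuous_on_id]])
        (use \<open>0 < a\<close> in auto)
    moreover have "continuous_on ({0..X} \<times> {a..b}) (\<lambda>z. g \<alpha> k i (fst z))"
      by (rule continuous_on_compose2[OF derivs_on_continuous[OF g] continuous_on_fst[OF continuous_on_id]])
        (use \<open>p \<in> I\<close> p in auto)
    ultimately show "continuous_on ({0..X} \<times> {a..b}) (\<lambda>z. case p of (\<alpha>, k) \<Rightarrow> powr_ln \<alpha> k j (snd z) * g \<alpha> k i (fst z))"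
      unfolding p by (simp add: continuous_on_mult)
  qed
  from continuous_bound_exists[OF compact_Times[OF compact_Icc compact_Icc] this]
  show ?thesis by auto
qed

text \<open>The common core of both versions. The corner estimate is used for y \<le> 1/2. Between
  1/2 and 1 every power of y is comparable to 1, so there boundedness of the x-derivatives of
  \<sigma>, assumed as \<open>bounded\<close>, and of the partial sums amounts to an O(y^N)
  bound.\<close>

lemma complete_asymptotics_if_corner:
  assumes phg: "phg_corner {0..} Y K (coefA u)" and K: "index_set K" and u: "compactly_supported u"
    and Y: "{0..1/2} \<subseteq> Y" "{0<..<1} \<subseteq> Y"
    and bounded: "\<And>p. \<exists>C. \<forall>x>0. \<forall>y\<in>{1/2..<1}. norm (nth_deriv {0<..} p (\<lambda>x. sigma u x (1 / y)) x) \<le> C"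
  shows "complete_asymptotics K u"
proof -
  obtain X where X: "0 \<le> X" "\<And>x y. X < x \<Longrightarrow> 0 < y \<Longrightarrow> coefA u x y = 0"
    using compactly_supported_coefA[OF u] by blast
  have half: "0 < (1/2::real)" "1/2 \<le> (1::real)" by auto
  obtain V g where V: "\<And>n. partials_upto n {0..} (Y \<inter> {0<..}) (V 0 0) V"
    and uV: "\<And>x y. 0 < x \<Longrightarrow> y \<in> Y \<Longrightarrow> 0 < y \<Longrightarrow> coefA u x y = of_real x * V 0 0 x y"
    and g: "\<And>\<alpha> k. (\<alpha>, k) \<in> K \<Longrightarrow> derivs_on UNIV (g \<alpha> k)"
    and est: "\<And>N p X. \<exists>C. \<forall>x\<in>{0..X}. \<forall>y\<in>{0<..1/2}.
       norm (V p 0 x y - expansion (upto_order K N) g p 0 x y) \<le> C * y ^ N"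
    using phg_corner_estimate[OF phg K half Y(1)] by blast
  obtain cut where cut: "smooth_real cut" "\<And>x. 0 \<le> x \<Longrightarrow> x \<le> X \<Longrightarrow> cut x = 1"
      "\<And>x. x \<le> - 1 \<or> X + 1 \<le> x \<Longrightarrow> cut x = 0"
    using smooth_cutoff[of X] by blast
  obtain ch where ch: "ch 0 = cut" "derivs_on UNIV ch" using cut(1) unfolding smooth_real_iff by blast
  have ch_zero: "ch n x = 0" if "X + 1 < x" for n x
    by (rule derivs_on_zero[OF ch(2), of "{X + 1<..}"]) (use that ch cut in auto)
  \<comment> \<open>The coefficients at the corner need not have compact support. As u vanishes for
    x > X, they may be cut off beyond X; (-1)^k undoes the sign of the logarithm.\<close>
  define s where "s \<alpha> k x = (-1) ^ k * (cut x * g \<alpha> k 0 x)" for \<alpha> k x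
  define q where "q N y i x = V i 0 x y - expansion (upto_order K N) g i 0 x y" for N y i x
  have Vx: "derivs_on {0..} (\<lambda>i x. V i 0 x y)" if "0 < y" "y < 1" for y
    by (rule derivs_on_partials_x[OF V]) (use that Y(2) in auto)
  have Ex: "derivs_on {0..} (\<lambda>i x. expansion (upto_order K N) g i 0 x y)" for N y
    by (rule derivs_on_expansion[OF derivs_on_subset[OF g]]) (use upto_order_subset in auto)
  have q: "derivs_on {0<..} (q N y)" if "0 < y" "y < 1" for N y
    using derivs_on_subset[OF Vx[OF that], of "{0<..}"] derivs_on_subset[OF Ex, of "{0<..}" N y]
    unfolding q_def by (rule derivs_on_diff) auto
  have V_bounded: "\<exists>C\<ge>0. \<forall>x>0. \<forall>y\<in>{1/2..<1}. norm (V p 0 x y) \<le> C" for p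
  proof -
    obtain C where C: "\<And>x y. 0 < x \<Longrightarrow> y \<in> {1/2..<1} \<Longrightarrow> norm (nth_deriv {0<..} p (\<lambda>x. sigma u x (1 / y)) x) \<le> C"
      using bounded[of p] by blast
    have "norm (V p 0 x y) \<le> max C 0" if "0 < x" "y \<in> {1/2..<1}" for x y
    proof -
      have y: "0 < y" "y < 1" "y \<in> Y" using that Y(2) by auto
      have "nth_deriv {0<..} p (\<lambda>x. sigma u x (1 / y)) x = V p 0 x y"
        by (rule nth_deriv_eq[of _ "\<lambda>i x. V i 0 x y"])
          (use derivs_on_subset[OF Vx[OF y(1,2)] greaterThan_subset_atLeast] uV y that in \<open>auto simp: sigma_def at_within_gt0\<close>)
      then show ?thesis using C[OF that] by simp
    qed
    then show ?thesis by (intro exI[of _ "max C 0"]) auto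
  qed
  have q_bound: "\<exists>C\<ge>0. \<forall>x\<in>{0<..X+1}. \<forall>y\<in>{0<..<1}. norm (q N y p x) \<le> C * y ^ N" for N p
  proof -
    obtain C1 where C1: "\<And>x y. x \<in> {0..X+1} \<Longrightarrow> y \<in> {0<..1/2} \<Longrightarrow> norm (q N y p x) \<le> C1 * y ^ N"
      using est[where X="X+1" and N=N and p=p] unfolding q_def by blast
    obtain C2 where C2: "0 \<le> C2" "\<And>x y. 0 < x \<Longrightarrow> y \<in> {1/2..<1} \<Longrightarrow> norm (V p 0 x y) \<le> C2"
      using V_bounded[of p] by blast
    have "\<exists>C\<ge>0. \<forall>x\<in>{0..X+1}. \<forall>y\<in>{1/2..1}. norm (expansion (upto_order K N) g p 0 x y) \<le> C"
      by (rule expansion_bounded[OF finite_upto_order[OF K] g]) (use upto_order_subset in auto)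
    then obtain C3 where C3: "0 \<le> C3" "\<And>x y. x \<in> {0..X+1} \<Longrightarrow> y \<in> {1/2..1} \<Longrightarrow> norm (expansion (upto_order K N) g p 0 x y) \<le> C3"
      by blast
    show ?thesis
    \<comment> \<open>For y > 1/2 one has 1 \<le> (2 y)^N, which turns the bound C2 + C3 into (C2 +
      C3) 2^N y^N.\<close>
    proof (intro exI[of _ "max C1 0 + (C2 + C3) * 2 ^ N"] conjI ballI)
      show "0 \<le> max C1 0 + (C2 + C3) * 2 ^ N" using C2 C3 by simp
      fix x y assume x: "x \<in> {0<..X+1}" and y: "y \<in> {0<..<1::real}"
      show "norm (q N y p x) \<le> (max C1 0 + (C2 + C3) * 2 ^ N) * y ^ N"
      proof (cases "y \<le> 1/2")
        case True
        then have "norm (q N y p x) \<le> C1 * y ^ N" using C1 x y by auto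
        also have "\<dots> \<le> (max C1 0 + (C2 + C3) * 2 ^ N) * y ^ N"
          using y C2 C3 by (intro mult_right_mono) (auto simp: add_increasing2)
        finally show ?thesis .
      next
        case False
        have "norm (q N y p x) \<le> norm (V p 0 x y) + norm (expansion (upto_order K N) g p 0 x y)"
          unfolding q_def by (rule norm_triangle_ineq4)
        also have "\<dots> \<le> C2 + C3" using C2(2)[of x y] C3(2)[of x y] x y False by auto
        also have "\<dots> = (C2 + C3) * 1" by simp
        also have "\<dots> \<le> (C2 + C3) * (2 ^ N * y ^ N)"
        proof (rule mult_left_mono)
          show "1 \<le> 2 ^ N * y ^ N"
            using one_le_power[of "2 * y" N] False by (simp add: power_mult_distrib)
        qed (use C2 C3 in simp)
        also have "\<dots> \<le> (max C1 0 + (C2 + C3) * 2 ^ N) * y ^ N"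
          using y mult_nonneg_nonneg[of "max C1 0" "y ^ N"] by (simp only: distrib_right mult.assoc) simp
        finally show ?thesis .
      qed
    qed
  qed
  have L_bound: "\<exists>C. \<forall>z\<in>{0<..} \<times> {0<..<1}. norm (leibniz ch (q N (snd z)) p (fst z)) \<le> C * snd z ^ N" for N p
    unfolding leibniz_def
  proof (rule sum_bound_exists)
    fix k
    obtain C where C: "0 \<le> C" "\<And>x y. x \<in> {0<..X+1} \<Longrightarrow> y \<in> {0<..<1} \<Longrightarrow> norm (q N y (p - k) x) \<le> C * y ^ N"
      using q_bound[where N=N and p="p - k"] by blast
    obtain B where B: "0 \<le> B" "\<And>x. x \<in> {0..X+1} \<Longrightarrow> norm (ch k x) \<le> B"
      using continuous_bound_exists[OF compact_Icc continuous_on_subset[OF derivs_on_continuous[OF ch(2)]]] by blast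
    show "\<exists>C. \<forall>z\<in>{0<..} \<times> {0<..<1}. norm (of_nat (p choose k) * (ch k (fst z) * q N (snd z) (p - k) (fst z))) \<le> C * snd z ^ N"
    proof (intro exI[of _ "real (p choose k) * (B * C)"] ballI)
      fix z :: "real \<times> real" assume z: "z \<in> {0<..} \<times> {0<..<1}"
      have "norm (ch k (fst z) * q N (snd z) (p - k) (fst z)) \<le> B * (C * snd z ^ N)"
      proof (cases "fst z \<le> X + 1")
        case True
        then show ?thesis unfolding norm_mult
          using z B C(1) by (intro mult_mono B(2) C(2)) auto
      next
        case False
        then show ?thesis using z B(1) C(1) by (auto simp: ch_zero)
      qed
      then show "norm (of_nat (p choose k) * (ch k (fst z) * q N (snd z) (p - k) (fst z))) \<le> real (p choose k) * (B * C) * snd z ^ N"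
        unfolding norm_mult[of "of_nat _"] by (simp add: mult.assoc mult_left_mono)
    qed
  qed simp
  have sum_eq: "sigma u x \<zeta> - (\<Sum>(\<alpha>, k)\<in>upto_order K N. of_real \<zeta> powr (- \<alpha>) * of_real (ln \<zeta>) ^ k * s \<alpha> k x)
      = leibniz ch (q N (1 / \<zeta>)) 0 x" if "0 < x" "1 < \<zeta>" for x \<zeta> N
  proof -
    define y where "y = 1 / \<zeta>"
    have y: "0 < y" "y < 1" "y \<in> Y" using that Y(2) by (auto simp: y_def)
    have z: "\<zeta> = 1 / y" by (simp add: y_def)
    have "(\<Sum>(\<alpha>, k)\<in>upto_order K N. of_real \<zeta> powr (- \<alpha>) * of_real (ln \<zeta>) ^ k * s \<alpha> k x)
      = cut x * expansion (upto_order K N) g 0 0 x y"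
      unfolding expansion_def sum_distrib_left z
    proof (rule sum.cong[OF refl])
      fix p assume "p \<in> upto_order K N"
      obtain \<alpha> k where p: "p = (\<alpha>, k)" by (cases p)
      show "(case p of (\<alpha>, k) \<Rightarrow> of_real (1 / y) powr (- \<alpha>) * of_real (ln (1 / y)) ^ k * s \<alpha> k x)
        = cut x * (case p of (\<alpha>, k) \<Rightarrow> powr_ln \<alpha> k 0 y * g \<alpha> k 0 x)"
        unfolding p s_def prod.case powr_ln_inverse[OF y(1)] by (simp add: mult_ac)
    qed
    \<comment> \<open>The cut-off leaves \<sigma> unchanged: it is 1 up to X, and beyond X both
      \<sigma> and V vanish.\<close>
    moreover have "sigma u x \<zeta> = cut x * V 0 0 x y"
    proof (cases "x \<le> X")
      case True
      then show ?thesis using uV[OF that(1) y(3,1)] cut(2) that by (simp add: sigma_def z)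
    next
      case False
      then show ?thesis using X(2)[of x y] uV[OF that(1) y(3,1)] that y by (simp add: sigma_def z)
    qed
    ultimately show ?thesis by (simp add: q_def ch(1) right_diff_distrib y_def)
  qed
  show ?thesis
    unfolding complete_asymptotics_def
  proof (intro exI[of _ s] conjI allI ballI)
    show "case z of (\<alpha>, k) \<Rightarrow> s \<alpha> k \<in> C0_infinity_Rplus" if "z \<in> K" for z
    proof -
      obtain \<alpha> k where z: "z = (\<alpha>, k)" by (cases z)
      have "smooth_real (g \<alpha> k 0)" using g that z unfolding smooth_real_iff by blast
      from smooth_real_affine[OF smooth_real_mult[OF cut(1) this], of "(-1) ^ k" 1 0 0]
      have "smooth_real (s \<alpha> k)" by (simp add: s_def[abs_def])
      then have "s \<alpha> k \<in> C0_infinity_Rplus"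
        by (rule C0_infinity_RplusI[of _ "-1" "X + 1"]) (use cut(3) in \<open>auto simp: s_def\<close>)
      then show ?thesis by (simp add: z)
    qed
    fix N p
    obtain C where C: "\<And>z. z \<in> {0<..} \<times> {0<..<1} \<Longrightarrow> norm (leibniz ch (q N (snd z)) p (fst z)) \<le> C * snd z ^ N"
      using L_bound[where N=N and p=p] by blast
    show "\<exists>C. \<forall>x>0. \<forall>\<zeta>>1. norm (nth_deriv {0<..} p (\<lambda>x. sigma u x \<zeta> -
       (\<Sum>(\<alpha>, k)\<in>upto_order K N. of_real \<zeta> powr (- \<alpha>) * of_real (ln \<zeta>) ^ k * s \<alpha> k x)) x) \<le> C * \<zeta> powr (- real N)"
    proof (intro exI[of _ C] allI impI)
      fix x \<zeta> :: real assume x: "0 < x" and z: "1 < \<zeta>"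
      have "nth_deriv {0<..} p (\<lambda>x. sigma u x \<zeta> -
         (\<Sum>(\<alpha>, k)\<in>upto_order K N. of_real \<zeta> powr (- \<alpha>) * of_real (ln \<zeta>) ^ k * s \<alpha> k x)) x
        = leibniz ch (q N (1 / \<zeta>)) p x"
        by (rule nth_deriv_eq[OF derivs_on_leibniz[OF derivs_on_subset[OF ch(2)] q]])
          (use x z sum_eq in \<open>auto simp: at_within_gt0 simp del: leibniz_0\<close>)
      moreover have "norm (leibniz ch (q N (1 / \<zeta>)) p x) \<le> C * (1 / \<zeta>) ^ N"
        using C[of "(x, 1 / \<zeta>)"] x z by simp
      moreover have "(1 / \<zeta>) ^ N = \<zeta> powr (- real N)"
        using z by (simp add: powr_minus powr_realpow divide_inverse power_inverse)
      ultimately show "norm (nth_deriv {0<..} p (\<lambda>x. sigma u x \<zeta> -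
         (\<Sum>(\<alpha>, k)\<in>upto_order K N. of_real \<zeta> powr (- \<alpha>) * of_real (ln \<zeta>) ^ k * s \<alpha> k x)) x) \<le> C * \<zeta> powr (- real N)"
        by simp
    qed
  qed
qed

lemma complete_asymptotics_if_tempered:
  assumes "phg_corner {0..} {0..<1} K (coefA u)" "index_set K" "compactly_supported u" "tempered_derivatives u"
  shows "complete_asymptotics K u"
proof (rule complete_asymptotics_if_corner[OF assms(1-3)])
  fix p
  obtain C M where C: "\<And>x \<zeta>. 0 < x \<Longrightarrow> 1 < \<zeta> \<Longrightarrow> norm (nth_deriv {0<..} p (\<lambda>x. nth_deriv {0<..} 0 (sigma u x) \<zeta>) x) \<le> C * \<zeta> powr M"
    using assms(4) unfolding tempered_derivatives_def by meson
  show "\<exists>C. \<forall>x>0. \<forall>y\<in>{1/2..<1}. norm (nth_deriv {0<..} p (\<lambda>x. sigma u x (1 / y)) x) \<le> C"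
  \<comment> \<open>Here \<zeta> = 1 / y lies between 1 and 2; absolute values are taken because
    neither C nor M has a known sign.\<close>
  proof (intro exI[of _ "\<bar>C\<bar> * 2 powr \<bar>M\<bar>"] allI impI ballI)
    fix x y :: real assume x: "0 < x" and y: "y \<in> {1/2..<1}"
    have z: "1 < 1 / y" "1 / y \<le> 2" using y by (auto simp: field_simps)
    have "norm (nth_deriv {0<..} p (\<lambda>x. sigma u x (1 / y)) x) \<le> C * (1 / y) powr M"
      using C[OF x z(1)] by (simp add: nth_deriv_def)
    also have "\<dots> \<le> \<bar>C\<bar> * 2 powr \<bar>M\<bar>"
    proof (intro mult_mono)
      have "(1 / y) powr M \<le> (1 / y) powr \<bar>M\<bar>" using z(1) by (intro powr_mono) auto
      also have "\<dots> \<le> 2 powr \<bar>M\<bar>" using z y by (intro powr_mono2) auto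
      finally show "(1 / y) powr M \<le> 2 powr \<bar>M\<bar>" .
    qed auto
    finally show "norm (nth_deriv {0<..} p (\<lambda>x. sigma u x (1 / y)) x) \<le> \<bar>C\<bar> * 2 powr \<bar>M\<bar>" .
  qed
qed auto

text \<open>With y = 1 included, the derivatives \<open>V p 0\<close> are continuous on the compact
  set [0, X] \<times> [1/2, 1], and for x > X they vanish together with \<sigma>.\<close>

lemma complete_asymptotics_if_closed_corner:
  assumes phg: "phg_corner {0..} {0..1} K (coefA u)" and "index_set K" and u: "compactly_supported u"
  shows "complete_asymptotics K u"
proof (rule complete_asymptotics_if_corner[OF phg assms(2) u])
  fix p
  obtain X where X: "0 \<le> X" "\<And>x y. X < x \<Longrightarrow> 0 < y \<Longrightarrow> coefA u x y = 0"
    using compactly_supported_coefA[OF u] by blast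
  obtain v where v: "smooth_on_prod {0..} ({0..1} \<inter> {0<..}) v"
      "\<And>x y. 0 < x \<Longrightarrow> 0 < y \<Longrightarrow> y \<le> 1 \<Longrightarrow> coefA u x y = of_real x * v x y"
    using phg unfolding phg_corner_def phg_face3_def by auto
  obtain V where V: "\<And>n. partials_upto n {0..} ({0..1} \<inter> {0<..}) v V"
    using v(1) unfolding smooth_on_prod_def by blast
  have "continuous_on ({0..X} \<times> {1/2..1}) (\<lambda>(x, y). V p 0 x y)"
    by (rule continuous_on_subset[OF partials_uptoD(2)[OF V[of p]]]) auto
  from continuous_bound_exists[OF compact_Times[OF compact_Icc compact_Icc] this]
  obtain C where C: "0 \<le> C" "\<And>x y. x \<in> {0..X} \<Longrightarrow> y \<in> {1/2..1} \<Longrightarrow> norm (V p 0 x y) \<le> C"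
    by fastforce
  show "\<exists>C. \<forall>x>0. \<forall>y\<in>{1/2..<1}. norm (nth_deriv {0<..} p (\<lambda>x. sigma u x (1 / y)) x) \<le> C"
  proof (intro exI[of _ C] allI impI ballI)
    fix x y :: real assume x: "0 < x" and y: "y \<in> {1/2..<1}"
    have D: "derivs_on {0<..} (\<lambda>i x. V i 0 x y)"
      by (rule derivs_on_subset[OF derivs_on_partials_x[OF V] greaterThan_subset_atLeast]) (use y in auto)
    have V0: "V 0 0 x y = sigma u x (1 / y)" if "0 < x" for x
      using partials_uptoD(1)[OF V[of 0]] v(2) that y by (simp add: sigma_def)
    have "nth_deriv {0<..} p (\<lambda>x. sigma u x (1 / y)) x = V p 0 x y"
      by (rule nth_deriv_eq[OF D]) (use V0 x in \<open>auto simp: at_within_gt0\<close>)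
    moreover have "norm (V p 0 x y) \<le> C"
    proof (cases "x \<le> X")
      case False
      have "V p 0 x y = 0"
        by (rule derivs_on_zero[OF D, of "{X<..}"]) (use X V0 False y in \<open>auto simp: sigma_def\<close>)
      then show ?thesis using C by simp
    qed (use C(2)[of x y] x y in auto)
    ultimately show "norm (nth_deriv {0<..} p (\<lambda>x. sigma u x (1 / y)) x) \<le> C" by simp
  qed
qed auto

subsection \<open>Integrable sums of powers and logarithms\<close>

definition log_integrable :: "(real \<Rightarrow> complex) \<Rightarrow> bool" where
  "log_integrable f \<longleftrightarrow> (\<integral>\<^sup>+\<zeta>\<in>{0<..<1}. ennreal (norm (f \<zeta>) / \<zeta>) \<partial>lborel) < \<infinity>"

lemma log_integrand_measurable:
  assumes "continuous_on {0<..} f"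
  shows "(\<lambda>\<zeta>. ennreal (norm (f \<zeta>) / \<zeta>) * indicator {0<..<1} \<zeta>) \<in> borel_measurable borel"
proof -
  have "continuous_on {0<..<1} (\<lambda>\<zeta>. norm (f \<zeta>) / \<zeta>)"
    by (intro continuous_intros continuous_on_subset[OF assms]) auto
  then have "(\<lambda>\<zeta>. indicator {0<..<1} \<zeta> *\<^sub>R (norm (f \<zeta>) / \<zeta>)) \<in> borel_measurable borel"
    by (intro borel_measurable_continuous_on_indicator) auto
  then have "(\<lambda>\<zeta>. ennreal (indicator {0<..<1} \<zeta> *\<^sub>R (norm (f \<zeta>) / \<zeta>))) \<in> borel_measurable borel"
    by simp
  moreover have "(\<lambda>\<zeta>. ennreal (indicator {0<..<1} \<zeta> *\<^sub>R (norm (f \<zeta>) / \<zeta>)))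
      = (\<lambda>\<zeta>. ennreal (norm (f \<zeta>) / \<zeta>) * indicator {0<..<1} \<zeta>)"
    by (auto simp: indicator_def)
  ultimately show ?thesis by simp
qed

lemma log_integrable_combine:
  assumes cont: "continuous_on {0<..} f" "continuous_on {0<..} g" and int: "log_integrable f" "log_integrable g"
    and le: "\<And>\<zeta>. 0 < \<zeta> \<Longrightarrow> \<zeta> < 1 \<Longrightarrow> norm (h \<zeta>) \<le> a * norm (f \<zeta>) + b * norm (g \<zeta>)"
    and ab: "0 \<le> a" "0 \<le> b"
  shows "log_integrable h"
proof -
  let ?F = "\<lambda>f \<zeta>. ennreal (norm (f \<zeta>) / \<zeta>) * indicator {0<..<1::real} \<zeta>"
  have [measurable]: "?F f \<in> borel_measurable borel" "?F g \<in> borel_measurable borel"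
    using log_integrand_measurable cont by auto
  have "(\<integral>\<^sup>+\<zeta>. ?F h \<zeta> \<partial>lborel) \<le> (\<integral>\<^sup>+\<zeta>. ennreal a * ?F f \<zeta> + ennreal b * ?F g \<zeta> \<partial>lborel)"
  proof (rule nn_integral_mono)
    fix \<zeta> :: real
    show "?F h \<zeta> \<le> ennreal a * ?F f \<zeta> + ennreal b * ?F g \<zeta>"
    proof (cases "\<zeta> \<in> {0<..<1}")
      case True
      have "norm (h \<zeta>) / \<zeta> \<le> a * (norm (f \<zeta>) / \<zeta>) + b * (norm (g \<zeta>) / \<zeta>)"
        using le[of \<zeta>] True by (auto simp: field_simps)
      then have "ennreal (norm (h \<zeta>) / \<zeta>) \<le> ennreal (a * (norm (f \<zeta>) / \<zeta>) + b * (norm (g \<zeta>) / \<zeta>))"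
        by (rule ennreal_leI)
      also have "\<dots> = ennreal a * ennreal (norm (f \<zeta>) / \<zeta>) + ennreal b * ennreal (norm (g \<zeta>) / \<zeta>)"
        using True ab by (subst ennreal_plus) (simp_all add: ennreal_mult[symmetric])
      finally show ?thesis using True by simp
    qed simp
  qed
  also have "\<dots> = ennreal a * (\<integral>\<^sup>+\<zeta>. ?F f \<zeta> \<partial>lborel) + ennreal b * (\<integral>\<^sup>+\<zeta>. ?F g \<zeta> \<partial>lborel)"
    by (simp add: nn_integral_add nn_integral_cmult)
  also have "\<dots> < \<infinity>"
    using int by (auto simp: log_integrable_def ennreal_mult_less_top)
  finally show ?thesis by (simp add: log_integrable_def)
qed

text \<open>The measure d\<zeta>/\<zeta> is invariant under dilations, and q < 1 maps the interval
  (0,1) into itself.\<close>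

lemma log_integrable_scale:
  assumes cont: "continuous_on {0<..} f" and int: "log_integrable f" and q: "0 < q" "q < 1"
  shows "log_integrable (\<lambda>\<zeta>. f (q * \<zeta>))"
proof -
  let ?F = "\<lambda>\<zeta>. ennreal (norm (f \<zeta>) / \<zeta>) * indicator {0<..<1::real} \<zeta>"
  have F: "?F \<in> borel_measurable borel" by (rule log_integrand_measurable[OF cont])
  then have [measurable]: "(\<lambda>\<zeta>. ?F (0 + q * \<zeta>)) \<in> borel_measurable lborel" by simp
  have "(\<integral>\<^sup>+\<zeta>\<in>{0<..<1}. ennreal (norm (f (q * \<zeta>)) / \<zeta>) \<partial>lborel) \<le> (\<integral>\<^sup>+\<zeta>. ennreal q * ?F (0 + q * \<zeta>) \<partial>lborel)"
  proof (rule nn_integral_mono)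
    fix \<zeta> :: real
    show "ennreal (norm (f (q * \<zeta>)) / \<zeta>) * indicator {0<..<1} \<zeta> \<le> ennreal q * ?F (0 + q * \<zeta>)"
    proof (cases "\<zeta> \<in> {0<..<1}")
      case True
      then have "q * \<zeta> < 1" using q mult_strict_mono[of q 1 \<zeta> 1] by auto
      then show ?thesis using True q by (simp add: ennreal_mult[symmetric])
    qed simp
  qed
  also have "\<dots> = ennreal q * (\<integral>\<^sup>+\<zeta>. ?F (0 + q * \<zeta>) \<partial>lborel)"
    by (rule nn_integral_cmult) measurable
  also have "\<dots> = (\<integral>\<^sup>+\<zeta>. ?F \<zeta> \<partial>lborel)"
    using nn_integral_real_affine[OF F, of q 0] q by simp
  also have "\<dots> < \<infinity>" using int by (simp add: log_integrable_def)
  finally show ?thesis by (simp add: log_integrable_def)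
qed

lemma not_log_integrable_bounded_below:
  assumes "log_integrable f" "\<And>\<zeta>. 0 < \<zeta> \<Longrightarrow> \<zeta> < 1 \<Longrightarrow> c \<le> norm (f \<zeta>)"
  shows "c \<le> 0"
proof (rule ccontr)
  assume "\<not> c \<le> 0"
  obtain I where I: "0 \<le> I" "(\<integral>\<^sup>+\<zeta>\<in>{0<..<1}. ennreal (norm (f \<zeta>) / \<zeta>) \<partial>lborel) = ennreal I"
    using assms(1) unfolding log_integrable_def by (cases "\<integral>\<^sup>+\<zeta>\<in>{0<..<1}. ennreal (norm (f \<zeta>) / \<zeta>) \<partial>lborel" rule: ennreal_cases) auto
  \<comment> \<open>This d makes the integral of c / \<zeta> over [d, 1] equal to I + 1, more than
    the integral of f allows.\<close>
  define d where "d = exp (- (I + 1) / c)"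
  have d: "0 < d" "d < 1" using I(1) \<open>\<not> c \<le> 0\<close> by (auto simp: d_def divide_neg_pos)
  have "((\<lambda>\<zeta>. c / \<zeta>) has_integral (c * ln 1 - c * ln d)) {d..1}"
    by (rule fundamental_theorem_of_calculus)
      (use d in \<open>auto intro!: derivative_eq_intros simp flip: has_real_derivative_iff_has_vector_derivative\<close>)
  then have "((\<lambda>\<zeta>. c / \<zeta>) has_integral (I + 1)) {d..1}" using \<open>\<not> c \<le> 0\<close> by (simp add: d_def add.commute)
  then have "ennreal (I + 1) = (\<integral>\<^sup>+\<zeta>. ennreal (c / \<zeta>) * indicator {d..1} \<zeta> \<partial>lborel)"
    by (rule nn_integral_has_integral_lebesgue'[symmetric, rotated]) (use d \<open>\<not> c \<le> 0\<close> in auto)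
  also have "\<dots> \<le> (\<integral>\<^sup>+\<zeta>\<in>{0<..<1}. ennreal (norm (f \<zeta>) / \<zeta>) \<partial>lborel)"
  proof (rule nn_integral_mono_AE)
    show "AE \<zeta> in lborel. ennreal (c / \<zeta>) * indicator {d..1} \<zeta> \<le> ennreal (norm (f \<zeta>) / \<zeta>) * indicator {0<..<1} \<zeta>"
      using AE_lborel_singleton[of "1::real"]
    proof eventually_elim
      case (elim \<zeta>)
      then show ?case using d assms(2)[of \<zeta>]
        by (auto simp: indicator_def intro!: ennreal_leI divide_right_mono)
    qed
  qed
  also have "\<dots> = ennreal I" by (rule I(2))
  finally show False using I(1) by simp
qed

text \<open>Otherwise p - p(0) would be a nonzero polynomial with all the infinitely many points n a
  among its zeros.\<close>

lemma poly_periodic_imp_degree_0: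
  fixes p :: "complex poly"
  assumes "pcompose p [:a, 1:] = p" "a \<noteq> 0"
  shows "degree p = 0"
proof (rule ccontr)
  assume "degree p \<noteq> 0"
  have shift: "poly p (z + a) = poly p z" for z
    using arg_cong[OF assms(1), of "\<lambda>p. poly p z"] by (simp add: poly_pcompose add.commute)
  have root: "poly p (of_nat n * a) = poly p 0" for n
    by (induction n) (simp_all add: shift distrib_right add.commute[of a])
  have "p - [:poly p 0:] \<noteq> 0"
    using \<open>degree p \<noteq> 0\<close> by (metis degree_pCons_0 right_minus_eq)
  then have "finite {z. poly (p - [:poly p 0:]) z = 0}" by (rule poly_roots_finite)
  moreover have "range (\<lambda>n. of_nat n * a) \<subseteq> {z. poly (p - [:poly p 0:]) z = 0}"
    using root by auto
  moreover have "inj (\<lambda>n. of_nat n * a)" using assms(2) by (auto simp: inj_def)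
  ultimately show False using finite_subset range_inj_infinite by blast
qed

text \<open>Nonzero periods of exp are integer multiples of 2 pi i and so have norm greater than
  1.\<close>

lemma exp_neq_1_small: "w \<noteq> 0 \<Longrightarrow> norm w < 1 \<Longrightarrow> exp w \<noteq> (1::complex)"
proof
  assume w: "w \<noteq> 0" "norm w < 1" "exp w = 1"
  then obtain n :: int where n: "Re w = 0" "Im w = of_int (2 * n) * pi" unfolding exp_eq_1 by blast
  have "n = 0"
  proof (rule ccontr)
    assume "n \<noteq> 0"
    then have "1 \<le> \<bar>real_of_int n\<bar>" by linarith
    then have "2 * pi \<le> \<bar>Im w\<bar>" using n(2) by (simp add: abs_mult)
    then show False using abs_Im_le_cmod[of w] w(2) pi_gt3 by linarith
  qed
  then show False using w(1) n by (simp add: complex_eq_iff)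
qed

text \<open>A given q need not separate two complex exponents, since their difference may be a
  period of exp divided by ln q. Here q = exp (- t), where t is chosen so that t (\<nu> - \<mu>) has
  norm 1/2, short of any nonzero period.\<close>

lemma exists_powr_neq:
  assumes "\<nu> \<noteq> (\<mu> :: complex)"
  obtains q where "0 < q" "q < 1" "of_real q powr \<nu> \<noteq> of_real q powr \<mu>"
proof
  define t where "t = 1 / (2 * norm (\<nu> - \<mu>))"
  define q where "q = exp (- t)"
  have t: "0 < t" using assms by (simp add: t_def)
  show q: "0 < q" "q < 1" using t by (auto simp: q_def)
  have "norm (of_real (- t) * (\<nu> - \<mu>)) = 1 / 2" using assms unfolding norm_mult norm_of_real t_def by simp
  then have "exp (of_real (- t) * (\<nu> - \<mu>)) \<noteq> 1"
    by (intro exp_neq_1_small) auto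
  moreover have "of_real q powr z = exp (of_real (- t) * z)" for z :: complex
    using q(1) Ln_of_real[OF q(1)] by (simp add: powr_def q_def mult.commute)
  ultimately show "of_real q powr \<nu> \<noteq> of_real q powr \<mu>"
    by (simp only: right_diff_distrib exp_diff) simp
qed

section \<open>Dilations of sums of powers with logarithmic coefficients\<close>

definition log_poly_sum :: "complex set \<Rightarrow> (complex \<Rightarrow> complex poly) \<Rightarrow> real \<Rightarrow> complex" where
  "log_poly_sum \<Lambda> p \<zeta> = (\<Sum>\<nu>\<in>\<Lambda>. poly (p \<nu>) (of_real (ln \<zeta>)) * of_real \<zeta> powr \<nu>)"

text \<open>The coefficients of \<open>f (q \<zeta>) - q\<^sup>\<mu> f \<zeta>\<close>: the degree drops at the exponent \<open>\<mu>\<close>.\<close>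

definition scale_reduce :: "real \<Rightarrow> complex \<Rightarrow> (complex \<Rightarrow> complex poly) \<Rightarrow> complex \<Rightarrow> complex poly" where
  "scale_reduce q \<mu> p \<nu> = smult (of_real q powr \<nu>) (pcompose (p \<nu>) [:of_real (ln q), 1:])
     - smult (of_real q powr \<mu>) (p \<nu>)"

text \<open>The induction measure. Nonzero constants must weigh more than 0, because the reduction
  at \<mu> turns a constant into 0.\<close>

definition poly_size :: "complex poly \<Rightarrow> nat" where
  "poly_size p = (if p = 0 then 0 else Suc (degree p))"

lemma log_poly_sum_scale:
  assumes "0 < q" "0 < \<zeta>"
  shows "log_poly_sum \<Lambda> p (q * \<zeta>) - of_real q powr \<mu> * log_poly_sum \<Lambda> p \<zeta> = log_poly_sum \<Lambda> (scale_reduce q \<mu> p) \<zeta>"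
proof -
  have "of_real (q * \<zeta>) powr \<nu> = of_real q powr \<nu> * (of_real \<zeta> powr \<nu> :: complex)" for \<nu>
    using assms Ln_of_real[of "q * \<zeta>"] Ln_of_real[of q] Ln_of_real[of \<zeta>]
    by (simp add: powr_def ln_mult exp_add distrib_left del: of_real_mult)
  then show ?thesis
    using assms
    by (simp add: log_poly_sum_def scale_reduce_def ln_mult poly_pcompose sum_distrib_left
        left_diff_distrib algebra_simps flip: sum_subtractf)
qed

text \<open>The shift by ln q keeps degree and leading coefficient. In the old degree the reduction
  therefore has the coefficient q^\<nu> - q^\<mu> times the leading one: it cancels at \<nu> = \<mu>
  and survives where q separates \<nu> from \<mu>.\<close>

lemma scale_reduce_size:
  "poly_size (scale_reduce q \<mu> p \<nu>) \<le> poly_size (p \<nu>)"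
  "p \<mu> \<noteq> 0 \<Longrightarrow> poly_size (scale_reduce q \<mu> p \<mu>) < poly_size (p \<mu>)"
  "of_real q powr \<nu> \<noteq> of_real q powr \<mu> \<Longrightarrow> scale_reduce q \<mu> p \<nu> = 0 \<Longrightarrow> p \<nu> = 0"
proof -
  let ?P = "\<lambda>\<nu>. pcompose (p \<nu>) [:of_real (ln q), 1:]"
  have deg: "degree (?P \<nu>) = degree (p \<nu>)" for \<nu> by (simp add: degree_pcompose)
  have lc: "coeff (?P \<nu>) (degree (p \<nu>)) = lead_coeff (p \<nu>)" for \<nu>
    using lead_coeff_comp[of "[:of_real (ln q), 1:]" "p \<nu>"] by (simp add: deg)
  have le: "degree (scale_reduce q \<mu> p \<nu>) \<le> degree (p \<nu>)" for \<nu>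
    unfolding scale_reduce_def by (intro degree_diff_le) (auto simp: deg intro: order_trans[OF degree_smult_le])
  show "poly_size (scale_reduce q \<mu> p \<nu>) \<le> poly_size (p \<nu>)"
    using le[of \<nu>] by (auto simp: poly_size_def scale_reduce_def)
  show "p \<nu> = 0" if "of_real q powr \<nu> \<noteq> of_real q powr \<mu>" "scale_reduce q \<mu> p \<nu> = 0"
  proof -
    have "coeff (scale_reduce q \<mu> p \<nu>) (degree (p \<nu>)) = (of_real q powr \<nu> - of_real q powr \<mu>) * lead_coeff (p \<nu>)"
      by (simp add: scale_reduce_def lc left_diff_distrib)
    then show ?thesis using that by simp
  qed
  show "poly_size (scale_reduce q \<mu> p \<mu>) < poly_size (p \<mu>)" if "p \<mu> \<noteq> 0"
  proof (cases "scale_reduce q \<mu> p \<mu> = 0")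
    case False
    have "coeff (scale_reduce q \<mu> p \<mu>) (degree (p \<mu>)) = 0" by (simp add: scale_reduce_def lc)
    then have "degree (scale_reduce q \<mu> p \<mu>) \<noteq> degree (p \<mu>)" using False by (metis leading_coeff_0_iff)
    then show ?thesis using le[of \<mu>] False that by (simp add: poly_size_def)
  qed (use that in \<open>simp add: poly_size_def\<close>)
qed

lemma continuous_on_log_poly_sum: "continuous_on {0<..} (log_poly_sum \<Lambda> p)"
proof -
  have "continuous_on {0<..} (\<lambda>\<zeta>. of_real \<zeta> powr \<nu> :: complex)" for \<nu>
    using derivs_on_continuous[OF derivs_on_powr_ln, of \<nu> 0 0] by (simp add: powr_ln_0)
  then show ?thesis
    unfolding log_poly_sum_def[abs_def] by (intro continuous_intros) auto
qed

text \<open>Strong induction on the total size, with \<Lambda> fixed. If \<open>p \<nu>\<close> is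
  not 0, reducing at \<nu> lowers the size, so all reduced polynomials vanish, for every q in (0,1).
  A separating q kills \<open>p \<mu>\<close> for each other \<mu>, and \<open>p \<nu>\<close> is
  invariant under a shift, hence a constant c. What is left is c \<zeta>^\<nu>, whose norm is at
  least that of c because Re \<nu> \<le> 0, and this is not integrable against
  d\<zeta>/\<zeta>.\<close>

lemma log_poly_sum_integrable_imp_zero:
  assumes "finite \<Lambda>" "\<And>\<nu>. \<nu> \<in> \<Lambda> \<Longrightarrow> Re \<nu> \<le> 0" "log_integrable (log_poly_sum \<Lambda> p)" "\<nu> \<in> \<Lambda>"
  shows "p \<nu> = 0"
  using assms(3,4)
proof (induction "\<Sum>\<nu>\<in>\<Lambda>. poly_size (p \<nu>)" arbitrary: p \<nu> rule: less_induct)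
  case less
  show ?case
  proof (rule ccontr)
    assume nz: "p \<nu> \<noteq> 0"
    have reduced: "scale_reduce q \<nu> p \<mu> = 0" if q: "0 < q" "q < 1" and "\<mu> \<in> \<Lambda>" for q \<mu>
    proof (rule less.hyps[OF _ _ \<open>\<mu> \<in> \<Lambda>\<close>])
      show "(\<Sum>\<mu>\<in>\<Lambda>. poly_size (scale_reduce q \<nu> p \<mu>)) < (\<Sum>\<mu>\<in>\<Lambda>. poly_size (p \<mu>))"
        using scale_reduce_size(1,2) nz less.prems(2) by (intro sum_strict_mono_ex1 assms(1)) blast+
      have cont: "continuous_on {0<..} (\<lambda>\<zeta>. log_poly_sum \<Lambda> p (q * \<zeta>))"
        by (rule continuous_on_compose2[OF continuous_on_log_poly_sum]) (use q in \<open>auto intro!: continuous_intros\<close>)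
      show "log_integrable (log_poly_sum \<Lambda> (scale_reduce q \<nu> p))"
      proof (rule log_integrable_combine[OF cont continuous_on_log_poly_sum
            log_integrable_scale[OF continuous_on_log_poly_sum less.prems(1) q] less.prems(1)])
        fix \<zeta> :: real assume "0 < \<zeta>"
        then show "norm (log_poly_sum \<Lambda> (scale_reduce q \<nu> p) \<zeta>)
          \<le> 1 * norm (log_poly_sum \<Lambda> p (q * \<zeta>)) + norm (of_real q powr \<nu> :: complex) * norm (log_poly_sum \<Lambda> p \<zeta>)"
          using norm_triangle_ineq4[of "log_poly_sum \<Lambda> p (q * \<zeta>)" "of_real q powr \<nu> * log_poly_sum \<Lambda> p \<zeta>"] q
          by (simp add: log_poly_sum_scale norm_mult)
      qed auto
    qed
    have zero: "p \<mu> = 0" if \<mu>: "\<mu> \<in> \<Lambda>" "\<mu> \<noteq> \<nu>" for \<mu>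
    proof -
      obtain q where "0 < q" "q < 1" "of_real q powr \<mu> \<noteq> of_real q powr \<nu>" using exists_powr_neq[OF \<mu>(2)] .
      then show ?thesis using scale_reduce_size(3) reduced \<mu>(1) by blast
    qed
    have "scale_reduce (1/2) \<nu> p \<nu> = 0" by (rule reduced) (use less.prems in auto)
    then have "degree (p \<nu>) = 0"
      by (intro poly_periodic_imp_degree_0[of _ "of_real (ln (1/2))"])
        (auto simp: scale_reduce_def simp flip: smult_diff_right)
    then obtain c where c: "p \<nu> = [:c:]" by (rule degree_eq_zeroE)
    have f: "log_poly_sum \<Lambda> p \<zeta> = c * of_real \<zeta> powr \<nu>" for \<zeta>
      unfolding log_poly_sum_def using assms(1) less.prems(2) zero
      by (subst sum.remove[of _ \<nu>]) (auto simp: c intro!: sum.neutral)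
    have "norm c \<le> 0"
    proof (rule not_log_integrable_bounded_below[OF less.prems(1)])
      fix \<zeta> :: real assume \<zeta>: "0 < \<zeta>" "\<zeta> < 1"
      have "1 \<le> \<zeta> powr Re \<nu>" using \<zeta> powr_mono2'[of "Re \<nu>" \<zeta> 1] assms(2)[OF less.prems(2)] by simp
      then show "norm c \<le> norm (log_poly_sum \<Lambda> p \<zeta>)"
        using \<zeta> by (simp add: f norm_mult norm_powr_real_powr mult_le_cancel_left1)
    qed
    then show False using nz c by simp
  qed
qed

subsection \<open>The integral condition\<close>

lemma sigma_eq_coefB: "0 < \<zeta> \<Longrightarrow> sigma u x \<zeta> = coefB u \<zeta> (x / \<zeta>) / of_real x"
  by (simp add: sigma_def coefB_eq_coefA)

section \<open>Sufficiency of positive exponents\<close>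

lemma expansion_bound_positive:
  assumes K: "index_set K" and pos: "\<And>z. z \<in> K \<Longrightarrow> 0 < Re (fst z)"
    and g: "\<And>\<alpha> k. (\<alpha>, k) \<in> K \<Longrightarrow> derivs_on UNIV (g \<alpha> k)"
  shows "\<exists>e C. 0 < e \<and> e \<le> 1 \<and> (\<forall>x\<in>{0..X}. \<forall>y\<in>{0<..1}. norm (expansion (upto_order K N) g i 0 x y) \<le> C * y powr e)"
proof -
  \<comment> \<open>Half of the least exponent leaves room for the logarithms. The inserted 1
    ensures e \<le> 1, so that a remainder O(\<zeta>) is also O(\<zeta>^e).\<close>
  define e where "e = Min (insert 1 ((\<lambda>z. Re (fst z)) ` upto_order K N)) / 2"
  have fin: "finite (insert 1 ((\<lambda>z. Re (fst z)) ` upto_order K N))" using finite_upto_order[OF K] by simp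
  have "0 < Min (insert 1 ((\<lambda>z. Re (fst z)) ` upto_order K N))"
    by (subst Min_gr_iff[OF fin]) (use pos upto_order_subset[of K N] in force)+
  then have e: "0 < e" by (simp add: e_def)
  have e1: "e \<le> 1" using Min_le[OF fin, of 1] e by (simp add: e_def)
  have le: "e < Re (fst z)" if "z \<in> upto_order K N" for z
    using Min_le[OF fin, of "Re (fst z)"] e that unfolding e_def by force
  have "\<exists>C. \<forall>z\<in>{0..X} \<times> {0<..1}. norm (expansion (upto_order K N) g i 0 (fst z) (snd z)) \<le> C * snd z powr e"
    by (rule expansion_bound[OF finite_upto_order[OF K] le g]) (use upto_order_subset in auto)
  then obtain C where "\<forall>z\<in>{0..X} \<times> {0<..1}. norm (expansion (upto_order K N) g i 0 (fst z) (snd z)) \<le> C * snd z powr e"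
    by blast
  then show ?thesis using e e1 by (intro exI[of _ e] exI[of _ C]) force
qed

lemma nn_integral_powr_0_1:
  assumes "0 < e" "0 \<le> C"
  shows "(\<integral>\<^sup>+\<zeta>\<in>{0..1}. ennreal (C * \<zeta> powr (e - 1)) \<partial>lborel) = ennreal (C / e)"
proof (rule nn_integral_has_integral_lebesgue')
  show "((\<lambda>\<zeta>. C * \<zeta> powr (e - 1)) has_integral C / e) {0..1}"
    using has_integral_mult_right[OF has_integral_powr_from_0[of "e - 1" 1], of C] assms by simp
qed (use assms in simp)

lemma integral_condition_if_positive:
  assumes phg: "phg_corner {0..} {0..} K (\<lambda>t \<zeta>. coefB u \<zeta> t)" and K: "index_set K"
    and pos: "\<And>z. z \<in> K \<Longrightarrow> 0 < Re (fst z)"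
  shows "integral_condition u"
  unfolding integral_condition_def
proof
  fix p
  have "{0..1} \<subseteq> {0::real..}" by auto
  from phg_corner_estimate[OF phg K zero_less_one order_refl this]
  obtain V g where V: "\<And>n. partials_upto n {0..} ({0..} \<inter> {0<..}) (V 0 0) V"
    and uV: "\<And>t \<zeta>. 0 < t \<Longrightarrow> \<zeta> \<in> {0..} \<Longrightarrow> 0 < \<zeta> \<Longrightarrow> coefB u \<zeta> t = of_real t * V 0 0 t \<zeta>"
    and g: "\<And>\<alpha> k. (\<alpha>, k) \<in> K \<Longrightarrow> derivs_on UNIV (g \<alpha> k)"
    and est: "\<And>N p X. \<exists>C. \<forall>x\<in>{0..X}. \<forall>y\<in>{0<..1}.
       norm (V p 0 x y - expansion (upto_order K N) g p 0 x y) \<le> C * y ^ N"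
    by blast
  have deriv: "nth_deriv {0..} p (\<lambda>x. sigma_ext u x \<zeta>) (\<zeta> * t) = V p 0 t \<zeta> / of_real (\<zeta> ^ Suc p)"
    if \<zeta>: "0 < \<zeta>" and t: "0 \<le> t" for \<zeta> t
  proof -
    \<comment> \<open>The x-derivatives of V(x / \<zeta>, \<zeta>) / \<zeta>, which is \<sigma> for
      x > 0 and continuous at 0. Each derivative brings a factor 1 / \<zeta>, and the weight
      \<zeta>^p of the integral later cancels all but one of them.\<close>
    define W where "W i x = of_real (1 / \<zeta> ^ Suc i) * V i 0 (x / \<zeta>) \<zeta>" for i x
    have W: "derivs_on {0..} W"
      unfolding derivs_on_def
    proof (intro allI ballI)
      fix n and x :: real assume x: "x \<in> {0..}"
      have 1: "((\<lambda>x. x / \<zeta>) has_vector_derivative 1 / \<zeta>) (at x within {0..})"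
        using \<zeta> by (auto intro!: derivative_eq_intros simp flip: has_real_derivative_iff_has_vector_derivative)
      have "((\<lambda>x. V n 0 x \<zeta>) has_vector_derivative V (Suc n) 0 (x / \<zeta>) \<zeta>) (at (x / \<zeta>) within (\<lambda>x. x / \<zeta>) ` {0..})"
        by (rule has_vector_derivative_within_subset[OF partials_uptoD(3)[OF V[of "Suc n"]]]) (use x \<zeta> in auto)
      from vector_diff_chain_within[OF 1 this]
      have "((\<lambda>x. V n 0 (x / \<zeta>) \<zeta>) has_vector_derivative (1 / \<zeta>) *\<^sub>R V (Suc n) 0 (x / \<zeta>) \<zeta>) (at x within {0..})"
        by (simp add: o_def)
      from has_vector_derivative_mult_right[OF this, of "of_real (1 / \<zeta> ^ Suc n)"]
      show "(W n has_vector_derivative W (Suc n) x) (at x within {0..})"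
        unfolding W_def[abs_def] by (simp add: scaleR_conv_of_real mult_ac)
    qed
    have sigma_W: "sigma u x \<zeta> = W 0 x" if "0 < x" for x
      using that \<zeta> uV[of "x / \<zeta>" \<zeta>] by (simp add: sigma_eq_coefB W_def)
    have "(W 0 \<longlongrightarrow> W 0 0) (at_right 0)"
      using derivs_on_continuous[OF W, of 0] by (auto simp: continuous_on intro: tendsto_within_subset)
    then have "((\<lambda>s. sigma u s \<zeta>) \<longlongrightarrow> W 0 0) (at_right 0)"
      by (rule Lim_transform_eventually) (auto simp: eventually_at_right_field sigma_W intro!: exI[of _ 1])
    then have "Lim (at_right 0) (\<lambda>s. sigma u s \<zeta>) = W 0 0"
      by (intro tendsto_Lim) auto
    then have "W 0 x = sigma_ext u x \<zeta>" if "x \<in> {0..}" for x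
      using sigma_W that by (simp add: sigma_ext_def)
    then have "nth_deriv {0..} p (\<lambda>x. sigma_ext u x \<zeta>) (\<zeta> * t) = W p (\<zeta> * t)"
      by (intro nth_deriv_eq[OF W]) (use \<zeta> t in \<open>auto simp: at_within_ge0\<close>)
    then show ?thesis using \<zeta> by (simp add: W_def)
  qed
  \<comment> \<open>Order 1 is enough: a remainder O(\<zeta>) is integrable against
    d\<zeta>/\<zeta>.\<close>
  obtain C where C: "\<And>t \<zeta>. t \<in> {0..1} \<Longrightarrow> \<zeta> \<in> {0<..1} \<Longrightarrow>
       norm (V p 0 t \<zeta> - expansion (upto_order K 1) g p 0 t \<zeta>) \<le> C * \<zeta> ^ 1"
    using est by blast
  obtain e B where e: "0 < e" "e \<le> 1" and B: "\<And>t \<zeta>. t \<in> {0..1} \<Longrightarrow> \<zeta> \<in> {0<..1} \<Longrightarrow>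
       norm (expansion (upto_order K 1) g p 0 t \<zeta>) \<le> B * \<zeta> powr e"
    using expansion_bound_positive[where g=g and K=K, OF K pos g] by blast
  define A where "A = max C 0 + max B 0"
  have V_le: "norm (V p 0 t \<zeta>) \<le> A * \<zeta> powr e" if t: "t \<in> {0..1}" and \<zeta>: "\<zeta> \<in> {0<..1}" for t \<zeta>
  proof -
    have "C * \<zeta> ^ 1 \<le> max C 0 * \<zeta> powr e"
      using \<zeta> e powr_mono'[of e 1 \<zeta>] by (intro mult_mono) auto
    moreover have "B * \<zeta> powr e \<le> max B 0 * \<zeta> powr e" by (intro mult_right_mono) auto
    ultimately show ?thesis
      using C[OF t \<zeta>] B[OF t \<zeta>] norm_triangle_sub[of "V p 0 t \<zeta>" "expansion (upto_order K 1) g p 0 t \<zeta>"]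
      by (simp add: A_def distrib_right)
  qed
  show "\<exists>C::real. \<forall>t\<in>{0..1}. (\<integral>\<^sup>+\<zeta>\<in>{0<..<1}. ennreal (\<zeta> ^ p *
        norm (nth_deriv {0..} p (\<lambda>x. sigma_ext u x \<zeta>) (\<zeta> * t))) \<partial>lborel) \<le> ennreal C"
  proof (intro exI[of _ "A / e"] ballI)
    fix t :: real assume t: "t \<in> {0..1}"
    have "(\<integral>\<^sup>+\<zeta>\<in>{0<..<1}. ennreal (\<zeta> ^ p * norm (nth_deriv {0..} p (\<lambda>x. sigma_ext u x \<zeta>) (\<zeta> * t))) \<partial>lborel)
      \<le> (\<integral>\<^sup>+\<zeta>\<in>{0..1}. ennreal (A * \<zeta> powr (e - 1)) \<partial>lborel)"
    proof (rule nn_integral_mono)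
      fix \<zeta> :: real
      show "ennreal (\<zeta> ^ p * norm (nth_deriv {0..} p (\<lambda>x. sigma_ext u x \<zeta>) (\<zeta> * t))) * indicator {0<..<1} \<zeta>
        \<le> ennreal (A * \<zeta> powr (e - 1)) * indicator {0..1} \<zeta>"
      proof (cases "\<zeta> \<in> {0<..<1}")
        case True
        have "\<zeta> ^ p * norm (nth_deriv {0..} p (\<lambda>x. sigma_ext u x \<zeta>) (\<zeta> * t)) = norm (V p 0 t \<zeta>) / \<zeta>"
          using True t by (simp add: deriv norm_divide norm_mult norm_power)
        also have "\<dots> \<le> A * \<zeta> powr e / \<zeta>"
          using V_le[OF t, of \<zeta>] True by (intro divide_right_mono) auto
        also have "\<dots> = A * \<zeta> powr (e - 1)" using True by (simp add: powr_diff)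
        finally show ?thesis using True by (simp add: ennreal_leI)
      qed simp
    qed
    also have "\<dots> = ennreal (A / e)" by (rule nn_integral_powr_0_1) (use e in \<open>auto simp: A_def\<close>)
    finally show "(\<integral>\<^sup>+\<zeta>\<in>{0<..<1}. ennreal (\<zeta> ^ p *
        norm (nth_deriv {0..} p (\<lambda>x. sigma_ext u x \<zeta>) (\<zeta> * t))) \<partial>lborel) \<le> ennreal (A / e)" .
  qed
qed

section \<open>Necessity of positive exponents\<close>

lemma log_integrable_powr_bound:
  assumes "0 < e" "\<And>\<zeta>. 0 < \<zeta> \<Longrightarrow> \<zeta> < 1 \<Longrightarrow> norm (f \<zeta>) \<le> C * \<zeta> powr e"
  shows "log_integrable f"
proof -
  have "(\<integral>\<^sup>+\<zeta>\<in>{0<..<1}. ennreal (norm (f \<zeta>) / \<zeta>) \<partial>lborel)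
    \<le> (\<integral>\<^sup>+\<zeta>\<in>{0..1}. ennreal (max C 0 * \<zeta> powr (e - 1)) \<partial>lborel)"
  proof (rule nn_integral_mono)
    fix \<zeta> :: real
    show "ennreal (norm (f \<zeta>) / \<zeta>) * indicator {0<..<1} \<zeta> \<le> ennreal (max C 0 * \<zeta> powr (e - 1)) * indicator {0..1} \<zeta>"
    proof (cases "\<zeta> \<in> {0<..<1}")
      case True
      have "norm (f \<zeta>) \<le> max C 0 * \<zeta> powr e"
        using assms(2)[of \<zeta>] True order_trans[OF _ mult_right_mono[of C "max C 0" "\<zeta> powr e"]] by simp
      then have "norm (f \<zeta>) / \<zeta> \<le> max C 0 * \<zeta> powr (e - 1)"
        using True by (simp add: powr_diff field_simps)
      then show ?thesis using True by (simp add: ennreal_leI)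
    qed simp
  qed
  also have "\<dots> = ennreal (max C 0 / e)" by (rule nn_integral_powr_0_1) (use assms in auto)
  also have "\<dots> < \<infinity>" by simp
  finally show ?thesis by (simp add: log_integrable_def)
qed

lemma log_integrable_cong:
  assumes "\<And>\<zeta>. 0 < \<zeta> \<Longrightarrow> f \<zeta> = g \<zeta>" "log_integrable f"
  shows "log_integrable g"
proof -
  have "(\<integral>\<^sup>+\<zeta>\<in>{0<..<1}. ennreal (norm (f \<zeta>) / \<zeta>) \<partial>lborel) = (\<integral>\<^sup>+\<zeta>\<in>{0<..<1}. ennreal (norm (g \<zeta>) / \<zeta>) \<partial>lborel)"
    by (intro nn_integral_cong) (auto simp: assms(1) indicator_def)
  then show ?thesis using assms(2) by (simp add: log_integrable_def)
qed

lemma log_integrable_diff: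
  assumes "continuous_on {0<..} f" "continuous_on {0<..} g" "log_integrable f" "log_integrable g"
  shows "log_integrable (\<lambda>\<zeta>. f \<zeta> - g \<zeta>)"
  by (rule log_integrable_combine[OF assms, where a=1 and b=1]) (auto intro: norm_triangle_ineq4)

lemma log_integrable_sum:
  assumes "finite I" "\<And>z. z \<in> I \<Longrightarrow> continuous_on {0<..} (f z)" "\<And>z. z \<in> I \<Longrightarrow> log_integrable (f z)"
  shows "log_integrable (\<lambda>\<zeta>. \<Sum>z\<in>I. f z \<zeta>)"
  using assms
proof (induction I rule: finite_induct)
  case empty
  then show ?case by (simp add: log_integrable_def)
next
  case (insert z I)
  have "continuous_on {0<..} (\<lambda>\<zeta>. \<Sum>z\<in>I. f z \<zeta>)" using insert by (intro continuous_intros) auto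
  then have "log_integrable (\<lambda>\<zeta>. f z \<zeta> + (\<Sum>z\<in>I. f z \<zeta>))"
    by (rule log_integrable_combine[where f="f z" and g="\<lambda>\<zeta>. \<Sum>z\<in>I. f z \<zeta>" and a=1 and b=1, rotated])
      (use insert in \<open>auto intro: norm_triangle_ineq\<close>)
  then show ?case using insert by simp
qed

text \<open>The terms with a common exponent \<alpha> are collected into one polynomial in ln
  \<zeta> whose coefficients are the \<open>c \<alpha> k\<close>; its vanishing kills each of
  them.\<close>

lemma powr_ln_sum_integrable_imp_zero:
  assumes I: "finite I" and Re: "\<And>z. z \<in> I \<Longrightarrow> Re (fst z) \<le> 0"
    and int: "log_integrable (\<lambda>\<zeta>. \<Sum>(\<alpha>, k)\<in>I. powr_ln \<alpha> k 0 \<zeta> * c \<alpha> k)" and "(\<alpha>, k) \<in> I"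
  shows "c \<alpha> k = 0"
proof -
  define B where "B \<alpha> = {k. (\<alpha>, k) \<in> I}" for \<alpha>
  define p where "p \<alpha> = (\<Sum>k\<in>B \<alpha>. monom (c \<alpha> k) k)" for \<alpha>
  have finB: "finite (B \<alpha>)" for \<alpha>
    using finite_subset[of "B \<alpha>" "snd ` I"] I by (force simp: B_def)
  have I_eq: "I = Sigma (fst ` I) B" by (force simp: B_def)
  have "(\<Sum>(\<alpha>, k)\<in>I. powr_ln \<alpha> k 0 \<zeta> * c \<alpha> k) = log_poly_sum (fst ` I) p \<zeta>" for \<zeta>
  proof -
    have "(\<Sum>(\<alpha>, k)\<in>I. powr_ln \<alpha> k 0 \<zeta> * c \<alpha> k) = (\<Sum>\<alpha>\<in>fst ` I. \<Sum>k\<in>B \<alpha>. powr_ln \<alpha> k 0 \<zeta> * c \<alpha> k)"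
      by (subst I_eq, subst sum.Sigma) (use I finB in auto)
    also have "\<dots> = log_poly_sum (fst ` I) p \<zeta>"
      unfolding log_poly_sum_def p_def poly_sum poly_monom powr_ln_0 sum_distrib_right
      by (intro sum.cong refl) (simp add: mult_ac)
    finally show ?thesis .
  qed
  then have "log_integrable (log_poly_sum (fst ` I) p)" using int by simp
  from log_poly_sum_integrable_imp_zero[OF _ _ this, of \<alpha>]
  have "p \<alpha> = 0" using I Re \<open>(\<alpha>, k) \<in> I\<close> by force
  then have "coeff (p \<alpha>) k = 0" by simp
  moreover have "coeff (p \<alpha>) k = c \<alpha> k"
    using finB[of \<alpha>] \<open>(\<alpha>, k) \<in> I\<close> by (simp add: p_def coeff_sum B_def)
  ultimately show ?thesis by simp
qed

text \<open>The case p = 0 at a fixed t. With x = \<zeta> t the integrand is the norm of u_B divided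
  by \<zeta> t, and t \<le> 1 makes it dominate the norm of u_B divided by \<zeta>.\<close>

lemma integral_condition_log_integrable:
  assumes "integral_condition u" "0 < t" "t \<le> 1"
  shows "log_integrable (\<lambda>\<zeta>. coefB u \<zeta> t)"
proof -
  obtain C where "\<forall>t\<in>{0..1}. (\<integral>\<^sup>+\<zeta>\<in>{0<..<1}. ennreal (\<zeta> ^ 0 *
        norm (nth_deriv {0..} 0 (\<lambda>x. sigma_ext u x \<zeta>) (\<zeta> * t))) \<partial>lborel) \<le> ennreal C"
    using assms(1) unfolding integral_condition_def by blast
  then have C: "(\<integral>\<^sup>+\<zeta>\<in>{0<..<1}. ennreal (norm (sigma_ext u (\<zeta> * t) \<zeta>)) \<partial>lborel) \<le> ennreal C"
    using assms by (simp add: nth_deriv_def)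
  have "(\<integral>\<^sup>+\<zeta>\<in>{0<..<1}. ennreal (norm (coefB u \<zeta> t) / \<zeta>) \<partial>lborel)
    \<le> (\<integral>\<^sup>+\<zeta>\<in>{0<..<1}. ennreal (norm (sigma_ext u (\<zeta> * t) \<zeta>)) \<partial>lborel)"
  proof (rule nn_integral_mono)
    fix \<zeta> :: real
    show "ennreal (norm (coefB u \<zeta> t) / \<zeta>) * indicator {0<..<1} \<zeta>
      \<le> ennreal (norm (sigma_ext u (\<zeta> * t) \<zeta>)) * indicator {0<..<1} \<zeta>"
    proof (cases "\<zeta> \<in> {0<..<1}")
      case True
      have "norm (coefB u \<zeta> t) / \<zeta> \<le> norm (coefB u \<zeta> t) / (\<zeta> * t)"
        using True assms by (intro divide_left_mono) auto
      also have "\<dots> = norm (sigma_ext u (\<zeta> * t) \<zeta>)"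
        using True assms by (simp add: sigma_ext_def sigma_eq_coefB norm_divide norm_mult)
      finally show ?thesis using True by (simp add: ennreal_leI)
    qed simp
  qed
  also note C
  finally show ?thesis unfolding log_integrable_def by (simp add: order.strict_trans1)
qed

lemma index_set_Re_positive:
  assumes K: "index_set K"
  shows "index_set {z \<in> K. 0 < Re (fst z)}"
  unfolding index_set_def
proof (intro conjI allI impI)
  let ?K = "{z \<in> K. 0 < Re (fst z)}"
  obtain \<alpha> k where z: "(\<alpha>, k) \<in> K" using K unfolding index_set_def by fastforce
  \<comment> \<open>An index set must be non-empty; shifts by natural numbers move any exponent into
    the right half plane.\<close>
  then have "(\<alpha> + of_nat (nat \<lceil>1 - Re \<alpha>\<rceil>), k) \<in> K" using K unfolding index_set_def by blast
  moreover have "0 < Re (\<alpha> + of_nat (nat \<lceil>1 - Re \<alpha>\<rceil>))"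
    using real_nat_ceiling_ge[of "1 - Re \<alpha>"] by simp
  ultimately show "?K \<noteq> {}" by fastforce
  show "\<not> z islimpt ?K" for z
    using K islimpt_subset[of z ?K K] unfolding index_set_def by blast
  show "filterlim (\<lambda>j. Re (fst (s j))) at_top sequentially"
    if "\<forall>j. s j \<in> ?K" "filterlim (\<lambda>j. norm (fst (s j), real (snd (s j)))) at_top sequentially"
    for s :: "nat \<Rightarrow> complex \<times> nat"
    using K that unfolding index_set_def by blast
  show "(\<alpha> + of_nat p, k) \<in> ?K" if "(\<alpha>, k) \<in> ?K" for \<alpha> k p
    using K that unfolding index_set_def by (simp add: add_pos_nonneg)
  show "(\<alpha>, p) \<in> ?K" if "(\<alpha>, k) \<in> ?K" "p < k" for \<alpha> k p
    using K that unfolding index_set_def by auto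
qed

text \<open>For fixed t in (0,1], u_B is the sum of the terms with Re \<alpha> \<le> 0, those with 0
  < Re \<alpha> \<le> 1, and a remainder O(\<zeta>). The last two and u_B itself are integrable
  against d\<zeta>/\<zeta>, hence so is the first, and its coefficients vanish at t. The part of K
  with positive real parts then serves as an index set over 0 \<le> t \<le> 1, where minimality
  applies.\<close>

lemma integral_condition_imp_positive:
  assumes phg: "phg_corner {0..} {0..} K (\<lambda>t \<zeta>. coefB u \<zeta> t)" and K: "index_set K"
    and minimal: "minimal_at_G2 K u" and int: "integral_condition u" and "z \<in> K"
  shows "0 < Re (fst z)"
proof -
  obtain v where v: "smooth_on_prod {0..} ({0..} \<inter> {0<..}) v"
      "\<And>t \<zeta>. 0 < t \<Longrightarrow> 0 < \<zeta> \<Longrightarrow> coefB u \<zeta> t = of_real t * v t \<zeta>"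
    using phg unfolding phg_corner_def phg_face3_def by auto
  obtain c where c: "\<forall>(\<alpha>, k)\<in>K. \<exists>g. smooth_real g \<and> (\<forall>x\<in>{0..}. c \<alpha> k x = of_real x * g x)"
      "\<And>N. \<exists>R D. partials_upto N {0..} {0..} R D \<and>
           (\<forall>x\<in>{0..}. \<forall>j<N. D 0 j x 0 = 0) \<and>
           (\<forall>x\<in>{0..}. \<forall>y\<in>{0..}. x > 0 \<longrightarrow> y > 0 \<longrightarrow>
              coefB u y x - (\<Sum>(\<alpha>, k)\<in>upto_order K N.
                 of_real y powr \<alpha> * of_real (ln y) ^ k * c \<alpha> k x) = R x y)"
    using phg unfolding phg_corner_def by blast
  have coeff_zero: "c \<alpha> k t = 0" if t: "0 < t" "t \<le> 1" and \<alpha>k: "(\<alpha>, k) \<in> upto_order K 0" for \<alpha> k t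
  proof -
    \<comment> \<open>Order 1 rather than 0: a merely continuous remainder need not be integrable
      against d\<zeta>/\<zeta>, whereas a continuously differentiable one that vanishes at 0
      is.\<close>
    obtain R D where P: "partials_upto 1 {0..} {0..} R D" and RD: "\<forall>x\<in>{0..}. \<forall>j<1. D 0 j x 0 = 0"
         "\<forall>x\<in>{0..}. \<forall>y\<in>{0..}. x > 0 \<longrightarrow> y > 0 \<longrightarrow>
              coefB u y x - (\<Sum>(\<alpha>, k)\<in>upto_order K 1.
                 of_real y powr \<alpha> * of_real (ln y) ^ k * c \<alpha> k x) = R x y"
      using c(2)[of 1] by blast
    let ?T = "\<lambda>z \<zeta>. case z of (\<alpha>, k) \<Rightarrow> powr_ln \<alpha> k 0 \<zeta> * c \<alpha> k t"
    let ?J = "upto_order K 1 - upto_order K 0"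
    have T_cont: "continuous_on {0<..} (?T z)" for z
      using derivs_on_continuous[OF derivs_on_powr_ln] by (cases z) (auto intro!: continuous_intros)
    have R: "R t \<zeta> = coefB u \<zeta> t - (\<Sum>z\<in>upto_order K 1. ?T z \<zeta>)" if "0 < \<zeta>" for \<zeta>
      using RD(2) t that by (simp add: powr_ln_0)
    have D00: "D 0 0 t \<zeta> = R t \<zeta>" if "0 \<le> \<zeta>" for \<zeta>
      using partials_uptoD(1)[OF P] t that by simp
    have D_cont: "continuous_on {0..} (\<lambda>\<zeta>. D 0 j t \<zeta>)" if "j \<le> 1" for j
    proof -
      have "continuous_on {0..} ((\<lambda>(x, y). D 0 j x y) \<circ> (\<lambda>\<zeta>. (t, \<zeta>)))"
        by (intro continuous_on_compose continuous_on_subset[OF partials_uptoD(2)[OF P]] continuous_intros)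
          (use t that in auto)
      then show ?thesis by (simp add: o_def)
    qed
    obtain C where C: "\<And>\<zeta>. \<zeta> \<in> {0..1} \<Longrightarrow> norm (D 0 1 t \<zeta>) \<le> C"
      using continuous_bound_exists[OF compact_Icc continuous_on_subset[OF D_cont[OF order_refl] Icc_subset_Ici_iff[THEN iffD2, OF disjI2[OF order_refl]]], of 1]
      by blast
    have R_int: "log_integrable (D 0 0 t)"
    proof (rule log_integrable_powr_bound[of 1])
      fix \<zeta> :: real assume \<zeta>: "0 < \<zeta>" "\<zeta> < 1"
      have "norm (D 0 0 t \<zeta>) \<le> C * \<zeta> ^ 1"
      proof (rule norm_le_power_of_vanishing_derivatives[of 1 1 "\<lambda>j. D 0 j t"])
        fix j y assume "j < (1::nat)" "y \<in> {0..1::real}"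
        then show "(D 0 j t has_vector_derivative D 0 (Suc j) t y) (at y within {0..1})"
          using has_vector_derivative_within_subset[OF partials_uptoD(4)[OF P, of 0 j t y], of "{0..1}"] t
          by (auto simp: subset_iff)
      qed (use C RD(1) t \<zeta> in auto)
      then show "norm (D 0 0 t \<zeta>) \<le> C * \<zeta> powr 1" using \<zeta> by simp
    qed simp
    have R_cont: "continuous_on {0<..} (D 0 0 t)"
      using continuous_on_subset[OF D_cont[of 0] greaterThan_subset_atLeast] by simp
    have J_int: "log_integrable (\<lambda>\<zeta>. \<Sum>z\<in>?J. ?T z \<zeta>)"
    proof (rule log_integrable_sum)
      fix z assume "z \<in> ?J"
      obtain \<beta> l where z: "z = (\<beta>, l)" by (cases z)
      have "0 < Re \<beta>" using \<open>z \<in> ?J\<close> by (auto simp: z upto_order_def)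
      then have "Re \<beta> / 2 < Re \<beta> - real 0" by simp
      from powr_ln_bound[OF this, of l] obtain B where B: "\<And>y. y \<in> {0<..1} \<Longrightarrow> norm (powr_ln \<beta> l 0 y) \<le> B * y powr (Re \<beta> / 2)"
        by blast
      show "log_integrable (?T z)"
      proof (rule log_integrable_powr_bound[of "Re \<beta> / 2" _ "B * norm (c \<beta> l t)"])
        fix \<zeta> :: real assume "0 < \<zeta>" "\<zeta> < 1"
        then show "norm (?T z \<zeta>) \<le> B * norm (c \<beta> l t) * \<zeta> powr (Re \<beta> / 2)"
          using mult_right_mono[OF B[of \<zeta>] norm_ge_zero[of "c \<beta> l t"]] by (simp add: z norm_mult mult_ac)
      qed (use \<open>0 < Re \<beta>\<close> in simp)
    qed (use finite_upto_order[OF K] T_cont in auto)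
    have J_cont: "continuous_on {0<..} (\<lambda>\<zeta>. \<Sum>z\<in>?J. ?T z \<zeta>)"
      by (intro continuous_on_sum T_cont)
    have u_eq: "coefB u \<zeta> t = D 0 0 t \<zeta> + (\<Sum>z\<in>upto_order K 1. ?T z \<zeta>)" if "0 < \<zeta>" for \<zeta>
      using R[OF that] D00[of \<zeta>] that by simp
    have "continuous_on {0<..} (\<lambda>\<zeta>. D 0 0 t \<zeta> + (\<Sum>z\<in>upto_order K 1. ?T z \<zeta>))"
      by (intro continuous_on_add R_cont continuous_on_sum T_cont)
    then have u_cont: "continuous_on {0<..} (\<lambda>\<zeta>. coefB u \<zeta> t)"
      by (rule continuous_on_eq) (simp only: u_eq greaterThan_iff)
    have "log_integrable (\<lambda>\<zeta>. (coefB u \<zeta> t - (\<Sum>z\<in>?J. ?T z \<zeta>)) - D 0 0 t \<zeta>)"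
      by (intro log_integrable_diff continuous_on_diff u_cont J_cont R_cont J_int R_int
          integral_condition_log_integrable[OF int t])
    moreover have "(coefB u \<zeta> t - (\<Sum>z\<in>?J. ?T z \<zeta>)) - D 0 0 t \<zeta> = (\<Sum>z\<in>upto_order K 0. ?T z \<zeta>)" if "0 < \<zeta>" for \<zeta>
      unfolding u_eq[OF that]
      using sum.subset_diff[OF upto_order_mono[of 0 1 K] finite_upto_order[OF K], of "\<lambda>z. ?T z \<zeta>"] by simp
    ultimately have "log_integrable (\<lambda>\<zeta>. \<Sum>z\<in>upto_order K 0. ?T z \<zeta>)"
      using log_integrable_cong by (metis (no_types, lifting))
    from powr_ln_sum_integrable_imp_zero[OF finite_upto_order[OF K] _ this \<alpha>k]
    show ?thesis by (auto simp: upto_order_def)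
  qed
  let ?K = "{z \<in> K. 0 < Re (fst z)}"
  have "phg_corner {0..1} {0..} ?K (\<lambda>t \<zeta>. coefB u \<zeta> t)"
    unfolding phg_corner_def
  proof (intro conjI exI[of _ c] allI)
    have "smooth_on_prod {0..1} ({0..} \<inter> {0<..}) v"
      by (rule smooth_on_prod_subset[OF v(1)]) auto
    then show "phg_face3 {0..1} {0..} (\<lambda>t \<zeta>. coefB u \<zeta> t)"
      unfolding phg_face3_def by (intro exI[of _ v]) (use v(2) in auto)
    show "\<forall>(\<alpha>, k)\<in>?K. \<exists>g. smooth_real g \<and> (\<forall>x\<in>{0..1}. c \<alpha> k x = of_real x * g x)"
    proof (intro ballI)
      fix z assume z: "z \<in> ?K"
      obtain \<alpha> k where ze: "z = (\<alpha>, k)" by (cases z)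
      obtain g where "smooth_real g" "\<forall>x\<in>{0..}. c \<alpha> k x = of_real x * g x"
        using c(1) z unfolding ze by blast
      then show "case z of (\<alpha>, k) \<Rightarrow> \<exists>g. smooth_real g \<and> (\<forall>x\<in>{0..1}. c \<alpha> k x = of_real x * g x)"
        unfolding ze by auto
    qed
    fix N
    obtain R D where P: "partials_upto N {0..} {0..} R D" and RD: "\<forall>x\<in>{0..}. \<forall>j<N. D 0 j x 0 = 0"
         "\<forall>x\<in>{0..}. \<forall>y\<in>{0..}. x > 0 \<longrightarrow> y > 0 \<longrightarrow>
              coefB u y x - (\<Sum>(\<alpha>, k)\<in>upto_order K N.
                 of_real y powr \<alpha> * of_real (ln y) ^ k * c \<alpha> k x) = R x y"
      using c(2)[of N] by blast
    \<comment> \<open>For 0 < x \<le> 1 the discarded terms are zero, so the remainder that belongs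
      to K can be reused.\<close>
    have "(\<Sum>(\<alpha>, k)\<in>upto_order ?K N. of_real y powr \<alpha> * of_real (ln y) ^ k * c \<alpha> k x) =
       (\<Sum>(\<alpha>, k)\<in>upto_order K N. of_real y powr \<alpha> * of_real (ln y) ^ k * c \<alpha> k x)"
      if "0 < x" "x \<le> 1" for x y
    proof (rule sum.mono_neutral_left[OF finite_upto_order[OF K]])
      show "\<forall>z\<in>upto_order K N - upto_order ?K N.
          (case z of (\<alpha>, k) \<Rightarrow> of_real y powr \<alpha> * of_real (ln y) ^ k * c \<alpha> k x) = 0"
      proof
        fix z assume z: "z \<in> upto_order K N - upto_order ?K N"
        obtain \<alpha> k where ze: "z = (\<alpha>, k)" by (cases z)
        have "(\<alpha>, k) \<in> upto_order K 0" using z by (auto simp: ze upto_order_def)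
        then have "c \<alpha> k x = 0" by (rule coeff_zero[OF that])
        then show "(case z of (\<alpha>, k) \<Rightarrow> of_real y powr \<alpha> * of_real (ln y) ^ k * c \<alpha> k x) = 0"
          by (simp add: ze)
      qed
    qed (auto simp: upto_order_def)
    then show "\<exists>R D. partials_upto N {0..1} {0..} R D \<and> (\<forall>x\<in>{0..1}. \<forall>j<N. D 0 j x 0 = 0) \<and>
        (\<forall>x\<in>{0..1}. \<forall>y\<in>{0..}. x > 0 \<longrightarrow> y > 0 \<longrightarrow>
          coefB u y x - (\<Sum>(\<alpha>, k)\<in>upto_order ?K N. of_real y powr \<alpha> * of_real (ln y) ^ k * c \<alpha> k x) = R x y)"
      using partials_upto_subset[OF P, of "{0..1}" "{0..}" R] RD
      by (intro exI[of _ R] exI[of _ D]) auto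
  qed
  with minimal index_set_Re_positive[OF K] have "K \<subseteq> ?K" unfolding minimal_at_G2_def by blast
  then show ?thesis using \<open>z \<in> K\<close> by blast
qed

subsection \<open>Smooth extension to the boundary\<close>

text \<open>A real exponent serves both uses: quadratic Taylor remainders in the extension to x = 0,
  and decay at some unspecified rate above 1 in the extension to y = 0.\<close>

lemma has_vector_derivative_of_le_powr:
  fixes f :: "real \<Rightarrow> complex"
  assumes e: "1 < e" and d: "0 < d"
    and le: "\<And>s. s \<in> T \<Longrightarrow> \<bar>s - x\<bar> < d \<Longrightarrow> norm (f s - f x - (s - x) *\<^sub>R f') \<le> C * \<bar>s - x\<bar> powr e"
  shows "(f has_vector_derivative f') (at x within T)"
  unfolding has_vector_derivative_def has_derivative_iff_norm
proof (intro conjI bounded_linear_scaleR_left)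
  have "((\<lambda>s. C * \<bar>s - x\<bar> powr (e - 1)) \<longlongrightarrow> C * 0) (at x within T)"
    by (intro tendsto_mult tendsto_const tendsto_zero_powrI[where b = "e - 1"])
      (use e in \<open>auto intro!: tendsto_eq_intros\<close>)
  then have lim: "((\<lambda>s. C * \<bar>s - x\<bar> powr (e - 1)) \<longlongrightarrow> 0) (at x within T)" by simp
  show "((\<lambda>s. norm (f s - f x - (s - x) *\<^sub>R f') / norm (s - x)) \<longlongrightarrow> 0) (at x within T)"
  proof (rule Lim_null_comparison[OF _ lim])
    show "\<forall>\<^sub>F s in at x within T. norm (norm (f s - f x - (s - x) *\<^sub>R f') / norm (s - x)) \<le> C * \<bar>s - x\<bar> powr (e - 1)"
      unfolding eventually_at
    proof (intro exI[of _ d] conjI ballI impI d)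
      fix s assume s: "s \<in> T" "s \<noteq> x \<and> dist s x < d"
      have "norm (f s - f x - (s - x) *\<^sub>R f') / \<bar>s - x\<bar> \<le> C * \<bar>s - x\<bar> powr e / \<bar>s - x\<bar>"
        using le[of s] s by (intro divide_right_mono) (auto simp: dist_real_def)
      also have "\<dots> = C * \<bar>s - x\<bar> powr (e - 1)" using s by (simp add: powr_diff)
      finally show "norm (norm (f s - f x - (s - x) *\<^sub>R f') / norm (s - x)) \<le> C * \<bar>s - x\<bar> powr (e - 1)"
        by simp
    qed
  qed
qed

lemma has_vector_derivative_within_open_part:
  fixes f :: "real \<Rightarrow> complex"
  assumes "(f has_vector_derivative d) (at x within T)" "open T" "x \<in> T"
    and "\<And>s. s \<in> T \<Longrightarrow> f s = g s"
  shows "(g has_vector_derivative d) (at x within S)"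
proof -
  have "(f has_vector_derivative d) (at x)" using assms at_within_open by metis
  then have "(g has_vector_derivative d) (at x)"
    by (rule has_vector_derivative_transform_within_open[OF _ assms(2,3)]) (rule assms(4))
  then show ?thesis by (rule has_vector_derivative_at_within)
qed

text \<open>The mean value inequality for f(s) - s d. A segment instead of an interval allows b < a,
  as needed for increments to either side.\<close>

lemma norm_linear_remainder_le:
  fixes f :: "real \<Rightarrow> complex"
  assumes "\<And>s. s \<in> closed_segment a b \<Longrightarrow> (f has_vector_derivative f' s) (at s within closed_segment a b)"
    and "\<And>s. s \<in> closed_segment a b \<Longrightarrow> norm (f' s - d) \<le> B"
  shows "norm (f b - f a - (b - a) *\<^sub>R d) \<le> \<bar>b - a\<bar> * B"
proof -
  have "norm ((f b - b *\<^sub>R d) - (f a - a *\<^sub>R d)) \<le> B * norm (b - a)"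
  proof (rule differentiable_bound[of "closed_segment a b" "\<lambda>s. f s - s *\<^sub>R d" "\<lambda>s h. h *\<^sub>R (f' s - d)" B b a])
    fix s assume s: "s \<in> closed_segment a b"
    have "((\<lambda>s. f s - s *\<^sub>R d) has_vector_derivative f' s - 1 *\<^sub>R d) (at s within closed_segment a b)"
      by (intro has_vector_derivative_diff assms(1)[OF s] has_vector_derivative_scaleR[where g="\<lambda>_. d" and g'=0, simplified] DERIV_ident)
    then show "((\<lambda>s. f s - s *\<^sub>R d) has_derivative (\<lambda>h. h *\<^sub>R (f' s - d))) (at s within closed_segment a b)"
      by (simp add: has_vector_derivative_def)
    show "onorm (\<lambda>h. h *\<^sub>R (f' s - d)) \<le> B"
      using assms(2)[OF s] by (auto simp: mult.commute[of B] intro!: onorm_le mult_left_mono)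
  qed auto
  then show ?thesis by (simp add: algebra_simps)
qed

lemma norm_difference_le:
  fixes f :: "real \<Rightarrow> complex"
  assumes "\<And>s. s \<in> closed_segment a b \<Longrightarrow> (f has_vector_derivative f' s) (at s within closed_segment a b)"
    and "\<And>s. s \<in> closed_segment a b \<Longrightarrow> norm (f' s) \<le> B"
  shows "norm (f b - f a) \<le> B * \<bar>b - a\<bar>"
  using norm_linear_remainder_le[of a b f f' 0 B] assms by (simp add: mult.commute)

text \<open>The points 1 / (n + 1) serve to name the limit at 0; a Lipschitz function maps this
  Cauchy sequence to a Cauchy sequence.\<close>

lemma lipschitz_extension_at_0:
  fixes f :: "real \<Rightarrow> complex"
  assumes "\<And>r s. 0 < r \<Longrightarrow> 0 < s \<Longrightarrow> norm (f s - f r) \<le> C * \<bar>s - r\<bar>"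
  shows "((\<lambda>n. f (inverse (real (Suc n)))) \<longlonglongrightarrow> lim (\<lambda>n. f (inverse (real (Suc n)))))"
proof -
  have "Cauchy (\<lambda>n. f (inverse (real (Suc n))))"
  proof (rule CauchyI)
    fix e :: real assume "0 < e"
    then have "0 < e / (\<bar>C\<bar> + 1)" by simp
    from CauchyD[OF LIMSEQ_imp_Cauchy[OF LIMSEQ_inverse_real_of_nat] this]
    obtain M where M: "\<And>m n. M \<le> m \<Longrightarrow> M \<le> n \<Longrightarrow>
        norm (inverse (real (Suc m)) - inverse (real (Suc n))) < e / (\<bar>C\<bar> + 1)" by blast
    show "\<exists>M. \<forall>m\<ge>M. \<forall>n\<ge>M. norm (f (inverse (real (Suc m))) - f (inverse (real (Suc n)))) < e"
    proof (intro exI[of _ M] allI impI)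
      fix m n assume mn: "M \<le> m" "M \<le> n"
      let ?d = "\<bar>inverse (real (Suc m)) - inverse (real (Suc n))\<bar>"
      have "norm (f (inverse (real (Suc m))) - f (inverse (real (Suc n)))) \<le> C * ?d"
        by (rule assms) auto
      also have "\<dots> \<le> (\<bar>C\<bar> + 1) * ?d" by (intro mult_right_mono) auto
      also have "\<dots> < e" using M[OF mn] by (simp add: field_simps)
      finally show "norm (f (inverse (real (Suc m))) - f (inverse (real (Suc n)))) < e" .
    qed
  qed
  then show ?thesis by (simp add: Cauchy_convergent_iff convergent_LIMSEQ_iff)
qed

lemma continuous_at_within_open_part:
  assumes "continuous_on (S \<inter> T) f" "open T" "z \<in> S" "z \<in> T"
  shows "continuous (at z within S) f"
proof -
  have "at z within (S \<inter> T) = at z within S"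
    by (rule at_within_nhd[OF \<open>z \<in> T\<close> \<open>open T\<close>]) auto
  then show ?thesis using assms unfolding continuous_on_eq_continuous_within continuous_within
    by (metis IntI)
qed

text \<open>Boundedness of all derivatives up to \<open>x = 0\<close> makes every derivative Lipschitz there, so all
  of them extend continuously; the Taylor estimates survive the limit \<open>x \<rightarrow> 0\<close>.\<close>

lemma smooth_extension_at_0:
  assumes P: "\<And>n. partials_upto n {0<..} {c<..<d} f V"
    and bounded: "\<And>i j a b. c < a \<Longrightarrow> b < d \<Longrightarrow> \<exists>C. \<forall>x>0. \<forall>y\<in>{a..b}. norm (V i j x y) \<le> C"
  obtains E where "\<And>n. partials_upto n {0..} {c<..<d} (E 0 0) E"
    "\<And>i j x y. 0 < x \<Longrightarrow> E i j x y = V i j x y"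
proof -
  let ?x = "\<lambda>n. inverse (real (Suc n))"
  define E where "E i j x y = (if x = 0 then lim (\<lambda>n. V i j (?x n) y) else V i j x y)" for i j x y
  have Vx: "((\<lambda>s. V i j s y) has_vector_derivative V (Suc i) j x y) (at x within {0<..})"
    if "0 < x" "y \<in> {c<..<d}" for i j x y
    by (rule partials_uptoD(3)[OF P[of "Suc (i + j)"]]) (use that in auto)
  have Vy: "((\<lambda>s. V i j x s) has_vector_derivative V i (Suc j) x y) (at y within {c<..<d})"
    if "0 < x" "y \<in> {c<..<d}" for i j x y
    by (rule partials_uptoD(4)[OF P[of "Suc (i + j)"]]) (use that in auto)
  have lip_x: "\<exists>C. \<forall>y\<in>{a..b}. \<forall>r>0. \<forall>s>0. norm (V i j s y - V i j r y) \<le> C * \<bar>s - r\<bar>"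
    if ab: "c < a" "b < d" for i j a b
  proof -
    obtain C where C: "\<And>x y. 0 < x \<Longrightarrow> y \<in> {a..b} \<Longrightarrow> norm (V (Suc i) j x y) \<le> C"
      using bounded[OF ab] by blast
    have "norm (V i j s y - V i j r y) \<le> C * \<bar>s - r\<bar>" if "y \<in> {a..b}" "0 < r" "0 < s" for y r s
    proof (rule norm_difference_le)
      fix x assume "x \<in> closed_segment r s"
      then have x: "0 < x" using that by (auto simp: closed_segment_eq_real_ivl split: if_splits)
      show "((\<lambda>s. V i j s y) has_vector_derivative V (Suc i) j x y) (at x within closed_segment r s)"
        by (rule has_vector_derivative_within_subset[OF Vx[OF x]])
          (use that ab in \<open>auto simp: closed_segment_eq_real_ivl split: if_splits\<close>)
      show "norm (V (Suc i) j x y) \<le> C" using C x that by blast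
    qed
    then show ?thesis by blast
  qed
  have xpos: "0 < ?x n" for n by simp
  have xlim: "?x \<longlonglongrightarrow> 0" by (rule LIMSEQ_inverse_real_of_nat)
  have lim_E: "(\<lambda>n. V i j (?x n) y) \<longlonglongrightarrow> E i j 0 y" if y: "y \<in> {c<..<d}" for i j y
  proof -
    have cd: "c < y" "y < d" using y by auto
    obtain C where "\<forall>y'\<in>{y..y}. \<forall>r>0. \<forall>s>0. norm (V i j s y' - V i j r y') \<le> C * \<bar>s - r\<bar>"
      using lip_x[OF cd, of i j] by blast
    then have C: "norm (V i j s y - V i j r y) \<le> C * \<bar>s - r\<bar>" if "0 < r" "0 < s" for r s
      using that by simp
    have "(\<lambda>n. V i j (?x n) y) \<longlonglongrightarrow> lim (\<lambda>n. V i j (?x n) y)"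
      by (rule lipschitz_extension_at_0[of "\<lambda>s. V i j s y"]) (rule C)
    then show ?thesis unfolding E_def by (simp only: refl if_True)
  qed
  have E_pos: "E i j x y = V i j x y" if "0 < x" for i j x y using that by (simp add: E_def)
  have E_lip_x: "\<exists>C. \<forall>y\<in>{a..b}. \<forall>r\<ge>0. \<forall>s>0. norm (E i j s y - E i j r y) \<le> C * \<bar>s - r\<bar>"
    if ab: "c < a" "b < d" for i j a b
  proof -
    obtain C where C: "\<And>r s y. y \<in> {a..b} \<Longrightarrow> 0 < r \<Longrightarrow> 0 < s \<Longrightarrow> norm (V i j s y - V i j r y) \<le> C * \<bar>s - r\<bar>"
      using lip_x[OF ab, of i j] by metis
    have "norm (E i j s y - E i j 0 y) \<le> C * \<bar>s - 0\<bar>" if "y \<in> {a..b}" "0 < s" for s y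
    proof (rule tendsto_le[OF sequentially_bot])
      have y: "y \<in> {c<..<d}" using that ab by auto
      show "(\<lambda>n. C * \<bar>s - ?x n\<bar>) \<longlonglongrightarrow> C * \<bar>s - 0\<bar>"
        by (intro tendsto_intros xlim)
      show "(\<lambda>n. norm (E i j s y - V i j (?x n) y)) \<longlonglongrightarrow> norm (E i j s y - E i j 0 y)"
        by (intro tendsto_intros lim_E y)
      show "\<forall>\<^sub>F n in sequentially. norm (E i j s y - V i j (?x n) y) \<le> C * \<bar>s - ?x n\<bar>"
        using C[OF that(1) xpos that(2)] that by (simp add: E_pos)
    qed
    then have "norm (E i j s y - E i j r y) \<le> C * \<bar>s - r\<bar>" if "y \<in> {a..b}" "0 \<le> r" "0 < s" for r s y
      using that C[of y r s] by (cases "r = 0") (auto simp: E_pos)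
    then show ?thesis by blast
  qed
  have Ex: "((\<lambda>s. E i j s y) has_vector_derivative E (Suc i) j x y) (at x within {0..})"
    if "0 \<le> x" and y: "y \<in> {c<..<d}" for i j x y
  proof (cases "x = 0")
    case False
    then have "((\<lambda>s. V i j s y) has_vector_derivative E (Suc i) j x y) (at x within {0<..})"
      using Vx[of x y i j] that by (simp add: E_pos)
    then show ?thesis
      by (rule has_vector_derivative_within_open_part) (use False that E_pos in auto)
  next
    case True
    have cd: "c < y" "y < d" using y by auto
    obtain C where "\<forall>y'\<in>{y..y}. \<forall>r\<ge>0. \<forall>s>0. norm (E (Suc i) j s y' - E (Suc i) j r y') \<le> C * \<bar>s - r\<bar>"
      using E_lip_x[OF cd, of "Suc i" j] by metis
    then have "\<forall>r\<ge>0. \<forall>s>0. norm (E (Suc i) j s y - E (Suc i) j r y) \<le> C * \<bar>s - r\<bar>" by simp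
    then have C: "norm (E (Suc i) j s y - E (Suc i) j 0 y) \<le> C * \<bar>s - 0\<bar>" if "0 < s" for s
      using that by blast
    have C0: "0 \<le> C" using order_trans[OF norm_ge_zero C[of 1]] by simp
    \<comment> \<open>The linear remainder is estimated on [r, s] with r > 0, where V is
      differentiable, and then r tends to 0 along the points \<open>?x n\<close>.\<close>
    have quad: "norm (E i j s y - E i j 0 y - (s - 0) *\<^sub>R E (Suc i) j 0 y) \<le> \<bar>s - 0\<bar> * (C * s)" if s: "0 < s" for s
    proof (rule tendsto_le[OF sequentially_bot])
      show "(\<lambda>n. \<bar>s - ?x n\<bar> * (C * s)) \<longlonglongrightarrow> \<bar>s - 0\<bar> * (C * s)"
        by (intro tendsto_intros xlim)
      show "(\<lambda>n. norm (E i j s y - V i j (?x n) y - (s - ?x n) *\<^sub>R E (Suc i) j 0 y)) \<longlonglongrightarrow>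
         norm (E i j s y - E i j 0 y - (s - 0) *\<^sub>R E (Suc i) j 0 y)"
        by (intro tendsto_intros lim_E y xlim)
      have "norm (E i j s y - V i j r y - (s - r) *\<^sub>R E (Suc i) j 0 y) \<le> \<bar>s - r\<bar> * (C * s)"
        if r: "0 < r" "r < s" for r
        unfolding E_pos[OF s]
      proof (rule norm_linear_remainder_le[where f="\<lambda>s. V i j s y"])
        fix t assume "t \<in> closed_segment r s"
        then have t: "0 < t" "t \<le> s" using r s by (auto simp: closed_segment_eq_real_ivl split: if_splits)
        show "((\<lambda>s. V i j s y) has_vector_derivative V (Suc i) j t y) (at t within closed_segment r s)"
          by (rule has_vector_derivative_within_subset[OF Vx[OF t(1) y]])
            (use r in \<open>auto simp: closed_segment_eq_real_ivl split: if_splits\<close>)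
        show "norm (V (Suc i) j t y - E (Suc i) j 0 y) \<le> C * s"
          using C[OF t(1)] t C0 mult_left_mono[of t s C] by (simp add: E_pos)
      qed
      moreover have "\<forall>\<^sub>F n in sequentially. ?x n < s"
        using xlim s by (rule order_tendstoD(2))
      ultimately show "\<forall>\<^sub>F n in sequentially. norm (E i j s y - V i j (?x n) y - (s - ?x n) *\<^sub>R E (Suc i) j 0 y)
          \<le> \<bar>s - ?x n\<bar> * (C * s)"
        using xpos by (auto elim: eventually_mono)
    qed
    show ?thesis unfolding True
    proof (rule has_vector_derivative_of_le_powr[of 2 1 _ _ _ _ C])
      fix s :: real assume "s \<in> {0..}"
      then show "norm (E i j s y - E i j 0 y - (s - 0) *\<^sub>R E (Suc i) j 0 y) \<le> C * \<bar>s - 0\<bar> powr 2"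
        using quad[of s] by (cases "s = 0") (auto simp: power2_eq_square mult_ac)
    qed auto
  qed
  have E_bounded: "\<exists>C. \<forall>x\<ge>0. \<forall>y\<in>{a..b}. norm (E i j x y) \<le> C" if ab: "c < a" "b < d" for i j a b
  proof -
    obtain C where C: "\<And>x y. 0 < x \<Longrightarrow> y \<in> {a..b} \<Longrightarrow> norm (V i j x y) \<le> C"
      using bounded[OF ab] by blast
    have "norm (E i j 0 y) \<le> C" if "y \<in> {a..b}" for y
      by (rule tendsto_le[OF sequentially_bot tendsto_const tendsto_norm[OF lim_E]])
        (use that ab C xpos in auto)
    then have "norm (E i j x y) \<le> C" if "0 \<le> x" "y \<in> {a..b}" for x y
      using that C by (cases "x = 0") (auto simp: E_pos)
    then show ?thesis by blast
  qed
  have Ey: "((\<lambda>s. E i j x s) has_vector_derivative E i (Suc j) x y) (at y within {c<..<d})"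
    if "0 \<le> x" and y: "y \<in> {c<..<d}" for i j x y
  proof (cases "x = 0")
    case False
    then show ?thesis using that Vy[of x y i j] by (simp add: E_pos)
  next
    case True
    \<comment> \<open>Bounds are available on compact subintervals of (c, d); the midpoints supply
      one around y.\<close>
    define a b where "a = (c + y) / 2" and "b = (y + d) / 2"
    have ab: "c < a" "a < y" "y < b" "b < d" using y by (auto simp: a_def b_def)
    obtain C where C: "\<And>x s. 0 < x \<Longrightarrow> s \<in> {a..b} \<Longrightarrow> norm (V i (Suc (Suc j)) x s) \<le> C"
      using bounded[OF ab(1,4)] by blast
    have C0: "0 \<le> C" using order_trans[OF norm_ge_zero C[of 1 y]] ab by simp
    have lip: "norm (V i (Suc j) x t - V i (Suc j) x y) \<le> C * \<bar>t - y\<bar>" if "0 < x" "t \<in> {a..b}" for x t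
    proof (rule norm_difference_le)
      fix s assume s: "s \<in> closed_segment y t"
      then have s': "s \<in> {a..b}" using that ab by (auto simp: closed_segment_eq_real_ivl split: if_splits)
      show "norm (V i (Suc (Suc j)) x s) \<le> C" by (rule C[OF \<open>0 < x\<close> s'])
      show "((\<lambda>s. V i (Suc j) x s) has_vector_derivative V i (Suc (Suc j)) x s) (at s within closed_segment y t)"
        by (rule has_vector_derivative_within_subset[OF Vy])
          (use that s' ab in \<open>auto simp: closed_segment_eq_real_ivl split: if_splits\<close>)
    qed
    have quad: "norm (E i j 0 s - E i j 0 y - (s - y) *\<^sub>R E i (Suc j) 0 y) \<le> \<bar>s - y\<bar> * (C * \<bar>s - y\<bar>)"
      if s: "s \<in> {a..b}" for s
    proof (rule tendsto_le[OF sequentially_bot tendsto_const])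
      show "(\<lambda>n. norm (V i j (?x n) s - V i j (?x n) y - (s - y) *\<^sub>R V i (Suc j) (?x n) y)) \<longlonglongrightarrow>
         norm (E i j 0 s - E i j 0 y - (s - y) *\<^sub>R E i (Suc j) 0 y)"
        by (intro tendsto_intros lim_E) (use s ab in auto)
      have "norm (V i j x s - V i j x y - (s - y) *\<^sub>R V i (Suc j) x y) \<le> \<bar>s - y\<bar> * (C * \<bar>s - y\<bar>)" if x: "0 < x" for x
      proof (rule norm_linear_remainder_le)
        fix t assume t: "t \<in> closed_segment y s"
        then have t': "t \<in> {a..b}" "\<bar>t - y\<bar> \<le> \<bar>s - y\<bar>"
          using s ab by (auto simp: closed_segment_eq_real_ivl split: if_splits)
        show "((\<lambda>s. V i j x s) has_vector_derivative V i (Suc j) x t) (at t within closed_segment y s)"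
          by (rule has_vector_derivative_within_subset[OF Vy])
            (use x s t' ab in \<open>auto simp: closed_segment_eq_real_ivl split: if_splits\<close>)
        show "norm (V i (Suc j) x t - V i (Suc j) x y) \<le> C * \<bar>s - y\<bar>"
          using lip[OF x t'(1)] mult_left_mono[OF t'(2) C0] by linarith
      qed
      then show "\<forall>\<^sub>F n in sequentially. norm (V i j (?x n) s - V i j (?x n) y - (s - y) *\<^sub>R V i (Suc j) (?x n) y)
          \<le> \<bar>s - y\<bar> * (C * \<bar>s - y\<bar>)"
        using xpos by simp
    qed
    show ?thesis unfolding True
    proof (rule has_vector_derivative_of_le_powr[of 2 "min (y - a) (b - y)" _ _ _ _ C])
      fix s :: real assume "\<bar>s - y\<bar> < min (y - a) (b - y)"
      then have "s \<in> {a..b}" by auto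
      then show "norm (E i j 0 s - E i j 0 y - (s - y) *\<^sub>R E i (Suc j) 0 y) \<le> C * \<bar>s - y\<bar> powr 2"
        using quad[of s] by (cases "s = y") (auto simp: power2_eq_square mult_ac)
    qed (use ab in auto)
  qed
  have E_cont: "continuous_on ({0..} \<times> {c<..<d}) (\<lambda>(x, y). E i j x y)" for i j
    unfolding continuous_on_eq_continuous_within
  proof
    fix z :: "real \<times> real" assume "z \<in> {0..} \<times> {c<..<d}"
    then obtain x0 y0 where z: "z = (x0, y0)" "0 \<le> x0" "y0 \<in> {c<..<d}" by auto
    define a b where "a = (c + y0) / 2" and "b = (y0 + d) / 2"
    have ab: "c < a" "a < y0" "y0 < b" "b < d" using z by (auto simp: a_def b_def)
    obtain B where B: "\<And>x y. 0 \<le> x \<Longrightarrow> y \<in> {a..b} \<Longrightarrow> norm (E i (Suc j) x y) \<le> B"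
      using E_bounded[OF ab(1,4)] by blast
    have in_y: "norm (E i j x y - E i j x y0) \<le> B * \<bar>y - y0\<bar>" if "0 \<le> x" "y \<in> {a..b}" for x y
    proof (rule norm_difference_le)
      fix s assume s: "s \<in> closed_segment y0 y"
      then have s': "s \<in> {a..b}" using that ab by (auto simp: closed_segment_eq_real_ivl split: if_splits)
      show "norm (E i (Suc j) x s) \<le> B" by (rule B[OF \<open>0 \<le> x\<close> s'])
      show "((\<lambda>s. E i j x s) has_vector_derivative E i (Suc j) x s) (at s within closed_segment y0 y)"
        by (rule has_vector_derivative_within_subset[OF Ey])
          (use that s' ab in \<open>auto simp: closed_segment_eq_real_ivl split: if_splits\<close>)
    qed
    let ?S = "{0..} \<times> {a<..<b}"
    \<comment> \<open>Joint continuity: the difference is small uniformly in x by the bound on the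
      y-derivative, and the other summand depends on x alone.\<close>
    have "((\<lambda>w. (E i j (fst w) (snd w) - E i j (fst w) y0) + E i j (fst w) y0) \<longlongrightarrow> 0 + E i j x0 y0) (at z within ?S)"
    proof (intro tendsto_add)
      have lim: "((\<lambda>w. B * \<bar>snd w - y0\<bar>) \<longlongrightarrow> 0) (at z within ?S)"
        by (auto intro!: tendsto_eq_intros simp: z)
      show "((\<lambda>w. E i j (fst w) (snd w) - E i j (fst w) y0) \<longlongrightarrow> 0) (at z within ?S)"
        by (rule Lim_null_comparison[OF _ lim]) (auto simp: eventually_at intro!: exI[of _ 1] in_y)
      have "continuous_on {0..} (\<lambda>x. E i j x y0)"
        unfolding continuous_on_eq_continuous_within
        using has_vector_derivative_continuous[OF Ex[OF _ z(3)]] by simp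
      then have "continuous_on ?S (\<lambda>w. E i j (fst w) y0)"
        by (rule continuous_on_compose2[OF _ continuous_on_fst[OF continuous_on_id]]) auto
      then show "((\<lambda>w. E i j (fst w) y0) \<longlongrightarrow> E i j x0 y0) (at z within ?S)"
        using z ab by (auto simp: continuous_on)
    qed
    moreover have "at z within ?S = at z within {0..} \<times> {c<..<d}"
      by (rule at_within_nhd[of z "UNIV \<times> {a<..<b}"]) (use z ab in \<open>auto intro!: open_Times\<close>)
    ultimately show "continuous (at z within {0..} \<times> {c<..<d}) (\<lambda>(x, y). E i j x y)"
      by (simp add: continuous_within case_prod_unfold z)
  qed
  show thesis
  proof (rule that[of E])
    show "partials_upto n {0..} {c<..<d} (E 0 0) E" for n
      by (rule partials_uptoI) (use E_cont Ex Ey in auto)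
  qed (rule E_pos)
qed

text \<open>Decay at a rate strictly better than m, uniform in x > 0, with the rate left open. Thus
  y^\<alpha> ln^k y has order above m as soon as Re \<alpha> > m, whatever k is; a negative m
  expresses polynomial growth.\<close>

definition order_above :: "real \<Rightarrow> (real \<Rightarrow> real \<Rightarrow> complex) \<Rightarrow> bool" where
  "order_above m f \<longleftrightarrow> (\<exists>e>m. \<exists>C. \<forall>x>0. \<forall>y\<in>{0<..<1}. norm (f x y) \<le> C * y powr e)"

lemma order_aboveI:
  assumes "m < e" "\<And>x y. 0 < x \<Longrightarrow> 0 < y \<Longrightarrow> y < 1 \<Longrightarrow> norm (f x y) \<le> C * y powr e"
  shows "order_above m f"
  using assms unfolding order_above_def by (intro exI[of _ e] conjI exI[of _ C]) auto

lemma order_aboveD: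
  assumes "order_above m f"
  obtains e C where "m < e" "0 \<le> C" "\<And>x y. 0 < x \<Longrightarrow> 0 < y \<Longrightarrow> y < 1 \<Longrightarrow> norm (f x y) \<le> C * y powr e"
proof -
  obtain e C where e: "m < e" and C: "\<forall>x>0. \<forall>y\<in>{0<..<1}. norm (f x y) \<le> C * y powr e"
    using assms unfolding order_above_def by blast
  show thesis
  proof (rule that[OF e, of "\<bar>C\<bar>"])
    fix x y :: real assume xy: "0 < x" "0 < y" "y < 1"
    then have "norm (f x y) \<le> C * y powr e" using C by simp
    also have "\<dots> \<le> \<bar>C\<bar> * y powr e" by (intro mult_right_mono) auto
    finally show "norm (f x y) \<le> \<bar>C\<bar> * y powr e" .
  qed simp
qed

lemma order_aboveD':
  assumes "order_above m f"
  obtains C where "0 \<le> C" "\<And>x y. 0 < x \<Longrightarrow> 0 < y \<Longrightarrow> y < 1 \<Longrightarrow> norm (f x y) \<le> C * y powr m"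
proof -
  obtain e C where e: "m < e" "0 \<le> C" and C: "\<And>x y. 0 < x \<Longrightarrow> 0 < y \<Longrightarrow> y < 1 \<Longrightarrow> norm (f x y) \<le> C * y powr e"
    using assms by (rule order_aboveD) blast
  show thesis
  proof (rule that[OF e(2)])
    fix x y :: real assume xy: "0 < x" "0 < y" "y < 1"
    then have "norm (f x y) \<le> C * y powr e" by (rule C)
    also have "\<dots> \<le> C * y powr m" using xy e powr_mono'[of m e y] by (intro mult_left_mono) auto
    finally show "norm (f x y) \<le> C * y powr m" .
  qed
qed

lemma order_above_mono: "order_above m f \<Longrightarrow> m' \<le> m \<Longrightarrow> order_above m' f"
  unfolding order_above_def by (meson order.strict_trans1)

lemma order_above_cong:
  "order_above m f \<Longrightarrow> (\<And>x y. 0 < x \<Longrightarrow> 0 < y \<Longrightarrow> y < 1 \<Longrightarrow> f x y = g x y) \<Longrightarrow> order_above m g"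
  unfolding order_above_def by simp

lemma order_above_add:
  assumes "order_above m f" "order_above m g"
  shows "order_above m (\<lambda>x y. f x y + g x y)"
proof -
  obtain e C where e: "m < e" "0 \<le> C" and C: "\<And>x y. 0 < x \<Longrightarrow> 0 < y \<Longrightarrow> y < 1 \<Longrightarrow> norm (f x y) \<le> C * y powr e"
    using assms(1) by (rule order_aboveD) blast
  obtain e' C' where e': "m < e'" "0 \<le> C'" and C': "\<And>x y. 0 < x \<Longrightarrow> 0 < y \<Longrightarrow> y < 1 \<Longrightarrow> norm (g x y) \<le> C' * y powr e'"
    using assms(2) by (rule order_aboveD) blast
  show ?thesis
  proof (rule order_aboveI)
    show "m < min e e'" using e e' by simp
    fix x y :: real assume xy: "0 < x" "0 < y" "y < 1"
    have "norm (f x y) \<le> C * y powr min e e'"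
      using C[OF xy] xy e mult_left_mono[OF powr_mono'[of "min e e'" e y] e(2)] by simp
    moreover have "norm (g x y) \<le> C' * y powr min e e'"
      using C'[OF xy] xy e' mult_left_mono[OF powr_mono'[of "min e e'" e' y] e'(2)] by simp
    ultimately show "norm (f x y + g x y) \<le> (C + C') * y powr min e e'"
      using norm_triangle_ineq[of "f x y" "g x y"] by (simp add: distrib_right)
  qed
qed

lemma order_above_uminus: "order_above m f \<Longrightarrow> order_above m (\<lambda>x y. - f x y)"
  unfolding order_above_def by simp

lemma order_above_diff:
  "order_above m f \<Longrightarrow> order_above m g \<Longrightarrow> order_above m (\<lambda>x y. f x y - g x y)"
  using order_above_add[OF _ order_above_uminus] by simp

lemma order_above_sum:
  assumes "finite I" "\<And>z. z \<in> I \<Longrightarrow> order_above m (f z)"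
  shows "order_above m (\<lambda>x y. \<Sum>z\<in>I. f z x y)"
  using assms
proof (induction I rule: finite_induct)
  case empty
  then show ?case by (auto intro!: order_aboveI[of m "m + 1" _ 0])
next
  case (insert z I)
  then have "order_above m (\<lambda>x y. f z x y + (\<Sum>z\<in>I. f z x y))" by (intro order_above_add) auto
  then show ?case using insert by simp
qed

lemma order_above_divide_power:
  assumes "order_above m f"
  shows "order_above (m - real n) (\<lambda>x y. of_real (c / y ^ n) * f x y)"
proof -
  obtain e C where e: "m < e" "0 \<le> C" and C: "\<And>x y. 0 < x \<Longrightarrow> 0 < y \<Longrightarrow> y < 1 \<Longrightarrow> norm (f x y) \<le> C * y powr e"
    using assms by (rule order_aboveD) blast
  show ?thesis
  proof (rule order_aboveI)
    show "m - real n < e - real n" using e by simp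
    fix x y :: real assume xy: "0 < x" "0 < y" "y < 1"
    have "norm (of_real (c / y ^ n) * f x y) \<le> \<bar>c\<bar> / y ^ n * (C * y powr e)"
      unfolding norm_mult using C[OF xy] xy by (intro mult_mono) (auto simp: norm_divide norm_power)
    also have "\<dots> = (\<bar>c\<bar> * C) * y powr (e - real n)" using xy by (simp add: powr_diff powr_realpow)
    finally show "norm (of_real (c / y ^ n) * f x y) \<le> (\<bar>c\<bar> * C) * y powr (e - real n)" .
  qed
qed

lemma order_above_powr_ln:
  assumes "m < Re \<alpha> - real j" "\<And>x. 0 < x \<Longrightarrow> norm (g x) \<le> B"
  shows "order_above m (\<lambda>x y. powr_ln \<alpha> k j y * g x)"
proof -
  obtain e where e: "m < e" "e < Re \<alpha> - real j" using dense[OF assms(1)] by blast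
  obtain C where C: "\<And>y. y \<in> {0<..1} \<Longrightarrow> norm (powr_ln \<alpha> k j y) \<le> C * y powr e"
    using powr_ln_bound[OF e(2), of k] by blast
  show ?thesis
  proof (rule order_aboveI[OF e(1)])
    fix x y :: real assume xy: "0 < x" "0 < y" "y < 1"
    have "norm (powr_ln \<alpha> k j y * g x) \<le> (C * y powr e) * B"
      unfolding norm_mult using C[of y] assms(2)[OF xy(1)] xy
      by (intro mult_mono) (auto intro: order_trans[OF norm_ge_zero])
    then show "norm (powr_ln \<alpha> k j y * g x) \<le> (C * B) * y powr e" by (simp add: mult_ac)
  qed
qed

text \<open>A Landau-type interpolation: compare \<open>f\<^sub>1\<close> with the difference quotient of \<open>f\<close> over
  \<open>[y - h, y]\<close>, where \<open>h\<close> is a high power of \<open>y\<close>.\<close>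

lemma order_above_interpolate:
  assumes d: "\<And>x y. 0 < x \<Longrightarrow> y \<in> {0<..<1} \<Longrightarrow> (f x has_vector_derivative f1 x y) (at y within {0<..<1})"
    "\<And>x y. 0 < x \<Longrightarrow> y \<in> {0<..<1} \<Longrightarrow> (f1 x has_vector_derivative f2 x y) (at y within {0<..<1})"
    and f2: "order_above (- M) f2" and M: "0 \<le> M" and P: "0 \<le> P" and f: "order_above (2 * P + M + 3) f"
  shows "order_above P f1"
proof -
  define Q where "Q = P + 1"
  \<comment> \<open>With h = y^L / 2 both errors of the difference quotient are small enough: h
    times the bound for f2 is O(y^(L - M)) = O(y^(Q + 1)), and f / h is O(y^Q). Moreover L \<ge> 1
    keeps h \<le> y / 2, so that all points of [y - h, y] are comparable to y.\<close>
  define L where "L = Q + M + 1"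
  have QL: "2 * P + M + 3 = Q + L" "0 \<le> Q" "1 \<le> L" using M P by (auto simp: Q_def L_def)
  obtain C0 where C0: "0 \<le> C0" "\<And>x y. 0 < x \<Longrightarrow> 0 < y \<Longrightarrow> y < 1 \<Longrightarrow> norm (f x y) \<le> C0 * y powr (Q + L)"
    using f unfolding QL(1) by (rule order_aboveD') blast
  obtain C2 where C2: "0 \<le> C2" "\<And>x y. 0 < x \<Longrightarrow> 0 < y \<Longrightarrow> y < 1 \<Longrightarrow> norm (f2 x y) \<le> C2 * y powr (- M)"
    using f2 by (rule order_aboveD') blast
  show ?thesis
  proof (rule order_aboveI)
    show "P < Q" by (simp add: Q_def)
    fix x y :: real assume xy: "0 < x" "0 < y" "y < 1"
    define h where "h = y powr L / 2"
    have "y powr L \<le> y powr 1" using QL(3) xy by (intro powr_mono') auto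
    then have h: "0 < h" "h \<le> y / 2" using xy by (auto simp: h_def)
    have sub: "closed_segment y (y - h) = {y - h..y}" using h by (simp add: closed_segment_eq_real_ivl)
    have sub1: "{y - h..y} \<subseteq> {0<..<1}" using h xy by auto
    define B where "B = C2 * 2 powr M * y powr (- M)"
    have f2_le: "norm (f2 x s) \<le> B" if "s \<in> {y - h..y}" for s
    proof -
      have s: "0 < s" "s < 1" "y / 2 \<le> s" using that h xy by auto
      have "norm (f2 x s) \<le> C2 * s powr (- M)" by (rule C2(2)[OF xy(1) s(1,2)])
      also have "s powr (- M) \<le> (y / 2) powr (- M)" using s xy M by (intro powr_mono2') auto
      also have "(y / 2) powr (- M) = 2 powr M * y powr (- M)"
        using xy by (simp add: powr_divide powr_minus field_simps)
      finally show ?thesis using C2(1) by (simp add: B_def mult_left_mono mult.assoc)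
    qed
    have "norm (f x (y - h) - f x y - (y - h - y) *\<^sub>R f1 x y) \<le> \<bar>y - h - y\<bar> * (B * h)"
    proof (rule norm_linear_remainder_le; unfold sub)
      fix s assume s: "s \<in> {y - h..y}"
      show "(f x has_vector_derivative f1 x s) (at s within {y - h..y})"
        by (rule has_vector_derivative_within_subset[OF d(1)]) (use s xy sub1 in auto)
      have "norm (f1 x y - f1 x s) \<le> B * (y - s)"
      proof (rule norm_diff_le_of_derivative_bound)
        show "s \<le> y" using s by simp
        fix r assume r: "r \<in> {s..y}"
        then have r': "r \<in> {y - h..y}" using s by auto
        show "(f1 x has_vector_derivative f2 x r) (at r within {s..y})"
          by (rule has_vector_derivative_within_subset[OF d(2)]) (use r' s xy sub1 in auto)
        show "norm (f2 x r) \<le> B" by (rule f2_le[OF r'])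
      qed
      also have "\<dots> \<le> B * h"
        using s C2(1) by (intro mult_left_mono) (auto simp: B_def)
      finally show "norm (f1 x s - f1 x y) \<le> B * h" by (simp add: norm_minus_commute)
    qed
    then have "norm (f x (y - h) - f x y + h *\<^sub>R f1 x y) \<le> h * (B * h)" using h by simp
    moreover have "h *\<^sub>R f1 x y = (f x (y - h) - f x y + h *\<^sub>R f1 x y) - f x (y - h) + f x y" by simp
    ultimately have "norm (h *\<^sub>R f1 x y) \<le> h * (B * h) + norm (f x (y - h)) + norm (f x y)"
      by (smt (verit) norm_triangle_ineq norm_triangle_ineq4)
    moreover have "norm (f x (y - h)) \<le> C0 * y powr (Q + L)"
    proof -
      have "norm (f x (y - h)) \<le> C0 * (y - h) powr (Q + L)" using C0(2)[of x "y - h"] h xy by simp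
      also have "\<dots> \<le> C0 * y powr (Q + L)"
        using C0(1) h xy QL by (intro mult_left_mono powr_mono2) auto
      finally show ?thesis .
    qed
    moreover have "norm (f x y) \<le> C0 * y powr (Q + L)" by (rule C0(2)[OF xy])
    ultimately have "h * norm (f1 x y) \<le> h * (B * h) + 2 * (C0 * y powr (Q + L))" using h by simp
    also have "2 * (C0 * y powr (Q + L)) = h * (4 * C0 * y powr Q)" by (simp add: h_def powr_add)
    finally have "h * norm (f1 x y) \<le> h * (B * h + 4 * C0 * y powr Q)" by (simp add: distrib_left)
    then have "norm (f1 x y) \<le> B * h + 4 * C0 * y powr Q" using h(1) by simp
    also have "B * h = C2 * 2 powr M / 2 * y powr (Q + 1)"
      by (simp add: B_def h_def L_def mult_ac flip: powr_add)
    also have "\<dots> \<le> C2 * 2 powr M / 2 * y powr Q"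
      using xy C2(1) by (intro mult_left_mono powr_mono') auto
    finally show "norm (f1 x y) \<le> (C2 * 2 powr M / 2 + 4 * C0) * y powr Q"
      by (simp add: distrib_right)
  qed
qed

text \<open>Order above 0 makes the extended derivatives continuous at y = 0, and order above 1
  makes their y-derivative 0 there; the latter is asked of those that are still to be
  differentiated.\<close>

lemma partials_upto_extend_by_zero:
  assumes P: "partials_upto n {0..} {0<..<1} f D"
    and o0: "\<And>i j. i + j \<le> n \<Longrightarrow> order_above 0 (D i j)"
    and o1: "\<And>i j. i + j < n \<Longrightarrow> order_above 1 (D i j)"
  shows "partials_upto n {0..} {0..<1} (\<lambda>x y. if y = 0 then 0 else f x y) (\<lambda>i j x y. if y = 0 then 0 else D i j x y)"
proof -
  have bound: "\<exists>e>m. \<exists>C. \<forall>x\<ge>0. \<forall>y\<in>{0..<1}. norm (if y = 0 then 0 else D i j x y) \<le> C * y powr e"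
    if ij: "i + j \<le> n" and m: "order_above m (D i j)" for m i j
  proof -
    obtain e C where e: "m < e" "0 \<le> C" and C: "\<And>x y. 0 < x \<Longrightarrow> 0 < y \<Longrightarrow> y < 1 \<Longrightarrow> norm (D i j x y) \<le> C * y powr e"
      using m by (rule order_aboveD) blast
    \<comment> \<open>\<open>order_above\<close> speaks of x > 0; continuity of D carries the bound
      to x = 0.\<close>
    have "norm (D i j 0 y) \<le> C * y powr e" if y: "0 < y" "y < 1" for y
    proof (rule tendsto_le[of "at_right 0"])
      show "((\<lambda>x. norm (D i j x y)) \<longlongrightarrow> norm (D i j 0 y)) (at_right 0)"
        using partials_upto_continuous_x[OF P ij, of y] y
        by (intro tendsto_norm) (auto simp: continuous_on intro: tendsto_within_subset)
      show "\<forall>\<^sub>F x in at_right 0. norm (D i j x y) \<le> C * y powr e"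
        by (auto simp: eventually_at_right_field C y intro!: exI[of _ 1])
    qed auto
    then have "norm (D i j x y) \<le> C * y powr e" if "0 \<le> x" "0 < y" "y < 1" for x y
      using C that by (cases "x = 0") auto
    then show ?thesis using e by (intro exI[of _ e] conjI exI[of _ C]) auto
  qed
  show ?thesis
  proof (rule partials_uptoI)
    fix x y :: real assume "x \<in> {0..}" "y \<in> {0..<1}"
    then show "(if y = 0 then 0 else D 0 0 x y) = (if y = 0 then 0 else f x y)"
      using partials_uptoD(1)[OF P, of x y] by auto
  next
    fix i j assume ij: "i + j \<le> n"
    obtain e C where e: "0 < e" and C: "\<And>x y. 0 \<le> x \<Longrightarrow> y \<in> {0..<1} \<Longrightarrow> norm (if y = 0 then 0 else D i j x y) \<le> C * y powr e"
      using bound[OF ij o0[OF ij]] by blast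
    show "continuous_on ({0..} \<times> {0..<1}) (\<lambda>(x, y). if y = 0 then 0 else D i j x y)"
      unfolding continuous_on_eq_continuous_within
    proof
      fix z :: "real \<times> real" assume z: "z \<in> {0..} \<times> {0..<1}"
      show "continuous (at z within {0..} \<times> {0..<1}) (\<lambda>(x, y). if y = 0 then 0 else D i j x y)"
      proof (cases "snd z = 0")
        case True
        have "((\<lambda>w. C * snd w powr e) \<longlongrightarrow> C * 0) (at z within {0..} \<times> {0..<1})"
          by (intro tendsto_mult tendsto_const tendsto_zero_powrI[where b = e])
            (use e True in \<open>auto intro!: tendsto_eq_intros simp: eventually_at intro!: exI[of _ 1]\<close>)
        then have lim: "((\<lambda>w. C * snd w powr e) \<longlongrightarrow> 0) (at z within {0..} \<times> {0..<1})" by simp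
        have "((\<lambda>(x, y). if y = 0 then 0 else D i j x y) \<longlongrightarrow> 0) (at z within {0..} \<times> {0..<1})"
          by (rule Lim_null_comparison[OF _ lim]) (use C in \<open>auto simp: eventually_at intro!: exI[of _ 1]\<close>)
        then show ?thesis using True by (simp add: continuous_within case_prod_unfold)
      next
        case False
        have "continuous_on (({0..} \<times> {0..<1}) \<inter> (UNIV \<times> {0<..})) (\<lambda>(x, y). D i j x y)"
          by (rule continuous_on_subset[OF partials_uptoD(2)[OF P ij]]) auto
        then have "continuous_on (({0..} \<times> {0..<1}) \<inter> (UNIV \<times> {0<..})) (\<lambda>(x, y). if y = 0 then 0 else D i j x y)"
          by (rule continuous_on_eq) auto
        then show ?thesis
          by (rule continuous_at_within_open_part) (use z False in \<open>auto intro!: open_Times\<close>)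
      qed
    qed
  next
    fix i j and x y :: real assume ij: "i + j < n" and x: "x \<in> {0..}" and y: "y \<in> {0..<1}"
    show "((\<lambda>s. if y = 0 then 0 else D i j s y) has_vector_derivative (if y = 0 then 0 else D (Suc i) j x y)) (at x within {0..})"
      using partials_uptoD(3)[OF P ij x, of y] y by auto
    show "((\<lambda>s. if s = 0 then 0 else D i j x s) has_vector_derivative (if y = 0 then 0 else D i (Suc j) x y)) (at y within {0..<1})"
    proof (cases "y = 0")
      case True
      obtain e C where e: "1 < e" and C: "\<And>x y. 0 \<le> x \<Longrightarrow> y \<in> {0..<1} \<Longrightarrow> norm (if y = 0 then 0 else D i j x y) \<le> C * y powr e"
        using bound[OF less_imp_le[OF ij] o1[OF ij]] by blast
      show ?thesis unfolding True
        by (rule has_vector_derivative_of_le_powr[OF e zero_less_one]) (use C x in force)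
    next
      case False
      have "((\<lambda>s. D i j x s) has_vector_derivative D i (Suc j) x y) (at y within {0<..<1})"
        by (rule partials_uptoD(4)[OF P ij x]) (use y False in auto)
      then have "((\<lambda>s. if s = 0 then 0 else D i j x s) has_vector_derivative D i (Suc j) x y) (at y within {0..<1})"
        by (rule has_vector_derivative_within_open_part) (use y False in auto)
      then show ?thesis using False by simp
    qed
  qed
qed

subsection \<open>Complete asymptotics imply polyhomogeneity\<close>

lemma order_above_sum_exists:
  assumes "finite I" "\<And>z. z \<in> I \<Longrightarrow> \<exists>m. order_above m (f z)"
  shows "\<exists>m. order_above m (\<lambda>x y. \<Sum>z\<in>I. f z x y)"
  using assms
proof (induction I rule: finite_induct)
  case empty
  then show ?case by (auto intro!: exI[of _ 0] order_aboveI[of 0 1 _ 0])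
next
  case (insert z I)
  then obtain m m' where m: "order_above m (f z)" "order_above m' (\<lambda>x y. \<Sum>z\<in>I. f z x y)" by blast
  have "order_above (min m m') (\<lambda>x y. f z x y + (\<Sum>z\<in>I. f z x y))"
    by (intro order_above_add order_above_mono[OF m(1)] order_above_mono[OF m(2)]) auto
  then show ?case using insert by auto
qed

lemma order_above_bounded:
  assumes "order_above m f" "0 < a" "b < 1"
  shows "\<exists>C. \<forall>x>0. \<forall>y\<in>{a..b}. norm (f x y) \<le> C"
proof -
  obtain C where C: "0 \<le> C" "\<And>x y. 0 < x \<Longrightarrow> 0 < y \<Longrightarrow> y < 1 \<Longrightarrow> norm (f x y) \<le> C * y powr m"
    using assms(1) by (rule order_aboveD') blast
  have "norm (f x y) \<le> C * a powr (- \<bar>m\<bar>)" if "0 < x" "y \<in> {a..b}" for x y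
  proof -
    have y: "0 < y" "y < 1" "a \<le> y" using that assms by auto
    have "y powr m \<le> y powr (- \<bar>m\<bar>)" using y by (intro powr_mono') auto
    also have "\<dots> \<le> a powr (- \<bar>m\<bar>)" using y assms(2) by (intro powr_mono2') auto
    finally show ?thesis using C(2)[OF that(1) y(1,2)] mult_left_mono[OF _ C(1)] order_trans by blast
  qed
  then show ?thesis by blast
qed

lemma C0_infinity_Rplus_derivs:
  assumes "f \<in> C0_infinity_Rplus"
  obtains G where "derivs_on UNIV G" "\<And>x. 0 \<le> x \<Longrightarrow> f x = G 0 x" "\<And>i. \<exists>B. \<forall>x>0. norm (G i x) \<le> B"
proof -
  obtain g where g: "smooth_real g" "compact (closure {x. g x \<noteq> 0})" "\<And>x. 0 \<le> x \<Longrightarrow> f x = g x"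
    using assms unfolding C0_infinity_Rplus_def by blast
  obtain G where G: "G 0 = g" "derivs_on UNIV G" using g(1) unfolding smooth_real_iff by blast
  have "bounded {x. g x \<noteq> 0}"
    by (rule bounded_subset[OF compact_imp_bounded[OF g(2)] closure_subset])
  then obtain b where b: "\<And>x. g x \<noteq> 0 \<Longrightarrow> \<bar>x\<bar> \<le> b" unfolding bounded_iff by (metis mem_Collect_eq real_norm_def)
  have zero: "G i x = 0" if "b < x" for i x
  proof (rule derivs_on_zero[OF G(2), of "{b<..}"])
    show "G 0 x = 0" if "x \<in> {b<..}" for x using b[of x] G(1) that by force
  qed (use that in auto)
  have "\<exists>B. \<forall>x>0. norm (G i x) \<le> B" for i
  proof -
    obtain B where B: "0 \<le> B" "\<And>x. x \<in> {0..b} \<Longrightarrow> norm (G i x) \<le> B"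
      using continuous_bound_exists[OF compact_Icc continuous_on_subset[OF derivs_on_continuous[OF G(2)]]] by blast
    have "norm (G i x) \<le> B" if "0 < x" for x
      using B zero[of x i] that by (cases "x \<le> b") auto
    then show ?thesis by blast
  qed
  then show thesis by (intro that[OF G(2)]) (use G(1) g(3) in auto)
qed

lemma partials_upto_expansion:
  assumes "\<And>\<alpha> k. (\<alpha>, k) \<in> I \<Longrightarrow> derivs_on A (g \<alpha> k)" "B \<subseteq> {0<..}"
  shows "partials_upto n A B (expansion I g 0 0) (expansion I g)"
  unfolding expansion_def[abs_def]
proof (rule partials_upto_sum)
  fix z assume z: "z \<in> I"
  obtain \<alpha> k where ze: "z = (\<alpha>, k)" by (cases z)
  show "partials_upto n A B (\<lambda>x y. case z of (\<alpha>, k) \<Rightarrow> powr_ln \<alpha> k 0 y * g \<alpha> k 0 x)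
      (\<lambda>i j x y. case z of (\<alpha>, k) \<Rightarrow> powr_ln \<alpha> k j y * g \<alpha> k i x)"
    using partials_upto_tensor[OF assms(1) derivs_on_subset[OF derivs_on_powr_ln assms(2)], of \<alpha> k n \<alpha> k] z
    unfolding ze by (simp add: mult.commute)
qed

text \<open>Only finitely many elements have Re \<alpha> \<le> 0. The bound makes the growth
  exponent of the partial sums independent of the number of terms.\<close>

lemma index_set_Re_bounded_below:
  assumes "index_set K"
  obtains m where "\<And>z. z \<in> K \<Longrightarrow> m < Re (fst z)"
proof (rule that)
  let ?A = "insert 0 ((\<lambda>z. Re (fst z)) ` upto_order K 0)"
  fix z assume z: "z \<in> K"
  have fin: "finite ?A" using finite_upto_order[OF assms] by simp
  show "Min ?A - 1 < Re (fst z)"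
  proof (cases "Re (fst z) \<le> 0")
    case True
    then have "Re (fst z) \<in> ?A" using z by (force simp: upto_order_def)
    then show ?thesis using Min_le[OF fin, of "Re (fst z)"] by linarith
  next
    case False
    then show ?thesis using Min_le[OF fin, of 0] by simp
  qed
qed

lemma smooth_sigma:
  assumes "smooth_in_interior u"
  obtains S where "\<And>n. partials_upto n {0<..} {0<..} (sigma u) S"
proof -
  obtain D where D: "\<And>n. partials_upto n {0<..} {0<..} (coefA u) D"
    using assms unfolding smooth_in_interior_def smooth_on_prod_def by blast
  \<comment> \<open>\<open>powr_ln (-1) 0\<close> is 1 / x together with its derivatives.\<close>
  define U where "U i j x y = leibniz (powr_ln (-1) 0) (\<lambda>i x. D i j x y) i x" for i j x y
  have "partials_upto n {0<..} {0<..} (\<lambda>x y. powr_ln (-1) 0 0 x * coefA u x y) U" for n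
    unfolding U_def by (rule partials_upto_mult[OF D derivs_on_powr_ln])
  from partials_upto_inverse[OF this, of "{0<..}"]
  have "partials_upto n {0<..} {0<..} (\<lambda>x \<zeta>. powr_ln (-1) 0 0 x * coefA u x (1 / \<zeta>)) (inv_partial U)" for n
    by simp
  then have "partials_upto n {0<..} {0<..} (sigma u) (inv_partial U)" for n
    by (rule partials_upto_subset) (auto simp: sigma_def powr_ln_0 powr_minus_divide)
  then show thesis by (rule that)
qed

lemma nth_deriv_partials:
  assumes "\<And>n. partials_upto n {0<..} {0<..} f D" "0 < x" "0 < y"
  shows "nth_deriv {0<..} i (\<lambda>x. nth_deriv {0<..} j (f x) y) x = D i j x y"
proof (rule nth_deriv_eq[where D = "\<lambda>i x. D i j x y"])
  show "derivs_on {0<..} (\<lambda>i x. D i j x y)"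
    by (rule derivs_on_partials_x[OF assms(1)]) (use assms(3) in simp)
  show "D 0 j x y = nth_deriv {0<..} j (f x) y" if "x \<in> {0<..}" for x
  proof (rule nth_deriv_eq[where D = "\<lambda>j y. D 0 j x y", symmetric])
    show "derivs_on {0<..} (\<lambda>j y. D 0 j x y)"
      by (rule derivs_on_partials_y[OF assms(1) that])
    show "D 0 0 x s = f x s" if "s \<in> {0<..}" for s
      using partials_uptoD(1)[OF assms(1)] \<open>x \<in> {0<..}\<close> that by blast
  qed (use assms in \<open>auto simp: at_within_gt0\<close>)
qed (use assms in \<open>auto simp: at_within_gt0\<close>)

lemma phg_corner_if_complete_asymptotics:
  assumes u: "smooth_in_interior u" and K: "index_set K" and temp: "tempered_derivatives u"
    and asym: "complete_asymptotics K u"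
  shows "phg_corner {0..} {0..<1} K (coefA u)"
proof -
  obtain S where S: "\<And>n. partials_upto n {0<..} {0<..} (sigma u) S"
    using smooth_sigma[OF u] by blast
  define V where "V = inv_partial S"
  have V: "partials_upto n {0<..} {0<..<1} (\<lambda>x y. sigma u x (1 / y)) V" for n
    unfolding V_def by (rule partials_upto_inverse[OF S]) auto
  \<comment> \<open>Passing from \<zeta> to y = 1 / \<zeta> multiplies the derivatives by powers of
    1 / y, so polynomial growth is preserved.\<close>
  have V_order: "\<exists>m. order_above m (V i j)" for i j
    unfolding V_def inv_partial_def[abs_def]
  proof (rule order_above_sum_exists)
    fix l
    obtain C M where C: "\<forall>x>0. \<forall>\<zeta>>1. norm (nth_deriv {0<..} i (\<lambda>x. nth_deriv {0<..} l (sigma u x) \<zeta>) x) \<le> C * \<zeta> powr M"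
      using temp unfolding tempered_derivatives_def by blast
    have "order_above (- M - 1) (\<lambda>x y. S i l x (1 / y))"
    proof (rule order_aboveI)
      fix x y :: real assume xy: "0 < x" "0 < y" "y < 1"
      have "norm (S i l x (1 / y)) \<le> C * (1 / y) powr M"
        using C[rule_format, of x "1 / y"] nth_deriv_partials[OF S, of x "1 / y" i l] xy by simp
      then show "norm (S i l x (1 / y)) \<le> C * y powr (- M)"
        using xy by (simp add: powr_divide powr_minus_divide)
    qed simp
    from order_above_divide_power[OF this]
    show "\<exists>m. order_above m (\<lambda>x y. of_real (invc j l / y ^ (j + l)) * S i l x (1 / y))" by blast
  qed simp
  have "\<exists>C. \<forall>x>0. \<forall>y\<in>{a..b}. norm (V i j x y) \<le> C" if "0 < a" "b < 1" for i j a b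
    using order_above_bounded[OF _ that] V_order by blast
  from smooth_extension_at_0[OF V this]
  obtain E where E: "\<And>n. partials_upto n {0..} {0<..<1} (E 0 0) E"
    and EV: "\<And>i j x y. 0 < x \<Longrightarrow> E i j x y = V i j x y"
    by blast
  have E_sigma: "E 0 0 x y = sigma u x (1 / y)" if "0 < x" "y \<in> {0<..<1}" for x y
    using EV[OF that(1)] partials_uptoD(1)[OF V[of 0]] that by auto
  have E_order: "\<exists>m. order_above m (E i j)" for i j
    using V_order[of i j] EV order_above_cong[of _ "V i j" "E i j"] by metis
  obtain s where s: "\<And>\<alpha> k. (\<alpha>, k) \<in> K \<Longrightarrow> s \<alpha> k \<in> C0_infinity_Rplus"
    and est: "\<And>N i. \<exists>C. \<forall>x>0. \<forall>\<zeta>>1. norm (nth_deriv {0<..} i (\<lambda>x. sigma u x \<zeta> -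
       (\<Sum>(\<alpha>, k)\<in>upto_order K N. of_real \<zeta> powr (- \<alpha>) * of_real (ln \<zeta>) ^ k * s \<alpha> k x)) x) \<le> C * \<zeta> powr (- real N)"
    using asym unfolding complete_asymptotics_def by blast
  have "\<exists>G. derivs_on UNIV G \<and> (\<forall>x\<ge>0. s (fst z) (snd z) x = G 0 x) \<and> (\<forall>i. \<exists>B. \<forall>x>0. norm (G i x) \<le> B)"
    if "z \<in> K" for z
    using s[of "fst z" "snd z"] that by (metis C0_infinity_Rplus_derivs prod.collapse)
  then obtain G where G: "\<And>z. z \<in> K \<Longrightarrow> derivs_on UNIV (G z) \<and> (\<forall>x\<ge>0. s (fst z) (snd z) x = G z 0 x) \<and>
      (\<forall>i. \<exists>B. \<forall>x>0. norm (G z i x) \<le> B)" by metis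
  define g where "g \<alpha> k i x = (-1) ^ k * G (\<alpha>, k) i x" for \<alpha> k i x
  have g: "derivs_on UNIV (g \<alpha> k)" if "(\<alpha>, k) \<in> K" for \<alpha> k
    using G[OF that] unfolding derivs_on_def g_def by (auto intro!: has_vector_derivative_mult_right)
  have g_bounded: "\<exists>B. \<forall>x>0. norm (g \<alpha> k i x) \<le> B" if "(\<alpha>, k) \<in> K" for \<alpha> k i
    using G[OF that] by (simp add: g_def norm_mult norm_power)
  have g_s: "s \<alpha> k x = (-1) ^ k * g \<alpha> k 0 x" if "(\<alpha>, k) \<in> K" "0 \<le> x" for \<alpha> k x
    using G[OF that(1)] that(2) by (simp add: g_def flip: power_mult_distrib mult.assoc)
  \<comment> \<open>The remainder of u / x after the terms up to order N, with all mixed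
    derivatives, up to x = 0.\<close>
  define \<Phi> where "\<Phi> N i j x y = E i j x y - expansion (upto_order K N) g i j x y" for N i j x y
  have \<Phi>: "partials_upto n {0..} {0<..<1} (\<Phi> N 0 0) (\<Phi> N)" for n N
    unfolding \<Phi>_def[abs_def]
    by (intro partials_upto_diff E partials_upto_expansion derivs_on_subset[OF g])
      (use upto_order_subset in auto)
  have term_order: "order_above m (\<lambda>x y. case z of (\<alpha>, k) \<Rightarrow> powr_ln \<alpha> k j y * g \<alpha> k i x)"
    if z: "z \<in> K" "m < Re (fst z) - real j" for m z i j
  proof -
    obtain \<alpha> k where ze: "z = (\<alpha>, k)" by (cases z)
    obtain B where "\<And>x. 0 < x \<Longrightarrow> norm (g \<alpha> k i x) \<le> B" using g_bounded z ze by blast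
    then show ?thesis using order_above_powr_ln[of m \<alpha> j "g \<alpha> k i" B k] z by (simp add: ze)
  qed
  obtain mK where mK: "\<And>z. z \<in> K \<Longrightarrow> mK < Re (fst z)"
    using index_set_Re_bounded_below[OF K] by blast
  \<comment> \<open>The quantifier order matters: m is found before N, from the growth of E and the
    lower bound \<open>mK\<close> of the exponents.\<close>
  have \<Phi>_tempered: "\<exists>m. \<forall>N. order_above m (\<Phi> N i j)" for i j
  proof -
    obtain m where m: "order_above m (E i j)" using E_order by blast
    have "order_above (min m (mK - real j)) (\<Phi> N i j)" for N
      unfolding \<Phi>_def expansion_def
    proof (intro order_above_diff order_above_sum finite_upto_order K order_above_mono[OF m])
      fix z assume "z \<in> upto_order K N"
      then have "z \<in> K" using upto_order_subset by blast
      then show "order_above (min m (mK - real j)) (\<lambda>x y. case z of (\<alpha>, k) \<Rightarrow> powr_ln \<alpha> k j y * g \<alpha> k i x)"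
        using mK[of z] by (intro term_order) auto
    qed simp
    then show ?thesis by blast
  qed
  \<comment> \<open>This is the estimate in the complete asymptotics, carried over to y = 1 /
    \<zeta>; P < N gives the strictness that \<open>order_above\<close> asks for.\<close>
  have \<Phi>_base: "order_above P (\<Phi> N i 0)" if "P < real N" for P N i
  proof -
    obtain C where C: "\<forall>x>0. \<forall>\<zeta>>1. norm (nth_deriv {0<..} i (\<lambda>x. sigma u x \<zeta> -
       (\<Sum>(\<alpha>, k)\<in>upto_order K N. of_real \<zeta> powr (- \<alpha>) * of_real (ln \<zeta>) ^ k * s \<alpha> k x)) x) \<le> C * \<zeta> powr (- real N)"
      using est[where N=N and i=i] by blast
    show ?thesis
    proof (rule order_aboveI[OF that])
      fix x y :: real assume xy: "0 < x" "0 < y" "y < 1"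
      have "derivs_on {0..} (\<lambda>i x. \<Phi> N i 0 x y)"
        by (rule derivs_on_partials_x[OF \<Phi>]) (use xy in simp)
      then have D: "derivs_on {0<..} (\<lambda>i x. \<Phi> N i 0 x y)"
        by (rule derivs_on_subset) auto
      have eq: "\<Phi> N 0 0 x y = sigma u x (1 / y) - (\<Sum>(\<alpha>, k)\<in>upto_order K N.
          of_real (1 / y) powr (- \<alpha>) * of_real (ln (1 / y)) ^ k * s \<alpha> k x)" if "0 < x" for x
      proof -
        have "expansion (upto_order K N) g 0 0 x y = (\<Sum>(\<alpha>, k)\<in>upto_order K N.
          of_real (1 / y) powr (- \<alpha>) * of_real (ln (1 / y)) ^ k * s \<alpha> k x)"
          unfolding expansion_def
        proof (rule sum.cong[OF refl])
          fix z assume "z \<in> upto_order K N"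
          then have zK: "z \<in> K" using upto_order_subset by blast
          obtain \<alpha> k where ze: "z = (\<alpha>, k)" by (cases z)
          have "s \<alpha> k x = (-1) ^ k * g \<alpha> k 0 x" using g_s zK that unfolding ze by simp
          then show "(case z of (\<alpha>, k) \<Rightarrow> powr_ln \<alpha> k 0 y * g \<alpha> k 0 x) = (case z of (\<alpha>, k) \<Rightarrow>
            of_real (1 / y) powr (- \<alpha>) * of_real (ln (1 / y)) ^ k * s \<alpha> k x)"
            unfolding ze prod.case powr_ln_inverse[OF xy(2)] by (simp add: mult_ac)
        qed
        then show ?thesis using E_sigma[OF that, of y] xy by (simp add: \<Phi>_def)
      qed
      have "nth_deriv {0<..} i (\<lambda>x. sigma u x (1 / y) - (\<Sum>(\<alpha>, k)\<in>upto_order K N.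
          of_real (1 / y) powr (- \<alpha>) * of_real (ln (1 / y)) ^ k * s \<alpha> k x)) x = \<Phi> N i 0 x y"
        by (rule nth_deriv_eq[OF D]) (use eq xy in \<open>auto simp: at_within_gt0\<close>)
      moreover have "(1 / y) powr (- real N) = y powr real N" using xy by (simp add: powr_divide powr_minus_divide)
      ultimately show "norm (\<Phi> N i 0 x y) \<le> C * y powr real N"
        using C[rule_format, of x "1 / y"] xy by simp
    qed
  qed
  \<comment> \<open>Induction on the y-order: j + 1 lies between j, where the decay is fast for
    large N, and j + 2, where the growth is bounded independently of N.\<close>
  have \<Phi>_order: "\<exists>N0. \<forall>N\<ge>N0. order_above P (\<Phi> N i j)" for i j P
  proof (induction j arbitrary: P)
    case 0
    obtain N0 where "P < real N0" using reals_Archimedean2 by blast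
    then show ?case by (intro exI[of _ N0] allI impI \<Phi>_base) simp
  next
    case (Suc j)
    define P' where "P' = max P 0"
    obtain m where m: "\<And>N. order_above m (\<Phi> N i (Suc (Suc j)))" using \<Phi>_tempered by blast
    define M where "M = max (- m) 0"
    obtain N0 where N0: "\<And>N. N0 \<le> N \<Longrightarrow> order_above (2 * P' + M + 3) (\<Phi> N i j)"
      using Suc.IH by blast
    have "order_above P (\<Phi> N i (Suc j))" if "N0 \<le> N" for N
    proof (rule order_above_mono)
      show "order_above P' (\<Phi> N i (Suc j))"
      proof (rule order_above_interpolate[where f = "\<Phi> N i j" and ?f2.0 = "\<Phi> N i (Suc (Suc j))" and M = M])
        show "(\<Phi> N i j' x has_vector_derivative \<Phi> N i (Suc j') x y) (at y within {0<..<1})"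
          if "0 < x" "y \<in> {0<..<1}" for x y j'
          by (rule partials_uptoD(4)[OF \<Phi>[of "Suc (i + j')"]]) (use that in auto)
        then show "(\<Phi> N i (Suc j) x has_vector_derivative \<Phi> N i (Suc (Suc j)) x y) (at y within {0<..<1})"
          if "0 < x" "y \<in> {0<..<1}" for x y using that by blast
        show "order_above (- M) (\<Phi> N i (Suc (Suc j)))"
          by (rule order_above_mono[OF m]) (simp add: M_def)
      qed (use N0[OF that] in \<open>auto simp: M_def P'_def\<close>)
    qed (simp add: P'_def)
    then show ?case by blast
  qed
  \<comment> \<open>The decay known for many terms descends to N, since the terms in between have Re
    \<alpha> > N, and so their j-th y-derivatives have order above N - j.\<close>
  have \<Phi>_vanish: "order_above (real N - real j) (\<Phi> N i j)" for N i j
  proof -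
    obtain N0 where "\<And>N'. N0 \<le> N' \<Longrightarrow> order_above (real N - real j) (\<Phi> N' i j)"
      using \<Phi>_order by blast
    then have 1: "order_above (real N - real j) (\<Phi> (max N N0) i j)" by simp
    let ?J = "upto_order K (max N N0) - upto_order K N"
    have "order_above (real N - real j) (\<lambda>x y. \<Sum>z\<in>?J. case z of (\<alpha>, k) \<Rightarrow> powr_ln \<alpha> k j y * g \<alpha> k i x)"
    proof (rule order_above_sum)
      fix z assume "z \<in> ?J"
      then have "z \<in> K" "real N < Re (fst z)" by (auto simp: upto_order_def)
      then show "order_above (real N - real j) (\<lambda>x y. case z of (\<alpha>, k) \<Rightarrow> powr_ln \<alpha> k j y * g \<alpha> k i x)"
        by (intro term_order) auto
    qed (use finite_upto_order[OF K] in simp)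
    from order_above_add[OF 1 this] show ?thesis
    proof (rule order_above_cong)
      fix x y :: real
      have "(\<Sum>z\<in>?J. case z of (\<alpha>, k) \<Rightarrow> powr_ln \<alpha> k j y * g \<alpha> k i x) =
         expansion (upto_order K (max N N0)) g i j x y - expansion (upto_order K N) g i j x y"
        using expansion_diff[OF K, of N "max N N0"] by (simp add: expansion_def)
      then show "\<Phi> (max N N0) i j x y + (\<Sum>z\<in>?J. case z of (\<alpha>, k) \<Rightarrow> powr_ln \<alpha> k j y * g \<alpha> k i x) = \<Phi> N i j x y"
        by (simp add: \<Phi>_def)
    qed
  qed
  \<comment> \<open>The function x with its derivatives, which turns the remainder of u / x into
    that of u.\<close>
  define X where "X i x = (if i = 0 then of_real x else if i = 1 then 1 else 0 :: complex)" for i :: nat and x :: real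
  have X: "derivs_on {0..} X"
    unfolding derivs_on_def
  proof (intro allI ballI)
    fix n and x :: real
    show "(X n has_vector_derivative X (Suc n) x) (at x within {0..})"
    proof (cases n)
      case 0
      have "((\<lambda>x. complex_of_real x) has_vector_derivative of_real 1) (at x within {0..})"
        by (rule has_vector_derivative_of_real) simp
      then show ?thesis by (simp add: 0 X_def[abs_def])
    qed (simp add: X_def[abs_def])
  qed
  have u_E: "coefA u x y = of_real x * E 0 0 x y" if "0 < x" "0 < y" "y < 1" for x y
    using E_sigma[of x y] that by (simp add: sigma_def)
  show ?thesis
    unfolding phg_corner_def
  proof (intro conjI exI[of _ "\<lambda>\<alpha> k x. of_real x * g \<alpha> k 0 x"] allI)
    have "partials_upto n {0..} ({0..<1} \<inter> {0<..}) (E 0 0) E" for n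
      by (rule partials_upto_subset[OF E]) auto
    then show "phg_face3 {0..} {0..<1} (coefA u)"
      unfolding phg_face3_def smooth_on_prod_def by (intro exI[of _ "E 0 0"]) (use u_E in auto)
    show "\<forall>(\<alpha>, k)\<in>K. \<exists>h. smooth_real h \<and> (\<forall>x\<in>{0..}. of_real x * g \<alpha> k 0 x = of_real x * h x)"
      using g unfolding smooth_real_iff by blast
    fix N
    let ?f = "\<lambda>x y. if y = 0 then 0 else \<Phi> N 0 0 x y"
    let ?D = "\<lambda>i j x y. if y = 0 then 0 else \<Phi> N i j x y"
    let ?R = "\<lambda>x y. X 0 x * ?f x y"
    let ?DR = "\<lambda>i j x y. leibniz X (\<lambda>i x. ?D i j x y) i x"
    \<comment> \<open>The order N - j is at least 0 for i + j \<le> N and at least 1 for i + j < N,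
      as the extension by zero requires.\<close>
    have "partials_upto N {0..} {0..<1} ?f ?D"
    proof (rule partials_upto_extend_by_zero[OF \<Phi>])
      show "order_above 0 (\<Phi> N i j)" if "i + j \<le> N" for i j
        by (rule order_above_mono[OF \<Phi>_vanish]) (use that in simp)
      show "order_above 1 (\<Phi> N i j)" if "i + j < N" for i j
        by (rule order_above_mono[OF \<Phi>_vanish]) (use that in linarith)
    qed
    from partials_upto_mult[OF this X]
    have "partials_upto N {0..} {0..<1} ?R ?DR" .
    moreover have "coefA u x y - (\<Sum>(\<alpha>, k)\<in>upto_order K N. of_real y powr \<alpha> * of_real (ln y) ^ k * (of_real x * g \<alpha> k 0 x)) = ?R x y"
      if "0 < x" "0 < y" "y < 1" for x y
    proof -
      have "(\<Sum>(\<alpha>, k)\<in>upto_order K N. of_real y powr \<alpha> * of_real (ln y) ^ k * (of_real x * g \<alpha> k 0 x))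
        = of_real x * expansion (upto_order K N) g 0 0 x y"
        unfolding expansion_def sum_distrib_left
        by (rule sum.cong[OF refl]) (auto simp: powr_ln_0)
      then show ?thesis using that by (simp add: u_E \<Phi>_def X_def right_diff_distrib)
    qed
    ultimately show "\<exists>R D. partials_upto N {0..} {0..<1} R D \<and> (\<forall>x\<in>{0..}. \<forall>j<N. D 0 j x 0 = 0) \<and>
        (\<forall>x\<in>{0..}. \<forall>y\<in>{0..<1}. x > 0 \<longrightarrow> y > 0 \<longrightarrow> coefA u x y -
          (\<Sum>(\<alpha>, k)\<in>upto_order K N. of_real y powr \<alpha> * of_real (ln y) ^ k * (of_real x * g \<alpha> k 0 x)) = R x y)"
      by (intro exI[of _ ?R] exI[of _ ?DR] conjI) auto
  qed
qed

theorem proposition5p1: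
  fixes u :: "real \<times> real \<Rightarrow> complex" and K1 K2 :: "(complex \<times> nat) set"
  assumes "index_set K1" and "index_set K2"
    and "compactly_supported u" and "smooth_in_interior u"
  shows "is_pushforward u (\<lambda>t. LINT x:{0<..}|lborel. sigma u x (x / t)) \<and>
    (sigma_smooth u \<longleftrightarrow> phg_face3 {0..} {0..} (coefA u)) \<and>
    (tempered_derivatives u \<longrightarrow>
       (complete_asymptotics K1 u \<longleftrightarrow> phg_corner {0..} {0..<1} K1 (coefA u))) \<and>
    (phg_corner {0..} {0..1} K1 (coefA u) \<longrightarrow> complete_asymptotics K1 u) \<and>
    (phg_X K1 K2 u \<and> minimal_at_G2 K2 u \<longrightarrow>
       (integral_condition u \<longleftrightarrow> (\<forall>(\<alpha>, k)\<in>K2. Re \<alpha> > 0))) \<and>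
    (phg_X K1 K2 u \<and> (\<forall>(\<alpha>, k)\<in>K2. Re \<alpha> > 0) \<longrightarrow> integral_condition u)"
proof -
  have corner2: "phg_corner {0..} {0..} K2 (\<lambda>t \<zeta>. coefB u \<zeta> t)" if "phg_X K1 K2 u"
    using that by (simp add: phg_X_def)
  have "integral_condition u" if "phg_X K1 K2 u" "\<forall>(\<alpha>, k)\<in>K2. Re \<alpha> > 0"
    using integral_condition_if_positive[OF corner2[OF that(1)] assms(2)] that(2) by fastforce
  moreover have "\<forall>(\<alpha>, k)\<in>K2. Re \<alpha> > 0" if "phg_X K1 K2 u" "minimal_at_G2 K2 u" "integral_condition u"
    using integral_condition_imp_positive[OF corner2[OF that(1)] assms(2) that(2,3)] by fastforce
  ultimately show ?thesis
    using is_pushforward_sigma sigma_smooth_iff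
      phg_corner_if_complete_asymptotics[OF assms(4,1)] complete_asymptotics_if_tempered[OF _ assms(1,3)]
      complete_asymptotics_if_closed_corner[OF _ assms(1,3)]
    by blast
qed

end
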